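(* Let $f(\cos\theta,\sin\theta)$ be a $2\pi$-periodic function restricted to an arc $\Omega_h=\{(x,y):x^2+y^2=1,\ x\ge h\}$, $|h|<1$, and let $\cos\varphi=h$, $\varphi\in(0,\pi)$. Suppose that $f$ (as a function of $\theta$) is analytic in $[-\varphi,\varphi]$ and is analytically continuable, as a $2\pi$-periodic function, to the region $$D_h(\rho)=\Big\{\theta\in\mathbb C:\ \cos\theta\in E^{(1+h)/2}_{\rho(1-h)/2,[h,1]}\Big\},$$ where $\rho>1$, and that $f$ is bounded in $D_h(\rho)$. Then for every $b\ge-1$ $$\big\|f-S_n^{(b,h)}[f]\big\|_{(b,h)}=\mathcal O(\rho^{-n})\quad\text{as }n\to\infty.$$ Similarly, all the coefficients in the expansion are $\mathcal O(\rho^{-n})$ as $n\to\infty$, i.e. $\hat f_{n1}=\mathcal O(\rho^{-n})$ and $\hat f_{n2}=\mathcal O(\rho^{-n})$.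
   Context: Ellipse: $E^{(1+h)/2}_{\rho(1-h)/2,[h,1]}\subset\mathbb C$ is the open ellipse with foci $h$ and $1$, centre $(1+h)/2$, whose semimajor and semiminor axis lengths sum to $\rho(1-h)/2$. Semiclassical Jacobi polynomials: for $t>1$, $a,b>-1$, $c\in\mathbb R$, let $w^{t,(a,b,c)}(x)=x^a(1-x)^b(t-x)^c$; $P_n^{t,(a,b,c)}$ ($n\ge0$, degree exactly $n$) are the orthogonal polynomials on $[0,1]$ with weight $w^{t,(a,b,c)}$, normalised so that $P_0=1$ and all have the same norm as $1$. For $b=-1$: $P_0^{t,(a,-1,c)}=1$ and $P_n^{t,(a,-1,c)}(x)=(1-x)P_{n-1}^{t,(a,1,c)}(x)$, $n\ge1$. Arc polynomials: with $\tau=2/(1-h)$, $\sigma=(x-1)/(h-1)$: $p_n=p_n^{(b,h)}(x,y)=P_n^{\tau,(-1/2,b,-1/2)}(\sigma)$ ($n\ge0$), $q_n=q_n^{(b,h)}(x,y)=yP_{n-1}^{\tau,(1/2,b,1/2)}(\sigma)$ ($n\ge1$). Inner product and norm: $\langle f,g\rangle^{(b,h)}=\int_{-\varphi}^{\varphi}f(\cos\theta,\sin\theta)g(\cos\theta,\sin\theta)(\cos\theta-h)^b\,d\theta$, $\|f\|_{(b,h)}^2=\langle f,f\rangle^{(b,h)}$. Partial sums: $S_n^{(b,h)}[f]=\hat f_0p_0+\sum_{j=1}^n[\hat f_{j1}q_j+\hat f_{j2}p_j]$. For $b>-1$: $\hat f_0=\langle f,p_0\rangle/\|p_0\|^2$,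 $\hat f_{j1}=\langle f,q_j\rangle/\|q_j\|^2$, $\hat f_{j2}=\langle f,p_j\rangle/\|p_j\|^2$ (inner products $\langle\cdot,\cdot\rangle^{(b,h)}$). For $b=-1$ the coefficients are those of the expansion of $f$ in the $b=-1$ basis: writing $f=f_e(x)+yf_o(x)$ on the arc with $f_e(x)=\frac12[f(x,\sqrt{1-x^2})+f(x,-\sqrt{1-x^2})]$, $f_o(x)=[f(x,\sqrt{1-x^2})-f(x,-\sqrt{1-x^2})]/(2\sqrt{1-x^2})$, and $\zeta=1+(h-1)\sigma$, one has $\hat f_0=f_e(h)$, $\hat f_{11}=f_o(h)$, $\hat f_{j2}$ ($j\ge1$) is the coefficient of $P_{j-1}^{\tau,(-1/2,1,-1/2)}$ in the orthogonal expansion of $\sigma\mapsto (f_e(\zeta)-f_e(h))/(1-\sigma)$ in the polynomials $P_k^{\tau,(-1/2,1,-1/2)}$, and $\hat f_{j1}$ ($j\ge2$) is the coefficient of $P_{j-2}^{\tau,(1/2,1,1/2)}$ in the orthogonal expansion of $(f_o(\zeta)-f_o(h))/(1-\sigma)$ in the polynomials $P_k^{\tau,(1/2,1,1/2)}$. *)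

theory Defs
  imports "HOL-Analysis.Analysis" "HOL-Library.Landau_Symbols"
    "HOL-Computational_Algebra.Polynomial"
begin

text \<open>The open ellipse with foci \<open>p\<close>, \<open>q\<close> whose semimajor axis \<open>A\<close> and semiminor axis \<open>B\<close>
  have sum \<open>s\<close>. For \<open>s > dist p q / 2\<close> the pair \<open>A, B\<close> exists and is unique.\<close>

definition open_ellipse :: "complex \<Rightarrow> complex \<Rightarrow> real \<Rightarrow> complex set" where
  "open_ellipse p q s =
     {z. \<exists>A B. 0 < B \<and> B \<le> A \<and> A + B = s \<and> A\<^sup>2 - B\<^sup>2 = (dist p q / 2)\<^sup>2 \<and>
               dist z p + dist z q < 2 * A}"

definition arc_region :: "real \<Rightarrow> real \<Rightarrow> complex set" where
  "arc_region h \<rho> =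
     {\<theta>. cos \<theta> \<in> open_ellipse (complex_of_real h) 1 (\<rho> * (1 - h) / 2)}"


definition sj_weight :: "real \<Rightarrow> real \<Rightarrow> real \<Rightarrow> real \<Rightarrow> real \<Rightarrow> real" where
  "sj_weight t a b c x = x powr a * (1 - x) powr b * (t - x) powr c"

definition sj_inner ::
    "real \<Rightarrow> real \<Rightarrow> real \<Rightarrow> real \<Rightarrow> (real \<Rightarrow> real) \<Rightarrow> (real \<Rightarrow> real) \<Rightarrow> real" where
  "sj_inner t a b c u v = (LINT x:{0..1}|lborel. u x * v x * sj_weight t a b c x)"

definition sj_family :: "real \<Rightarrow> real \<Rightarrow> real \<Rightarrow> real \<Rightarrow> (nat \<Rightarrow> real poly) \<Rightarrow> bool" where
  "sj_family t a b c P \<longleftrightarrow>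
     P 0 = 1 \<and>
     (\<forall>n. degree (P n) = n) \<and>
     (\<forall>m n. m \<noteq> n \<longrightarrow> sj_inner t a b c (poly (P m)) (poly (P n)) = 0) \<and>
     (\<forall>n. sj_inner t a b c (poly (P n)) (poly (P n)) = sj_inner t a b c (\<lambda>x. 1) (\<lambda>x. 1))"

text \<open>For \<open>t > 1\<close>, \<open>a, b > -1\<close> the normalisation determines each polynomial of positive degree
  only up to its sign; the choice operator leaves these signs unspecified. The case \<open>b = -1\<close>
  is not an orthogonal family and is defined through \<open>b = 1\<close>.\<close>

definition semiclassical_jacobi :: "real \<Rightarrow> real \<Rightarrow> real \<Rightarrow> real \<Rightarrow> nat \<Rightarrow> real poly" where
  "semiclassical_jacobi t a b c n =
     (if b = -1
      then (if n = 0 then 1 else [:1, -1:] * (SOME P. sj_family t a 1 c P) (n - 1))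
      else (SOME P. sj_family t a b c P) n)"

definition sj_coeff ::
    "real \<Rightarrow> real \<Rightarrow> real \<Rightarrow> real \<Rightarrow> (real \<Rightarrow> real) \<Rightarrow> nat \<Rightarrow> real" where
  "sj_coeff t a b c u k =
     (let P = poly (semiclassical_jacobi t a b c k)
      in sj_inner t a b c u P / sj_inner t a b c P P)"


definition arc_tau :: "real \<Rightarrow> real" where
  "arc_tau h = 2 / (1 - h)"

definition arc_p :: "real \<Rightarrow> real \<Rightarrow> nat \<Rightarrow> real \<Rightarrow> real \<Rightarrow> real" where
  "arc_p b h n x y =
     poly (semiclassical_jacobi (arc_tau h) (-1/2) b (-1/2) n) ((x - 1) / (h - 1))"

text \<open>Meaningful only for \<open>n \<ge> 1\<close>.\<close>

definition arc_q :: "real \<Rightarrow> real \<Rightarrow> nat \<Rightarrow> real \<Rightarrow> real \<Rightarrow> real" where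
  "arc_q b h n x y =
     y * poly (semiclassical_jacobi (arc_tau h) (1/2) b (1/2) (n - 1)) ((x - 1) / (h - 1))"

definition arc_inner ::
    "real \<Rightarrow> real \<Rightarrow> (real \<Rightarrow> real \<Rightarrow> real) \<Rightarrow> (real \<Rightarrow> real \<Rightarrow> real) \<Rightarrow> real" where
  "arc_inner b h f g =
     (LINT \<theta>:{- arccos h..arccos h}|lborel.
        f (cos \<theta>) (sin \<theta>) * g (cos \<theta>) (sin \<theta>) * (cos \<theta> - h) powr b)"

definition arc_norm :: "real \<Rightarrow> real \<Rightarrow> (real \<Rightarrow> real \<Rightarrow> real) \<Rightarrow> real" where
  "arc_norm b h f = sqrt (arc_inner b h f f)"


definition arc_even :: "(real \<Rightarrow> real \<Rightarrow> real) \<Rightarrow> real \<Rightarrow> real" where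
  "arc_even f x = (f x (sqrt (1 - x\<^sup>2)) + f x (- sqrt (1 - x\<^sup>2))) / 2"

definition arc_odd :: "(real \<Rightarrow> real \<Rightarrow> real) \<Rightarrow> real \<Rightarrow> real" where
  "arc_odd f x = (f x (sqrt (1 - x\<^sup>2)) - f x (- sqrt (1 - x\<^sup>2))) / (2 * sqrt (1 - x\<^sup>2))"

text \<open>The division by zero at \<open>s = 1\<close> (and, for odd parts, inside \<open>u\<close> at \<open>s = 0\<close>) is harmless:
  the quotient is only ever integrated.\<close>

definition arc_quotient :: "real \<Rightarrow> (real \<Rightarrow> real) \<Rightarrow> real \<Rightarrow> real" where
  "arc_quotient h u s = (u (1 + (h - 1) * s) - u h) / (1 - s)"

definition arc_coeff_0 :: "real \<Rightarrow> real \<Rightarrow> (real \<Rightarrow> real \<Rightarrow> real) \<Rightarrow> real" where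
  "arc_coeff_0 b h f =
     (if b = -1 then arc_even f h
      else arc_inner b h f (arc_p b h 0) / (arc_norm b h (arc_p b h 0))\<^sup>2)"

text \<open>\<open>arc_coeff_1\<close> and \<open>arc_coeff_2\<close> are the coefficients of \<open>arc_q\<close> and \<open>arc_p\<close>, respectively,
  for indices \<open>j \<ge> 1\<close>.\<close>

definition arc_coeff_1 :: "real \<Rightarrow> real \<Rightarrow> (real \<Rightarrow> real \<Rightarrow> real) \<Rightarrow> nat \<Rightarrow> real" where
  "arc_coeff_1 b h f j =
     (if b = -1
      then (if j = 1 then arc_odd f h
            else sj_coeff (arc_tau h) (1/2) 1 (1/2) (arc_quotient h (arc_odd f)) (j - 2))
      else arc_inner b h f (arc_q b h j) / (arc_norm b h (arc_q b h j))\<^sup>2)"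

definition arc_coeff_2 :: "real \<Rightarrow> real \<Rightarrow> (real \<Rightarrow> real \<Rightarrow> real) \<Rightarrow> nat \<Rightarrow> real" where
  "arc_coeff_2 b h f j =
     (if b = -1
      then sj_coeff (arc_tau h) (-1/2) 1 (-1/2) (arc_quotient h (arc_even f)) (j - 1)
      else arc_inner b h f (arc_p b h j) / (arc_norm b h (arc_p b h j))\<^sup>2)"

definition arc_partial_sum ::
    "real \<Rightarrow> real \<Rightarrow> nat \<Rightarrow> (real \<Rightarrow> real \<Rightarrow> real) \<Rightarrow> real \<Rightarrow> real \<Rightarrow> real" where
  "arc_partial_sum b h n f x y =
     arc_coeff_0 b h f * arc_p b h 0 x y +
     (\<Sum>j=1..n. arc_coeff_1 b h f j * arc_q b h j x y + arc_coeff_2 b h f j * arc_p b h j x y)"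

end

theory Submission
  imports Defs "HOL-Complex_Analysis.Complex_Analysis"
begin

text \<open>Write \<open>f = f\<^sub>e(x) + y f\<^sub>o(x)\<close> on the arc. The even part of \<open>F\<close> and the odd part of \<open>F\<close> divided by
  \<open>sin\<close> are even and periodic, hence of the form \<open>G \<circ> cos\<close> with \<open>G\<close> holomorphic on the ellipse, and
  \<open>G\<close> extends \<open>f\<^sub>e\<close> and \<open>f\<^sub>o\<close>, respectively. A Joukowski map turns the Cauchy formula on confocal
  ellipses into a Chebyshev expansion, which gives polynomials of degree \<open>n\<close> at uniform distance
  \<open>O(\<rho>\<^sup>-\<^sup>n)\<close> on \<open>[h, 1]\<close>. The substitution \<open>\<sigma> = (1 - cos \<theta>) / (1 - h)\<close> splits the arc inner product into
  two semiclassical Jacobi inner products, one for the even and one for the odd parts, so the partial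
  sums are best approximations in weighted \<open>L\<^sup>2\<close> spaces and inherit the rate. For \<open>b = -1\<close> the same
  argument applies to the difference quotients \<open>(G - G(h)) / (x - h)\<close> and the weight with \<open>b = 1\<close>.\<close>

text \<open>The obstacle is the odd part: division by \<open>sin\<close> may create singularities at
  \<open>cos \<theta> = 1\<close> and \<open>cos \<theta> = -1\<close>. The point 1 is a focus, and
  the zeros of the odd part remove the singularity there. The point -1 may lie inside, outside or on
  the boundary of the ellipse; in the last case boundedness of \<open>F\<close> only bounds
  \<open>G\<close> by an inverse square root of the distance to -1. This uniformity also yields the
  sharp rate. Boundary values at radius \<open>\<rho>\<close> are not given, and a fixed
  \<open>r < \<rho>\<close> would only yield powers of \<open>r\<close>; but \<open>r\<close> may
  depend on \<open>n\<close> and approach \<open>\<rho>\<close> so fast that \<open>r ^ n\<close>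
  and \<open>\<rho> ^ n\<close> stay comparable, with an unchanged constant.\<close>

section \<open>Orthogonal expansions for semiclassical Jacobi weights\<close>

text \<open>Only the open interval is constrained: the weights vanish at the endpoints, and
  \<open>arc_odd\<close> or \<open>arc_quotient\<close> take default values of division by zero
  there.\<close>

definition bounded_borel01 :: "(real \<Rightarrow> real) \<Rightarrow> bool" where
  "bounded_borel01 u \<longleftrightarrow>
     (\<lambda>x. indicator {0<..<1} x * u x) \<in> borel_measurable borel \<and> (\<exists>B. \<forall>x\<in>{0<..<1}. \<bar>u x\<bar> \<le> B)"

lemma bounded_borel01_measurable:
  "bounded_borel01 u \<Longrightarrow> (\<lambda>x. indicator {0<..<1} x * u x) \<in> borel_measurable borel"
  unfolding bounded_borel01_def by blast

lemma bounded_borel01_add: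
  assumes "bounded_borel01 u" "bounded_borel01 v"
  shows "bounded_borel01 (\<lambda>x. u x + v x)"
proof -
  obtain B C where BC: "\<forall>x\<in>{0<..<1}. \<bar>u x\<bar> \<le> B" "\<forall>x\<in>{0<..<1}. \<bar>v x\<bar> \<le> C"
    using assms by (auto simp: bounded_borel01_def)
  then have "\<forall>x\<in>{0<..<1}. \<bar>u x + v x\<bar> \<le> B + C"
    by (meson abs_triangle_ineq add_mono order_trans)
  moreover have "(\<lambda>x. indicator {0<..<1} x * u x + indicator {0<..<1} x * v x) \<in> borel_measurable borel"
    by (intro borel_measurable_add bounded_borel01_measurable assms)
  ultimately show ?thesis
    by (auto simp: bounded_borel01_def distrib_left)
qed

lemma bounded_borel01_mult:
  assumes "bounded_borel01 u" "bounded_borel01 v"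
  shows "bounded_borel01 (\<lambda>x. u x * v x)"
proof -
  obtain B C where BC: "\<forall>x\<in>{0<..<1}. \<bar>u x\<bar> \<le> B" "\<forall>x\<in>{0<..<1}. \<bar>v x\<bar> \<le> C"
    using assms by (auto simp: bounded_borel01_def)
  have "\<forall>x\<in>{0<..<1}. \<bar>u x * v x\<bar> \<le> B * C"
  proof
    fix x :: real assume "x \<in> {0<..<1}"
    then have "\<bar>u x\<bar> \<le> B" "\<bar>v x\<bar> \<le> C" using BC by auto
    then show "\<bar>u x * v x\<bar> \<le> B * C" unfolding abs_mult by (intro mult_mono) auto
  qed
  moreover have "(\<lambda>x. (indicator {0<..<1} x * u x) * (indicator {0<..<1} x * v x)) \<in> borel_measurable borel"
    by (intro borel_measurable_times bounded_borel01_measurable assms)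
  moreover have "(\<lambda>x::real. (indicator {0<..<1} x * u x) * (indicator {0<..<1} x * v x)) =
      (\<lambda>x. indicator {0<..<1} x * (u x * v x))"
    by (auto simp: indicator_def)
  ultimately show ?thesis
    by (auto simp: bounded_borel01_def)
qed

lemma bounded_borel01_continuous:
  assumes "continuous_on {0..1} u"
  shows "bounded_borel01 u"
proof -
  have "bounded (u ` {0..1})"
    using assms compact_continuous_image compact_imp_bounded by blast
  then have "\<exists>B. \<forall>x\<in>{0<..<1}. \<bar>u x\<bar> \<le> B"
    by (force simp: bounded_iff)
  moreover have "(\<lambda>x. indicator {0<..<1} x *\<^sub>R u x) \<in> borel_measurable borel"
    by (rule borel_measurable_continuous_on_indicator)
       (auto intro: continuous_on_subset[OF assms])
  ultimately show ?thesis
    by (auto simp: bounded_borel01_def)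
qed

lemma bounded_borel01_poly [simp, intro]: "bounded_borel01 (poly p)"
  by (rule bounded_borel01_continuous) (intro continuous_intros)

lemma bounded_borel01_const [simp, intro]: "bounded_borel01 (\<lambda>x. k)"
  by (rule bounded_borel01_continuous) (intro continuous_intros)

lemma bounded_borel01_diff:
  assumes "bounded_borel01 u" "bounded_borel01 v"
  shows "bounded_borel01 (\<lambda>x. u x - v x)"
  using bounded_borel01_add[OF assms(1) bounded_borel01_mult[OF bounded_borel01_const[of "-1"] assms(2)]]
  by simp

lemma bounded_borel01_sum:
  assumes "\<And>i. i \<in> I \<Longrightarrow> bounded_borel01 (u i)"
  shows "bounded_borel01 (\<lambda>x. \<Sum>i\<in>I. u i x)"
  using assms by (induction I rule: infinite_finite_induct) (auto intro: bounded_borel01_add)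

lemmas bounded_borel01_intros =
  bounded_borel01_add bounded_borel01_diff bounded_borel01_mult bounded_borel01_sum

section \<open>The weight and its inner product\<close>

lemma sj_weight_nonneg: "sj_weight t a b c x \<ge> 0"
  by (simp add: sj_weight_def)

lemma sj_weight_pos: "0 < x \<Longrightarrow> x < 1 \<Longrightarrow> t > 1 \<Longrightarrow> sj_weight t a b c x > 0"
  by (simp add: sj_weight_def)

text \<open>\<open>0 powr a = 0\<close> for every real \<open>a\<close>, also for negative ones.
  Hence integrands over \<open>{0..1}\<close> need comparing on \<open>{0<..<1}\<close> only,
  whatever the other factors are at the endpoints.\<close>

lemma sj_weight_endpoints [simp]: "sj_weight t a b c 0 = 0" "sj_weight t a b c 1 = 0"
  by (simp_all add: sj_weight_def)

lemma sj_weight_borel [measurable]: "sj_weight t a b c \<in> borel_measurable borel"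
  unfolding sj_weight_def by measurable

lemma sj_inner_cong:
  assumes "\<And>x. x \<in> {0<..<1} \<Longrightarrow>
      u x * v x * sj_weight t a b c x = u' x * v' x * sj_weight t' a' b' c' x"
  shows "sj_inner t a b c u v = sj_inner t' a' b' c' u' v'"
  unfolding sj_inner_def
proof (rule set_lebesgue_integral_cong)
  show "\<forall>x. x \<in> {0..1} \<longrightarrow>
      u x * v x * sj_weight t a b c x = u' x * v' x * sj_weight t' a' b' c' x"
  proof (intro allI impI)
    fix x :: real assume "x \<in> {0..1}"
    then consider "x = 0" | "x = 1" | "x \<in> {0<..<1}" by fastforce
    then show "u x * v x * sj_weight t a b c x = u' x * v' x * sj_weight t' a' b' c' x"
      by cases (use assms in auto)
  qed
qed auto

lemma sj_inner_commute: "sj_inner t a b c u v = sj_inner t a b c v u"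
  by (simp add: sj_inner_def mult.commute mult.left_commute)

lemma sj_inner_scale_left: "sj_inner t a b c (\<lambda>x. k * u x) v = k * sj_inner t a b c u v"
  by (simp add: sj_inner_def mult.assoc)

lemma sj_inner_self_nonneg: "sj_inner t a b c u u \<ge> 0"
  unfolding sj_inner_def set_lebesgue_integral_def
  by (rule integral_nonneg_AE) (auto simp: sj_weight_nonneg)

locale sj_parameters =
  fixes t a b c :: real
  assumes t_gt_1: "t > 1" and a_gt: "a > -1" and b_gt: "b > -1"
begin

abbreviation "w \<equiv> sj_weight t a b c"
abbreviation "ip \<equiv> sj_inner t a b c"

text \<open>A Beta density times \<open>(t - x) powr c\<close>, which is bounded on
  \<open>{0..1}\<close> because \<open>t > 1\<close> keeps the base away from zero.\<close>

lemma weight_integrable: "set_integrable lborel {0..1} w"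
proof -
  have beta: "set_integrable lborel {0..1} (\<lambda>x. x powr a * (1 - x) powr b)"
    using integrable_Beta[of "a + 1" "b + 1"] a_gt b_gt by simp
  have "continuous_on {0..1} (\<lambda>x. (t - x) powr c)"
    using t_gt_1 by (intro continuous_intros) auto
  then have "bounded ((\<lambda>x. (t - x) powr c) ` {0..1})"
    using compact_continuous_image compact_imp_bounded by blast
  then obtain B where B: "\<And>x. x \<in> {0..1} \<Longrightarrow> \<bar>(t - x) powr c\<bar> \<le> B"
    by (force simp: bounded_iff)
  show ?thesis
  proof (rule set_integrable_bound)
    show "set_integrable lborel {0..1} (\<lambda>x. B * (x powr a * (1 - x) powr b))"
      using beta by simp
    show "set_borel_measurable lborel {0..1} w"
      by (simp add: set_borel_measurable_def)
    show "AE x in lborel. x \<in> {0..1} \<longrightarrow> norm (w x) \<le> norm (B * (x powr a * (1 - x) powr b))"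
    proof (rule AE_I2, rule impI)
      fix x :: real assume "x \<in> {0..1}"
      then have "\<bar>(t - x) powr c\<bar> \<le> \<bar>B\<bar>"
        using B by (meson abs_ge_self order_trans)
      then have "\<bar>(t - x) powr c\<bar> * (x powr a * (1 - x) powr b) \<le> \<bar>B\<bar> * (x powr a * (1 - x) powr b)"
        by (intro mult_right_mono) auto
      then show "norm (w x) \<le> norm (B * (x powr a * (1 - x) powr b))"
        by (simp add: sj_weight_def abs_mult mult_ac)
    qed
  qed
qed

lemma weighted_integrable:
  assumes "bounded_borel01 u"
  shows "set_integrable lborel {0..1} (\<lambda>x. u x * w x)"
proof -
  obtain B where B: "\<forall>x\<in>{0<..<1}. \<bar>u x\<bar> \<le> B"
    using assms by (auto simp: bounded_borel01_def)
  have "set_integrable lborel {0..1} (\<lambda>x. B * w x)"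
    using weight_integrable by simp
  moreover have "set_borel_measurable lborel {0..1} (\<lambda>x. u x * w x)"
  proof -
    have "(\<lambda>x. (indicator {0<..<1} x * u x) * w x) \<in> borel_measurable borel"
      by (intro borel_measurable_times bounded_borel01_measurable assms sj_weight_borel)
    moreover have "(\<lambda>x. (indicator {0<..<1} x * u x) * w x) = (\<lambda>x. indicator {0..1} x *\<^sub>R (u x * w x))"
    proof
      fix x :: real
      consider "x = 0" | "x = 1" | "x \<in> {0<..<1}" | "x \<notin> {0..1}" by fastforce
      then show "(indicator {0<..<1} x * u x) * w x = indicator {0..1} x *\<^sub>R (u x * w x)"
        by cases auto
    qed
    ultimately show ?thesis by (simp add: set_borel_measurable_def)
  qed
  moreover have "AE x in lborel. x \<in> {0..1} \<longrightarrow> norm (u x * w x) \<le> norm (B * w x)"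
  proof (rule AE_I2, rule impI)
    fix x :: real assume "x \<in> {0..1}"
    then consider "x = 0" | "x = 1" | "x \<in> {0<..<1}" by fastforce
    then show "norm (u x * w x) \<le> norm (B * w x)"
    proof cases
      case 3
      then have "\<bar>u x\<bar> \<le> \<bar>B\<bar>" using B by fastforce
      then show ?thesis by (simp add: abs_mult mult_right_mono)
    qed auto
  qed
  ultimately show ?thesis
    by (rule set_integrable_bound)
qed

lemma ip_add_left:
  assumes "bounded_borel01 u" "bounded_borel01 v" "bounded_borel01 z"
  shows "ip (\<lambda>x. u x + v x) z = ip u z + ip v z"
  using set_integral_add(2)[OF weighted_integrable weighted_integrable,
      OF bounded_borel01_mult[OF assms(1,3)] bounded_borel01_mult[OF assms(2,3)]]
  by (simp add: sj_inner_def distrib_right)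

lemma ip_diff_left:
  assumes "bounded_borel01 u" "bounded_borel01 v" "bounded_borel01 z"
  shows "ip (\<lambda>x. u x - v x) z = ip u z - ip v z"
  using set_integral_diff(2)[OF weighted_integrable weighted_integrable,
      OF bounded_borel01_mult[OF assms(1,3)] bounded_borel01_mult[OF assms(2,3)]]
  by (simp add: sj_inner_def left_diff_distrib)

lemma ip_sum_left:
  assumes "\<And>i. i \<in> I \<Longrightarrow> bounded_borel01 (u i)" "bounded_borel01 z"
  shows "ip (\<lambda>x. \<Sum>i\<in>I. u i x) z = (\<Sum>i\<in>I. ip (u i) z)"
  using assms(1)
proof (induction I rule: infinite_finite_induct)
  case (insert i I)
  then show ?case
    by (simp add: ip_add_left bounded_borel01_sum assms(2))
qed (simp_all add: sj_inner_def)

lemma ip_mono: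
  assumes "bounded_borel01 u" "bounded_borel01 v" "bounded_borel01 u'" "bounded_borel01 v'"
    "\<And>x. x \<in> {0<..<1} \<Longrightarrow> u x * v x \<le> u' x * v' x"
  shows "ip u v \<le> ip u' v'"
  unfolding sj_inner_def
proof (rule set_integral_mono)
  fix x :: real assume "x \<in> {0..1}"
  then consider "x = 0" | "x = 1" | "x \<in> {0<..<1}" by fastforce
  then show "u x * v x * w x \<le> u' x * v' x * w x"
    by cases (use assms(5) sj_weight_nonneg in \<open>auto intro: mult_right_mono\<close>)
qed (auto intro!: weighted_integrable bounded_borel01_mult assms)

text \<open>A vanishing integral would make the nonnegative integrand vanish almost everywhere;
  since the weight is positive inside and \<open>p\<close> has finitely many roots,
  \<open>{0<..<1}\<close> would be a null set.\<close>

lemma ip_poly_pos: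
  assumes "p \<noteq> 0"
  shows "ip (poly p) (poly p) > 0"
proof (rule ccontr)
  assume "\<not> ?thesis"
  then have "ip (poly p) (poly p) = 0"
    using sj_inner_self_nonneg[of t a b c "poly p"] by linarith
  then have "(LINT x|lborel. indicator {0..1} x *\<^sub>R (poly p x * poly p x * w x)) = 0"
    by (simp add: sj_inner_def set_lebesgue_integral_def)
  moreover have "integrable lborel (\<lambda>x. indicator {0..1} x *\<^sub>R (poly p x * poly p x * w x))"
    using weighted_integrable[of "\<lambda>x. poly p x * poly p x"]
    by (simp add: bounded_borel01_mult set_integrable_def)
  ultimately have "AE x in lborel. indicator {0..1} x *\<^sub>R (poly p x * poly p x * w x) = 0"
    by (subst (asm) integral_nonneg_eq_0_iff_AE) (auto simp: sj_weight_nonneg)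
  moreover have "AE x in lborel. x \<notin> {x. poly p x = 0}"
    using poly_roots_finite[OF assms] by (intro AE_not_in finite_imp_null_set_lborel) auto
  ultimately have "AE x in lborel. x \<notin> {0<..<1::real}"
  proof eventually_elim
    case (elim x)
    show ?case
    proof
      assume x: "x \<in> {0<..<1}"
      then have "w x > 0" using sj_weight_pos t_gt_1 by auto
      then show False using elim x by auto
    qed
  qed
  then have "{0<..<1::real} \<in> null_sets lborel"
    by (subst AE_iff_null_sets) auto
  then show False
    by (simp add: null_sets_def)
qed

section \<open>Orthogonal polynomials by Gram-Schmidt\<close>

abbreviation "mass \<equiv> ip (\<lambda>x. 1) (\<lambda>x. 1)"

lemma mass_pos: "mass > 0"
  using ip_poly_pos[of 1] by (simp add: sj_inner_def)

lemma ip_poly_diff_left: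
  "ip (poly (p - q)) (poly r) = ip (poly p) (poly r) - ip (poly q) (poly r)"
proof -
  have "poly (p - q) = (\<lambda>x. poly p x - poly q x)" by auto
  then show ?thesis using ip_diff_left[of "poly p" "poly q" "poly r"] by auto
qed

lemma ip_poly_smult_left: "ip (poly (smult k p)) (poly r) = k * ip (poly p) (poly r)"
proof -
  have "poly (smult k p) = (\<lambda>x. k * poly p x)" by auto
  then show ?thesis by (simp add: sj_inner_scale_left)
qed

lemma ip_poly_sum_left:
  "ip (poly (\<Sum>i\<in>I. f i)) (poly r) = (\<Sum>i\<in>I. ip (poly (f i)) (poly r))"
proof -
  have "poly (\<Sum>i\<in>I. f i) = (\<lambda>x. \<Sum>i\<in>I. poly (f i) x)" by (auto simp: poly_sum)
  then show ?thesis using ip_sum_left[of I "\<lambda>i. poly (f i)" "poly r"] by auto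
qed

text \<open>Monic orthogonal polynomials. Their purpose is to show that some
  \<open>sj_family\<close> exists, since \<open>semiclassical_jacobi\<close> is obtained by
  \<open>SOME\<close>.\<close>

function gram_schmidt :: "nat \<Rightarrow> real poly" where
  "gram_schmidt n = monom 1 n - (\<Sum>k<n. smult
     (ip (poly (monom 1 n)) (poly (gram_schmidt k)) /
      ip (poly (gram_schmidt k)) (poly (gram_schmidt k))) (gram_schmidt k))"
  by auto
termination by (relation "Wellfounded.measure id") auto

declare gram_schmidt.simps [simp del]

lemma degree_gram_schmidt: "degree (gram_schmidt n) = n"
  and lead_coeff_gram_schmidt: "coeff (gram_schmidt n) n = 1"
proof -
  have "degree (gram_schmidt n) = n \<and> coeff (gram_schmidt n) n = 1"
  proof (induction n rule: less_induct)
    case (less n)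
    define S where "S = (\<Sum>k<n. smult
       (ip (poly (monom 1 n)) (poly (gram_schmidt k)) /
        ip (poly (gram_schmidt k)) (poly (gram_schmidt k))) (gram_schmidt k))"
    have "coeff S i = 0" if "i \<ge> n" for i
    proof -
      have "coeff (gram_schmidt k) i = 0" if "k < n" for k
        using less.IH[OF that] that \<open>i \<ge> n\<close> by (intro coeff_eq_0) auto
      then show ?thesis by (simp add: S_def coeff_sum)
    qed
    moreover have "gram_schmidt n = monom 1 n - S"
      by (subst gram_schmidt.simps) (simp add: S_def)
    ultimately have c: "coeff (gram_schmidt n) i = (if i = n then 1 else 0)" if "i \<ge> n" for i
      using that by auto
    then have "degree (gram_schmidt n) \<le> n"
      by (intro degree_le) auto
    moreover have "n \<le> degree (gram_schmidt n)"
      using c[of n] by (intro le_degree) auto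
    ultimately show ?case using c[of n] by auto
  qed
  then show "degree (gram_schmidt n) = n" "coeff (gram_schmidt n) n = 1" by auto
qed

lemma gram_schmidt_nonzero: "gram_schmidt n \<noteq> 0"
  using lead_coeff_gram_schmidt[of n] by auto

lemma gram_schmidt_orthogonal:
  assumes "m < n"
  shows "ip (poly (gram_schmidt n)) (poly (gram_schmidt m)) = 0"
  using assms
proof (induction n arbitrary: m rule: less_induct)
  case (less n)
  let ?G = gram_schmidt
  have orth: "ip (poly (?G k)) (poly (?G m)) = 0" if "k < n" "k \<noteq> m" for k
    using less.IH[of k m] less.IH[of m k] that less.prems
    by (metis linorder_neqE_nat sj_inner_commute)
  have "ip (poly (?G n)) (poly (?G m)) = ip (poly (monom 1 n)) (poly (?G m)) -
     (\<Sum>k<n. ip (poly (monom 1 n)) (poly (?G k)) / ip (poly (?G k)) (poly (?G k)) *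
        ip (poly (?G k)) (poly (?G m)))"
    by (subst gram_schmidt.simps)
       (simp add: ip_poly_diff_left ip_poly_sum_left ip_poly_smult_left)
  also have "(\<Sum>k<n. ip (poly (monom 1 n)) (poly (?G k)) / ip (poly (?G k)) (poly (?G k)) *
        ip (poly (?G k)) (poly (?G m))) =
      (\<Sum>k<n. if k = m then ip (poly (monom 1 n)) (poly (?G m)) else 0)"
    using orth ip_poly_pos[OF gram_schmidt_nonzero[of m]] by (intro sum.cong) auto
  also have "\<dots> = ip (poly (monom 1 n)) (poly (?G m))"
    using less.prems by simp
  finally show ?case by simp
qed

lemma sj_family_exists: "\<exists>P. sj_family t a b c P"
proof -
  define N where "N n = ip (poly (gram_schmidt n)) (poly (gram_schmidt n))" for n
  have Npos: "N n > 0" for n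
    using ip_poly_pos gram_schmidt_nonzero by (simp add: N_def)
  \<comment> \<open>The factor gives every polynomial the squared norm \<open>mass\<close>; at
    \<open>n = 0\<close> it equals 1, which yields \<open>P 0 = 1\<close>.\<close>
  define P where "P n = smult (sqrt (mass / N n)) (gram_schmidt n)" for n
  have "gram_schmidt 0 = 1"
    by (subst gram_schmidt.simps) simp
  moreover from this have "N 0 = mass"
    by (simp add: N_def sj_inner_def)
  ultimately have "P 0 = 1"
    using mass_pos by (simp add: P_def)
  moreover have "degree (P n) = n" for n
    using Npos[of n] mass_pos by (simp add: P_def degree_gram_schmidt)
  moreover have "ip (poly (P m)) (poly (P n)) =
      sqrt (mass / N m) * sqrt (mass / N n) * ip (poly (gram_schmidt m)) (poly (gram_schmidt n))" for m n
    unfolding P_def by (simp add: ip_poly_smult_left sj_inner_commute[of t a b c "poly (gram_schmidt m)"]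
      sj_inner_commute[of t a b c "poly (smult (sqrt (mass / N m)) (gram_schmidt m))"])
  moreover have "ip (poly (gram_schmidt m)) (poly (gram_schmidt n)) = 0" if "m \<noteq> n" for m n
    using gram_schmidt_orthogonal that by (metis linorder_neqE_nat sj_inner_commute)
  ultimately show ?thesis
    using Npos mass_pos by (intro exI[of _ P])
      (auto simp: sj_family_def less_imp_le less_imp_neq[symmetric] simp flip: N_def)
qed

abbreviation "P \<equiv> semiclassical_jacobi t a b c"

text \<open>The chosen family may differ in signs from the one just constructed, so everything later
  rests on the properties listed in \<open>sj_family\<close> alone.\<close>

lemma semiclassical_jacobi_family: "sj_family t a b c P"
proof -
  have "P = (SOME Q. sj_family t a b c Q)"
    using b_gt by (auto simp: semiclassical_jacobi_def)
  then show ?thesis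
    using someI_ex[OF sj_family_exists] by simp
qed

lemma degree_P [simp]: "degree (P n) = n"
  and ip_P_orthogonal: "m \<noteq> n \<Longrightarrow> ip (poly (P m)) (poly (P n)) = 0"
  and ip_P_self: "ip (poly (P n)) (poly (P n)) = mass"
  using semiclassical_jacobi_family by (auto simp: sj_family_def)

text \<open>Each \<open>P n\<close> has exact degree \<open>n\<close>, so a multiple of
  \<open>P (Suc n)\<close> cancels the top coefficient of \<open>q\<close> and induction handles the
  rest.\<close>

lemma P_span:
  assumes "degree q \<le> n"
  shows "\<exists>\<alpha>. q = (\<Sum>k\<le>n. smult (\<alpha> k) (P k))"
  using assms
proof (induction n arbitrary: q)
  case 0
  have "P 0 = 1"
    using semiclassical_jacobi_family by (simp add: sj_family_def)
  moreover obtain k where "q = [:k:]" using 0 by (auto elim: degree_eq_zeroE)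
  ultimately show ?case by (intro exI[of _ "\<lambda>_. k"]) simp
next
  case (Suc n)
  have nz: "coeff (P (Suc n)) (Suc n) \<noteq> 0"
    using degree_P[of "Suc n"] by (metis leading_coeff_neq_0 degree_0 nat.distinct(1))
  define \<beta> where "\<beta> = coeff q (Suc n) / coeff (P (Suc n)) (Suc n)"
  have "degree (q - smult \<beta> (P (Suc n))) \<le> n"
  proof (rule degree_le, intro allI impI)
    fix i assume "n < i"
    then consider "i = Suc n" | "i > Suc n" by linarith
    then show "coeff (q - smult \<beta> (P (Suc n))) i = 0"
      using nz Suc.prems by cases (auto simp: \<beta>_def coeff_eq_0)
  qed
  from Suc.IH[OF this] obtain \<alpha> where "q - smult \<beta> (P (Suc n)) = (\<Sum>k\<le>n. smult (\<alpha> k) (P k))"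
    by blast
  then have "q = (\<Sum>k\<le>n. smult (\<alpha> k) (P k)) + smult \<beta> (P (Suc n))"
    by (simp add: algebra_simps)
  also have "\<dots> = (\<Sum>k\<le>Suc n. smult ((\<alpha>(Suc n := \<beta>)) k) (P k))"
    by simp
  finally show ?case by blast
qed

section \<open>Truncated expansions as best approximations\<close>

definition expansion :: "(real \<Rightarrow> real) \<Rightarrow> nat \<Rightarrow> real poly" where
  "expansion u n = (\<Sum>k\<le>n. smult (sj_coeff t a b c u k) (P k))"

lemma sj_coeff_eq: "sj_coeff t a b c u k = ip u (poly (P k)) / mass"
  by (simp add: sj_coeff_def Let_def ip_P_self)

lemma degree_expansion: "degree (expansion u n) \<le> n"
  unfolding expansion_def by (intro degree_sum_le) (auto intro: order_trans[OF degree_smult_le])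

lemma ip_poly_P_eq_0:
  assumes "degree q < k"
  shows "ip (poly q) (poly (P k)) = 0"
proof -
  obtain n where n: "k = Suc n" "degree q \<le> n" using assms by (cases k) auto
  obtain \<alpha> where "q = (\<Sum>i\<le>n. smult (\<alpha> i) (P i))" using P_span[OF n(2)] by blast
  then show ?thesis
    using n by (simp add: ip_poly_sum_left ip_poly_smult_left ip_P_orthogonal)
qed

text \<open>Testing the residual against \<open>P k\<close> with \<open>k \<le> n\<close> gives zero
  by the choice of the coefficients; \<open>P_span\<close> extends this to \<open>q\<close>.\<close>

lemma expansion_residual_orthogonal:
  assumes u: "bounded_borel01 u" and q: "degree q \<le> n"
  shows "ip (\<lambda>x. u x - poly (expansion u n) x) (poly q) = 0"
proof -
  have "ip (poly (P k)) (\<lambda>x. u x - poly (expansion u n) x) = 0" if "k \<le> n" for k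
  proof -
    have "ip (poly (expansion u n)) (poly (P k)) =
        (\<Sum>i\<le>n. sj_coeff t a b c u i * ip (poly (P i)) (poly (P k)))"
      by (simp add: expansion_def ip_poly_sum_left ip_poly_smult_left)
    also have "\<dots> = (\<Sum>i\<le>n. if i = k then ip u (poly (P k)) else 0)"
      using mass_pos by (intro sum.cong) (auto simp: ip_P_orthogonal ip_P_self sj_coeff_eq)
    also have "\<dots> = ip u (poly (P k))" using that by simp
    finally have "ip (\<lambda>x. u x - poly (expansion u n) x) (poly (P k)) = 0"
      using ip_diff_left[OF u, of "poly (expansion u n)" "poly (P k)"] by auto
    then show ?thesis by (simp add: sj_inner_commute)
  qed
  moreover obtain \<alpha> where \<alpha>: "q = (\<Sum>k\<le>n. smult (\<alpha> k) (P k))"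
    using P_span[OF q] by blast
  have "ip (poly q) (\<lambda>x. u x - poly (expansion u n) x) =
      (\<Sum>k\<le>n. \<alpha> k * ip (poly (P k)) (\<lambda>x. u x - poly (expansion u n) x))"
  proof -
    have "poly q = (\<lambda>x. \<Sum>k\<le>n. \<alpha> k * poly (P k) x)"
      by (subst \<alpha>) (auto simp: poly_sum)
    then show ?thesis
      using u by (simp add: ip_sum_left bounded_borel01_intros bounded_borel01_diff
        bounded_borel01_poly sj_inner_scale_left)
  qed
  ultimately show ?thesis by (simp add: sj_inner_commute[of t a b c _ "poly q"])
qed

text \<open>Pythagoras: \<open>u - q\<close> is the residual plus the polynomial \<open>s\<close> of
  degree at most \<open>n\<close>, and these two are orthogonal.\<close>

lemma expansion_best_approximation:
  assumes u: "bounded_borel01 u" and q: "degree q \<le> n"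
  shows "ip (\<lambda>x. u x - poly (expansion u n) x) (\<lambda>x. u x - poly (expansion u n) x)
       \<le> ip (\<lambda>x. u x - poly q x) (\<lambda>x. u x - poly q x)"
proof -
  define r where "r x = u x - poly (expansion u n) x" for x
  define s where "s = expansion u n - q"
  have r: "bounded_borel01 r" unfolding r_def by (intro bounded_borel01_diff u bounded_borel01_poly)
  have "degree s \<le> n" unfolding s_def by (intro degree_diff_le degree_expansion q)
  then have 0: "ip r (poly s) = 0" "ip (poly s) r = 0"
    using expansion_residual_orthogonal[OF u] sj_inner_commute by (auto simp: r_def[abs_def])
  have "(\<lambda>x. u x - poly q x) = (\<lambda>x. r x + poly s x)"
    by (auto simp: r_def s_def)
  moreover have "ip (\<lambda>x. r x + poly s x) (\<lambda>x. r x + poly s x) = ip r r + ip (poly s) (poly s)"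
  proof -
    have rs: "bounded_borel01 (\<lambda>x. r x + poly s x)" by (intro bounded_borel01_add r bounded_borel01_poly)
    have "ip (\<lambda>x. r x + poly s x) (\<lambda>x. r x + poly s x) =
       ip (\<lambda>x. r x + poly s x) r + ip (\<lambda>x. r x + poly s x) (poly s)"
      using ip_add_left[OF r bounded_borel01_poly rs, of s] by (simp add: sj_inner_commute)
    then show ?thesis using 0 r by (simp add: ip_add_left bounded_borel01_poly)
  qed
  ultimately show ?thesis
    using sj_inner_self_nonneg[of t a b c "poly s"] by (simp add: r_def[abs_def])
qed

end

text \<open>The interface of the two halves of the proof: complex analysis produces this property,
  orthogonal expansions consume it. \<open>K\<close> does not depend on \<open>n\<close>.\<close>

definition geom_approx :: "real \<Rightarrow> (real \<Rightarrow> real) \<Rightarrow> bool" where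
  "geom_approx \<rho> u \<longleftrightarrow>
     (\<exists>K. \<forall>n. \<exists>p. degree p \<le> n \<and> (\<forall>s\<in>{0<..<1}. \<bar>u s - poly p s\<bar> \<le> K / \<rho> ^ n))"

text \<open>Uniform limits of polynomials are Borel and bounded. This is where measurability of the
  functions derived from \<open>f\<close> comes from.\<close>

lemma geom_approx_bounded_borel01:
  assumes "geom_approx \<rho> u" "\<rho> > 1"
  shows "bounded_borel01 u"
proof -
  obtain K p where p: "\<And>n s. s \<in> {0<..<1} \<Longrightarrow> \<bar>u s - poly (p n) s\<bar> \<le> K / \<rho> ^ n"
    using assms(1) unfolding geom_approx_def by metis
  have lim0: "(\<lambda>n. K / \<rho> ^ n) \<longlonglongrightarrow> 0"
    using assms(2) by (intro tendsto_divide_0[OF tendsto_const] filterlim_at_top_imp_at_infinity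
      filterlim_realpow_sequentially_gt1) auto
  have "(\<lambda>s. indicator {0<..<1} s * u s) \<in> borel_measurable borel"
  proof (rule borel_measurable_LIMSEQ_real)
    show "(\<lambda>s. indicator {0<..<1} s * poly (p n) s) \<in> borel_measurable borel" for n
      by (intro bounded_borel01_measurable bounded_borel01_poly)
    show "(\<lambda>n. indicator {0<..<1} s * poly (p n) s) \<longlonglongrightarrow> indicator {0<..<1} s * u s" for s :: real
    proof (cases "s \<in> {0<..<1}")
      case True
      have "(\<lambda>n. u s - poly (p n) s) \<longlonglongrightarrow> 0"
        by (rule Lim_null_comparison[OF _ lim0]) (use p[OF True] in simp)
      then have "(\<lambda>n. u s - (u s - poly (p n) s)) \<longlonglongrightarrow> u s - 0"
        by (intro tendsto_intros)
      then show ?thesis using True by simp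
    qed simp
  qed
  moreover obtain B where "\<forall>x\<in>{0<..<1}. \<bar>poly (p 0) x\<bar> \<le> B"
    using bounded_borel01_poly[of "p 0"] by (auto simp: bounded_borel01_def)
  then have "\<forall>x\<in>{0<..<1}. \<bar>u x\<bar> \<le> B + K"
    using p[of _ 0] by fastforce
  ultimately show ?thesis by (auto simp: bounded_borel01_def)
qed

section \<open>Decay of coefficients and residuals\<close>

context sj_parameters
begin

text \<open>\<open>P (Suc n)\<close> is orthogonal to the approximant \<open>p n\<close>, so the
  coefficient of index \<open>Suc n\<close> sees only the error \<open>u - p n\<close>, of size
  \<open>K / \<rho> ^ n\<close>. The index shift costs a factor \<open>\<rho>\<close>.\<close>

theorem sj_coeff_geom_decay:
  assumes u: "geom_approx \<rho> u" and \<rho>: "\<rho> > 1"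
  shows "\<exists>C. \<forall>k. \<bar>sj_coeff t a b c u k\<bar> \<le> C / \<rho> ^ k"
proof -
  note bu = geom_approx_bounded_borel01[OF u \<rho>]
  obtain K p where p: "\<And>n. degree (p n) \<le> n"
      "\<And>n s. s \<in> {0<..<1} \<Longrightarrow> \<bar>u s - poly (p n) s\<bar> \<le> K / \<rho> ^ n"
    using u unfolding geom_approx_def by metis
  have bound: "\<bar>sj_coeff t a b c u (Suc n)\<bar> \<le> K * \<rho> / \<rho> ^ Suc n" for n
  proof -
    let ?r = "\<lambda>s. u s - poly (p n) s" and ?P = "poly (P (Suc n))"
    let ?e = "K / \<rho> ^ n"
    have e: "?e \<ge> 0" using order_trans[OF abs_ge_zero p(2)[of "1/2" n]] by simp
    have "ip ?r ?P = ip u ?P"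
      using ip_diff_left[OF bu bounded_borel01_poly bounded_borel01_poly, of "p n" "P (Suc n)"]
        ip_poly_P_eq_0[of "p n" "Suc n"] p(1)[of n] by simp
    \<comment> \<open>The bound \<open>\<bar>x\<bar> \<le> (1 + x * x) / 2\<close> stands in for
      Cauchy-Schwarz. Since \<open>?P\<close> has the same norm as 1, the right side integrates to
      exactly \<open>?e * mass\<close>.\<close>
    moreover have *: "\<bar>?r s * ?P s\<bar> \<le> ?e * ((1 + ?P s * ?P s) / 2)" if "s \<in> {0<..<1}" for s
    proof -
      have "0 \<le> (1 - \<bar>?P s\<bar>)\<^sup>2" by simp
      then have "\<bar>?P s\<bar> \<le> (1 + ?P s * ?P s) / 2"
        by (simp add: power2_eq_square algebra_simps flip: abs_mult)
      with p(2)[OF that, of n] e show ?thesis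
        unfolding abs_mult by (intro mult_mono) auto
    qed
    define g where "g s = ?e * ((1 + ?P s * ?P s) / 2)" for s
    have bg: "bounded_borel01 g"
      unfolding g_def times_divide_eq_right[symmetric] divide_inverse[of _ 2]
      by (intro bounded_borel01_intros bounded_borel01_const bounded_borel01_poly)
    have br: "bounded_borel01 ?r" by (intro bounded_borel01_intros bu bounded_borel01_poly)
    have "ip g (\<lambda>_. 1) = ?e * mass"
    proof -
      have "ip g (\<lambda>_. 1) = ip (\<lambda>s. ?e / 2 * (1 + ?P s * ?P s)) (\<lambda>_. 1)"
        by (intro sj_inner_cong) (simp add: g_def)
      also have "\<dots> = ?e / 2 * (ip (\<lambda>s. 1) (\<lambda>_. 1) + ip (\<lambda>s. ?P s * ?P s) (\<lambda>_. 1))"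
        by (subst sj_inner_scale_left, subst ip_add_left)
           (auto intro!: bounded_borel01_intros)
      also have "ip (\<lambda>s. ?P s * ?P s) (\<lambda>_. 1) = mass"
        by (subst ip_P_self[of "Suc n", symmetric]) (simp add: sj_inner_def)
      finally show ?thesis by simp
    qed
    moreover have "ip ?r ?P \<le> ip g (\<lambda>_. 1)"
      by (rule ip_mono) (use * in \<open>auto intro!: br bg simp: g_def abs_le_iff\<close>)
    moreover have "ip (\<lambda>s. -1 * ?r s) ?P \<le> ip g (\<lambda>_. 1)"
    proof (rule ip_mono)
      show "-1 * ?r s * ?P s \<le> g s * 1" if "s \<in> {0<..<1}" for s
      proof -
        have "-1 * ?r s * ?P s \<le> \<bar>?r s * ?P s\<bar>" using abs_ge_minus_self[of "?r s * ?P s"] by (simp only: mult_minus_left mult_1)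
        then show ?thesis using *[OF that] unfolding g_def by linarith
      qed
    qed (intro bounded_borel01_mult br bg bounded_borel01_const bounded_borel01_poly)+
    ultimately have "\<bar>ip u ?P\<bar> \<le> ?e * mass"
      by (subst (asm) sj_inner_scale_left) (simp add: abs_le_iff)
    then show ?thesis
      using mass_pos \<rho> by (simp add: sj_coeff_eq abs_mult field_simps)
  qed
  \<comment> \<open>The index 0 is not a successor and is absorbed into the constant.\<close>
  define C where "C = max (K * \<rho>) \<bar>sj_coeff t a b c u 0\<bar>"
  have "\<bar>sj_coeff t a b c u k\<bar> \<le> C / \<rho> ^ k" for k
  proof (cases k)
    case (Suc n)
    have "K * \<rho> / \<rho> ^ Suc n \<le> C / \<rho> ^ Suc n" using \<rho> by (intro divide_right_mono) (auto simp: C_def)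
    then show ?thesis using bound[of n] unfolding Suc by linarith
  qed (simp add: C_def)
  then show ?thesis by blast
qed

text \<open>The truncated expansion is at least as good as \<open>p n\<close>, whose uniform error
  is integrated. The rate is squared because \<open>ip\<close> of the residual with itself is the
  square of a norm.\<close>

theorem expansion_geom_convergence:
  assumes u: "geom_approx \<rho> u" and \<rho>: "\<rho> > 1"
  shows "\<exists>C. \<forall>n. ip (\<lambda>x. u x - poly (expansion u n) x) (\<lambda>x. u x - poly (expansion u n) x)
       \<le> C / (\<rho> ^ n)\<^sup>2"
proof -
  note bu = geom_approx_bounded_borel01[OF u \<rho>]
  obtain K p where p: "\<And>n. degree (p n) \<le> n"
      "\<And>n s. s \<in> {0<..<1} \<Longrightarrow> \<bar>u s - poly (p n) s\<bar> \<le> K / \<rho> ^ n"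
    using u unfolding geom_approx_def by metis
  have "ip (\<lambda>x. u x - poly (expansion u n) x) (\<lambda>x. u x - poly (expansion u n) x)
       \<le> K\<^sup>2 * mass / (\<rho> ^ n)\<^sup>2" for n
  proof -
    let ?r = "\<lambda>s. u s - poly (p n) s" and ?e = "K / \<rho> ^ n"
    have "ip ?r ?r \<le> ip (\<lambda>s. ?e) (\<lambda>s. ?e)"
    proof (rule ip_mono)
      show "?r s * ?r s \<le> ?e * ?e" if "s \<in> {0<..<1}" for s
      proof -
        have "\<bar>?r s\<bar> * \<bar>?r s\<bar> \<le> ?e * ?e"
          by (intro mult_mono p(2) that order_trans[OF abs_ge_zero p(2)[OF that]]) auto
        then show ?thesis by (simp flip: abs_mult)
      qed
    qed (auto intro!: bounded_borel01_diff bu)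
    also have "\<dots> = ?e * ?e * mass"
      by (simp add: sj_inner_def mult.assoc)
    also have "\<dots> = K\<^sup>2 * mass / (\<rho> ^ n)\<^sup>2" by (simp add: power2_eq_square)
    finally show ?thesis
      using expansion_best_approximation[OF bu p(1)[of n]] by linarith
  qed
  then show ?thesis by blast
qed

end

section \<open>Polynomial approximation on a Bernstein ellipse\<close>

text \<open>With \<open>c\<close> half the focal distance, \<open>A + B = \<rho> * c\<close> and
  \<open>A\<^sup>2 - B\<^sup>2 = c\<^sup>2\<close> force \<open>A - B = c / \<rho>\<close>. So
  \<open>A\<close> is explicit and the existential quantifiers disappear.\<close>

lemma open_ellipse_eq:
  fixes h \<rho> :: real
  assumes h: "h < 1" and \<rho>: "\<rho> > 1"
  shows "open_ellipse (complex_of_real h) 1 (\<rho> * (1 - h) / 2) =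
     {z. dist z (complex_of_real h) + dist z 1 < (1 - h) / 2 * (\<rho> + 1 / \<rho>)}"
proof -
  define c where "c = (1 - h) / 2"
  have c: "c > 0" using h by (simp add: c_def)
  have d: "dist (complex_of_real h) 1 / 2 = c"
    using h dist_of_real[of h 1, where 'a = complex] by (simp add: dist_real_def c_def)
  have iff: "0 < B \<and> B \<le> A \<and> A + B = \<rho> * c \<and> A\<^sup>2 - B\<^sup>2 = c\<^sup>2 \<longleftrightarrow>
      A = c * (\<rho> + 1 / \<rho>) / 2 \<and> B = c * (\<rho> - 1 / \<rho>) / 2" for A B
  proof
    assume *: "0 < B \<and> B \<le> A \<and> A + B = \<rho> * c \<and> A\<^sup>2 - B\<^sup>2 = c\<^sup>2"
    then have "(A - B) * (\<rho> * c) = c\<^sup>2"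
      by (metis power2_eq_square square_diff_square_factored mult.commute)
    then have "(A - B) * \<rho> * c = c * c" by (simp add: power2_eq_square mult_ac)
    then have "(A - B) * \<rho> = c" using c by simp
    then have "A - B = c / \<rho>" using \<rho> by (simp add: field_simps)
    with * have "2 * A = \<rho> * c + c / \<rho>" "2 * B = \<rho> * c - c / \<rho>"
      by linarith+
    then show "A = c * (\<rho> + 1 / \<rho>) / 2 \<and> B = c * (\<rho> - 1 / \<rho>) / 2"
      by (simp add: distrib_left right_diff_distrib mult.commute)
  next
    assume *: "A = c * (\<rho> + 1 / \<rho>) / 2 \<and> B = c * (\<rho> - 1 / \<rho>) / 2"
    have "1 / \<rho> < \<rho>" using \<rho> by (simp add: field_simps) (use less_1_mult[of \<rho> \<rho>] in auto)
    then have "c / \<rho> < c * \<rho>" using mult_strict_left_mono[OF _ c] by fastforce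
    moreover have sd: "A + B = c * \<rho>" "A - B = c / \<rho>"
      using * by (simp_all add: distrib_left right_diff_distrib)
    moreover have "A\<^sup>2 - B\<^sup>2 = c\<^sup>2"
      using sd \<rho> by (simp add: power2_eq_square square_diff_square_factored)
    moreover have "c / \<rho> > 0" using c \<rho> by simp
    moreover note mult.commute[of c \<rho>]
    ultimately show "0 < B \<and> B \<le> A \<and> A + B = \<rho> * c \<and> A\<^sup>2 - B\<^sup>2 = c\<^sup>2"
      by (intro conjI; linarith)
  qed
  have s: "\<rho> * (1 - h) / 2 = \<rho> * c" by (simp add: c_def)
  have "open_ellipse (complex_of_real h) 1 (\<rho> * (1 - h) / 2) =
     {z. \<exists>A B. (0 < B \<and> B \<le> A \<and> A + B = \<rho> * c \<and> A\<^sup>2 - B\<^sup>2 = c\<^sup>2) \<and>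
         dist z (complex_of_real h) + dist z 1 < 2 * A}"
    unfolding open_ellipse_def d s by (simp only: conj_assoc)
  also have "\<dots> = {z. dist z (complex_of_real h) + dist z 1 < c * (\<rho> + 1 / \<rho>)}"
  proof -
    have *: "(\<exists>A B. (A = k \<and> B = l) \<and> d < 2 * A) \<longleftrightarrow> d < 2 * k" for k l d :: real by blast
    show ?thesis unfolding iff * by simp
  qed
  finally show ?thesis by (simp add: c_def)
qed

section \<open>The ellipse in bifocal form and the Joukowski map\<close>

locale arc_ellipse =
  fixes h \<rho> :: real
  assumes h: "\<bar>h\<bar> < 1" and \<rho>: "\<rho> > 1"
begin

definition E :: "complex set" where
  "E = {z. dist z (complex_of_real h) + dist z 1 < (1 - h) / 2 * (\<rho> + 1 / \<rho>)}"

lemma open_ellipse_E: "open_ellipse (complex_of_real h) 1 (\<rho> * (1 - h) / 2) = E"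
  using open_ellipse_eq[of h \<rho>] h \<rho> by (simp add: E_def)

lemma open_E: "open E"
  unfolding E_def by (intro open_Collect_less continuous_intros)

text \<open>The sum of the distances to two points is a convex function. Convexity admits a Cauchy
  formula for closed curves that are not known to be simple.\<close>

lemma convex_E: "convex E"
proof (rule convexI)
  fix x y :: complex and u v :: real
  assume xy: "x \<in> E" "y \<in> E" and uv: "0 \<le> u" "0 \<le> v" "u + v = 1"
  define k where "k = (1 - h) / 2 * (\<rho> + 1 / \<rho>)"
  let ?z = "u *\<^sub>R x + v *\<^sub>R y"
  have d: "dist ?z p \<le> u * dist x p + v * dist y p" for p :: complex
  proof -
    have "u *\<^sub>R p + v *\<^sub>R p = p" using uv(3) by (simp flip: scaleR_add_left)
    moreover have "?z - (u *\<^sub>R p + v *\<^sub>R p) = u *\<^sub>R (x - p) + v *\<^sub>R (y - p)"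
      by (simp add: scaleR_right_diff_distrib)
    ultimately have "?z - p = u *\<^sub>R (x - p) + v *\<^sub>R (y - p)" by simp
    then show ?thesis
      using uv norm_triangle_ineq[of "u *\<^sub>R (x - p)" "v *\<^sub>R (y - p)"] by (simp add: dist_norm)
  qed
  have "dist ?z h + dist ?z 1 \<le> u * (dist x h + dist x 1) + v * (dist y h + dist y 1)"
    using d[of h] d[of 1] by (simp add: algebra_simps)
  also have "\<dots> < k"
  proof -
    have "dist x h + dist x 1 < k" "dist y h + dist y 1 < k"
      using xy by (auto simp: E_def k_def)
    then show ?thesis using uv by (rule convex_bound_lt)
  qed
  finally show "?z \<in> E" by (simp add: E_def k_def)
qed

text \<open>Between the foci the two distances add up to \<open>1 - h\<close>, and
  \<open>\<rho> + 1 / \<rho> > 2\<close> because \<open>(\<rho> - 1)\<^sup>2 > 0\<close>.\<close>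

lemma segment_in_E:
  assumes "h \<le> x" "x \<le> 1"
  shows "complex_of_real x \<in> E"
proof -
  have "dist (complex_of_real x) (complex_of_real h) + dist (complex_of_real x) 1 = 1 - h"
    using assms dist_of_real[of x 1, where 'a = complex] by (simp add: dist_real_def)
  moreover have "2 < \<rho> + 1 / \<rho>"
  proof -
    have "0 < (\<rho> - 1)\<^sup>2" using \<rho> by simp
    then show ?thesis using \<rho> by (simp add: power2_eq_square field_simps)
  qed
  then have "1 - h < (1 - h) / 2 * (\<rho> + 1 / \<rho>)"
  proof -
    assume *: "2 < \<rho> + 1 / \<rho>"
    have "(1 - h) / 2 * 2 < (1 - h) / 2 * (\<rho> + 1 / \<rho>)"
      by (rule mult_strict_left_mono[OF *]) (use h in auto)
    moreover have "(1 - h) / 2 * 2 = 1 - h" by simp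
    ultimately show ?thesis by (simp only:)
  qed
  ultimately show ?thesis by (simp only: E_def mem_Collect_eq)
qed

text \<open>The Joukowski map, scaled so that its critical points 1 and -1 go to the foci 1 and
  \<open>h\<close>. The circle of radius \<open>r > 1\<close> goes to the confocal ellipse whose
  semiaxes sum to \<open>r * (1 - h) / 2\<close>.\<close>

definition J :: "complex \<Rightarrow> complex" where
  "J w = of_real ((1 + h) / 2) + of_real ((1 - h) / 4) * (w + 1 / w)"

lemma J_minus_foci:
  assumes "w \<noteq> 0"
  shows "J w - 1 = of_real ((1 - h) / 4) * (w - 1)\<^sup>2 / w"
    and "J w - of_real h = of_real ((1 - h) / 4) * (w + 1)\<^sup>2 / w"
  using assms by (simp_all add: J_def field_simps power2_eq_square)

text \<open>By \<open>J_minus_foci\<close> the focal distances are proportional to the squared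
  moduli of \<open>w - 1\<close> and \<open>w + 1\<close>. The parallelogram law sums them to
  \<open>(1 - h) / 2 * (r + 1 / r)\<close>, and \<open>r + 1 / r\<close> increases for
  \<open>r > 1\<close>.\<close>

lemma J_in_E:
  assumes "1 < cmod w" "cmod w < \<rho>"
  shows "J w \<in> E"
proof -
  define r where "r = cmod w"
  have w: "w \<noteq> 0" and r: "1 < r" "r < \<rho>" using assms by (auto simp: r_def)
  have "(cmod (w - 1))\<^sup>2 + (cmod (w + 1))\<^sup>2 = 2 * (r\<^sup>2 + 1)"
    unfolding r_def cmod_power2 by (simp add: power2_eq_square algebra_simps)
  moreover have "dist (J w) h + dist (J w) 1 =
      (1 - h) / 4 * ((cmod (w - 1))\<^sup>2 + (cmod (w + 1))\<^sup>2) / r"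
    using h unfolding dist_norm J_minus_foci[OF w] norm_mult norm_divide norm_power norm_of_real r_def
    by (simp add: distrib_left add_divide_distrib)
  ultimately have "dist (J w) h + dist (J w) 1 = (1 - h) / 2 * (r + 1 / r)"
    using r by (simp add: field_simps power2_eq_square)
  moreover have "r + 1 / r < \<rho> + 1 / \<rho>"
  proof -
    have "r * \<rho> > 1" using r less_1_mult[of r \<rho>] by auto
    then have "0 < (\<rho> - r) * (1 - 1 / (r * \<rho>))"
      using r by (intro mult_pos_pos) (auto simp: field_simps)
    also have "\<dots> = (\<rho> + 1 / \<rho>) - (r + 1 / r)" using r by (simp add: field_simps)
    finally show ?thesis by simp
  qed
  then have "(1 - h) / 2 * (r + 1 / r) < (1 - h) / 2 * (\<rho> + 1 / \<rho>)"
    using h by (intro mult_strict_left_mono) auto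
  ultimately show ?thesis by (simp only: E_def mem_Collect_eq)
qed

end

text \<open>The Chebyshev polynomials in the argument \<open>1 - 2 * s\<close>. The parameter
  \<open>s = (1 - cos \<beta>) / 2\<close> is the one with
  \<open>J (cis \<beta>) = 1 + (h - 1) * s\<close>.\<close>

fun shifted_cheb :: "nat \<Rightarrow> real poly" where
  "shifted_cheb 0 = 1"
| "shifted_cheb (Suc 0) = [:1, -2:]"
| "shifted_cheb (Suc (Suc n)) = [:2, -4:] * shifted_cheb (Suc n) - shifted_cheb n"

lemma degree_shifted_cheb: "degree (shifted_cheb n) \<le> n"
proof (induction n rule: shifted_cheb.induct)
  case (3 n)
  have "degree ([:2, -4:] * shifted_cheb (Suc n)) \<le> 1 + Suc n"
    by (rule order_trans[OF degree_mult_le]) (use 3 in \<open>intro add_mono, auto\<close>)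
  then show ?case using 3 by (auto intro!: degree_diff_le)
qed auto

lemma poly_shifted_cheb: "poly (shifted_cheb n) ((1 - cos \<beta>) / 2) = cos (real n * \<beta>)"
proof (induction n rule: shifted_cheb.induct)
  case (3 n)
  have "cos (real (Suc (Suc n)) * \<beta>) + cos (real n * \<beta>) = 2 * cos \<beta> * cos (real (Suc n) * \<beta>)"
    using cos_add[of "real (Suc n) * \<beta>" \<beta>] cos_diff[of "real (Suc n) * \<beta>" \<beta>]
    by (simp add: algebra_simps)
  with 3 show ?case by (simp add: field_simps)
qed (auto simp: field_simps)

text \<open>A finite geometric series with its exact remainder, so that later only finite sums have
  to be integrated.\<close>

lemma cauchy_kernel_expansion:
  fixes w u :: complex
  assumes "w \<noteq> 0" "w \<noteq> u"
  shows "1 / (w - u) = (\<Sum>k\<le>n. u ^ k / w ^ Suc k) + u ^ Suc n / (w ^ Suc n * (w - u))"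
proof (induction n)
  case 0
  then show ?case using assms by (simp add: field_simps)
next
  case (Suc n)
  have "u ^ Suc n / (w ^ Suc n * (w - u)) =
      u ^ Suc n / w ^ Suc (Suc n) + u ^ Suc (Suc n) / (w ^ Suc (Suc n) * (w - u))"
    using assms by (simp add: field_simps)
  with Suc show ?case by simp
qed

text \<open>The expansions for \<open>u\<close> and \<open>inverse u\<close> are added;
  \<open>1 / w\<close> compensates for the term \<open>k = 0\<close> being counted twice. On the
  unit circle \<open>u ^ k + inverse u ^ k\<close> is twice a Chebyshev value.\<close>

lemma joukowski_kernel_expansion:
  fixes w u :: complex
  assumes "w \<noteq> 0" "w \<noteq> u" "w \<noteq> inverse u" "u \<noteq> 0"
  shows "1 / (w - u) + 1 / (w - inverse u) - 1 / w =
     (\<Sum>k\<le>n. (if k = 0 then 1 else u ^ k + inverse u ^ k) / w ^ Suc k) +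
     (u ^ Suc n / (w - u) + inverse u ^ Suc n / (w - inverse u)) / w ^ Suc n"
proof -
  have "(\<Sum>k\<le>n. (if k = 0 then 1 else u ^ k + inverse u ^ k) / w ^ Suc k) =
      (\<Sum>k\<le>n. u ^ k / w ^ Suc k) + (\<Sum>k\<le>n. inverse u ^ k / w ^ Suc k) - 1 / w"
  proof (induction n)
    case (Suc n)
    then show ?case by (simp add: add_divide_distrib)
  qed simp
  then show ?thesis
    unfolding cauchy_kernel_expansion[OF assms(1,2), of n] cauchy_kernel_expansion[OF assms(1,3), of n]
    by (simp add: add_divide_distrib mult.commute)
qed

text \<open>\<open>sqrt\<close> is an odd function on all reals, so
  \<open>2 * sqrt (t - 1/2)\<close> is continuous across the singularity and an antiderivative on
  both sides of it. The fundamental theorem tolerates the one exceptional point.\<close>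

lemma has_integral_inverse_sqrt_abs:
  "((\<lambda>t. 1 / sqrt \<bar>t - 1/2\<bar>) has_integral 2 * sqrt 2) {0..1::real}"
proof -
  have "((\<lambda>t. 1 / sqrt \<bar>t - 1/2\<bar>) has_integral (2 * sqrt (1 - 1/2) - 2 * sqrt (0 - 1/2))) {0..1::real}"
  proof (rule fundamental_theorem_of_calculus_interior_strong[of "{1/2}"])
    show "continuous_on {0..1} (\<lambda>t. 2 * sqrt (t - 1/2))"
      by (intro continuous_intros)
    fix t :: real assume t: "t \<in> {0<..<1} - {1/2}"
    have "((\<lambda>t. 2 * sqrt (t - 1/2)) has_real_derivative 1 / sqrt \<bar>t - 1/2\<bar>) (at t)"
    proof (cases "t > 1/2")
      case True
      then show ?thesis
        by (auto intro!: derivative_eq_intros simp: field_simps)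
    next
      case False
      with t have t': "t < 1/2" by auto
      have "((\<lambda>t. - (2 * sqrt (1/2 - t))) has_real_derivative 1 / sqrt \<bar>t - 1/2\<bar>) (at t)"
        using t' by (auto intro!: derivative_eq_intros simp: field_simps)
      moreover have "(\<lambda>t. - (2 * sqrt (1/2 - t))) = (\<lambda>t::real. 2 * sqrt (t - 1/2))"
        by (metis (no_types) minus_diff_eq mult_minus_right real_sqrt_minus)
      ultimately show ?thesis by simp
    qed
    then show "((\<lambda>t. 2 * sqrt (t - 1/2)) has_vector_derivative 1 / sqrt \<bar>t - 1/2\<bar>) (at t)"
      by (simp add: has_real_derivative_iff_has_vector_derivative)
  qed auto
  moreover have "2 * sqrt (1 - 1/2) - 2 * sqrt (0 - 1/2) = 2 * sqrt (2::real)"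
    by (simp add: real_sqrt_divide real_sqrt_minus field_simps)
  ultimately show ?thesis by simp
qed

section \<open>The Cauchy integral in the Joukowski coordinate\<close>

context arc_ellipse
begin

lemma J_has_field_derivative:
  assumes "w \<noteq> 0"
  shows "(J has_field_derivative of_real ((1 - h) / 4) * (1 - 1 / w\<^sup>2)) (at w)"
  unfolding J_def using assms
  by (auto intro!: derivative_eq_intros simp: power2_eq_square field_simps)

lemma J_holomorphic: "J holomorphic_on - {0}"
  unfolding J_def by (intro holomorphic_intros) auto

lemma J_unit_circle: "J (cis \<beta>) = of_real (1 + (h - 1) * ((1 - cos \<beta>) / 2))"
proof -
  have "cis \<beta> + 1 / cis \<beta> = of_real (2 * cos \<beta>)"
    by (simp add: complex_eq_iff divide_inverse cis_inverse)
  then show ?thesis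
    unfolding J_def by (simp only:) (simp add: complex_eq_iff field_simps)
qed

text \<open>\<open>J w - J u\<close> is a constant times
  \<open>(w - u) * (w - inverse u) / w\<close>, with two zeros and a pole at 0. The left side is its
  logarithmic derivative, hence a sum of three simple fractions.\<close>

lemma J_log_derivative:
  assumes "w \<noteq> 0" "u \<noteq> 0" "w \<noteq> u" "w \<noteq> inverse u"
  shows "of_real ((1 - h) / 4) * (1 - 1 / w\<^sup>2) / (J w - J u) =
     1 / (w - u) + 1 / (w - inverse u) - 1 / w"
    and "J w \<noteq> J u"
proof -
  define d where "d = complex_of_real ((1 - h) / 4)"
  have d: "d \<noteq> 0" using h by (simp add: d_def)
  have wu: "w * u - 1 \<noteq> 0"
    using assms(2,4) by (metis eq_iff_diff_eq_0 inverse_unique mult.commute)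
  have "J w - J u = d * ((w + 1 / w) - (u + 1 / u))"
    unfolding J_def d_def by (simp add: right_diff_distrib)
  also have "(w + 1 / w) - (u + 1 / u) = (w - u) * (w * u - 1) / (w * u)"
    using assms by (simp add: field_simps)
  finally have eq: "J w - J u = d * (w - u) * (w * u - 1) / (w * u)"
    by simp
  show "J w \<noteq> J u" using eq d wu assms by auto
  have inv: "w - inverse u = (w * u - 1) / u"
    using assms by (simp add: field_simps)
  have nz: "w - u \<noteq> 0" using assms by auto
  have "d * (1 - 1 / w\<^sup>2) / (J w - J u) = (1 - 1 / w\<^sup>2) * (w * u) / ((w - u) * (w * u - 1))"
    unfolding eq using d by simp
  also have "\<dots> = (w\<^sup>2 - 1) * u / (w * ((w - u) * (w * u - 1)))"
  proof -
    have "(1 - 1 / w\<^sup>2) * (w * u) = (w\<^sup>2 - 1) * u / w"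
      using assms by (simp add: power2_eq_square field_simps)
    then show ?thesis by simp
  qed
  also have "\<dots> = 1 / (w - u) + u / (w * u - 1) - 1 / w"
  proof -
    have "1 / (w - u) + u / (w * u - 1) - 1 / w =
       (w * (w * u - 1) + u * (w * (w - u)) - (w - u) * (w * u - 1)) / (w * ((w - u) * (w * u - 1)))"
      using nz wu assms by (simp add: add_frac_eq diff_frac_eq) (simp add: algebra_simps)
    also have "w * (w * u - 1) + u * (w * (w - u)) - (w - u) * (w * u - 1) = (w\<^sup>2 - 1) * u"
      by (simp add: power2_eq_square algebra_simps)
    finally show ?thesis by simp
  qed
  finally show "of_real ((1 - h) / 4) * (1 - 1 / w\<^sup>2) / (J w - J u) =
     1 / (w - u) + 1 / (w - inverse u) - 1 / w"
    by (simp add: inv d_def)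
qed

lemma continuous_on_circle:
  assumes G: "G holomorphic_on E" and r: "1 < r" "r < \<rho>"
  shows "continuous_on (path_image (circlepath 0 r)) (\<lambda>w. G (J w))"
proof (rule continuous_on_compose2[OF holomorphic_on_imp_continuous_on[OF G]])
  show "continuous_on (path_image (circlepath 0 r)) J"
    using r by (intro continuous_on_subset[OF holomorphic_on_imp_continuous_on[OF J_holomorphic]]) auto
  show "J ` path_image (circlepath 0 r) \<subseteq> E"
    using r J_in_E by auto
qed

text \<open>The Cauchy integral over the ellipse \<open>J(|w| = r)\<close>, pulled back to the circle; in the coordinate
  \<open>w\<close> the Cauchy kernel becomes the generating function of the Chebyshev polynomials.\<close>

lemma cauchy_formula_joukowski:
  assumes G: "G holomorphic_on E" and r: "1 < r" "r < \<rho>" and u: "cmod u = 1" "J u \<in> E"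
  shows "((\<lambda>w. G (J w) * (1 / (w - u) + 1 / (w - inverse u) - 1 / w))
      has_contour_integral 2 * pi * \<i> * G (J u)) (circlepath 0 r)"
proof -
  let ?\<gamma> = "circlepath 0 r" and ?z = "J u"
  let ?J' = "\<lambda>w. of_real ((1 - h) / 4) * (1 - 1 / w\<^sup>2)"
  let ?k = "\<lambda>w. 1 / (w - u) + 1 / (w - inverse u) - 1 / w"
  have path: "path_image ?\<gamma> \<subseteq> - {0}" using r by auto
  have u0: "u \<noteq> 0" using u by auto
  have on_path: "w \<noteq> 0" "w \<noteq> u" "w \<noteq> inverse u" "cmod w = r" if "w \<in> path_image ?\<gamma>" for w
    using that r u by (auto simp: norm_inverse)
  have val: "valid_path (J \<circ> ?\<gamma>)"
    by (rule valid_path_compose_holomorphic[OF _ J_holomorphic _ path]) auto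
  have img: "path_image (J \<circ> ?\<gamma>) \<subseteq> E - {?z}"
    using on_path r J_in_E J_log_derivative(2)[OF _ u0] by (force simp: path_image_compose)
  have comp: "contour_integral (J \<circ> ?\<gamma>) g = contour_integral ?\<gamma> (\<lambda>w. ?J' w * g (J w))" for g
  proof -
    have "contour_integral (J \<circ> ?\<gamma>) g = contour_integral ?\<gamma> (\<lambda>w. deriv J w * g (J w))"
      by (rule contour_integral_comp_analyticW[OF _ _ path])
         (simp_all add: analytic_on_open open_Compl J_holomorphic)
    also have "\<dots> = contour_integral ?\<gamma> (\<lambda>w. ?J' w * g (J w))"
      using on_path(1) by (intro contour_integral_cong)
        (auto simp: DERIV_imp_deriv[OF J_has_field_derivative])
    finally show ?thesis .
  qed
  have pole: "((\<lambda>w. 1 / (w - a)) has_contour_integral 2 * pi * \<i>) ?\<gamma>" if "cmod a < r" for a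
    using Cauchy_integral_circlepath_simple[of "\<lambda>_. 1" 0 r a] that by simp
  have "(?k has_contour_integral 2 * pi * \<i> + 2 * pi * \<i> - 2 * pi * \<i>) ?\<gamma>"
    using r u pole[of 0]
    by (intro has_contour_integral_diff has_contour_integral_add pole) (auto simp: norm_inverse)
  then have "(?k has_contour_integral 2 * pi * \<i>) ?\<gamma>" by (simp add: mult_ac)
  then have "contour_integral ?\<gamma> (\<lambda>w. ?J' w * (1 / (J w - ?z))) = 2 * pi * \<i>"
    by (subst contour_integral_cong[of _ _ _ ?k])
       (use on_path u0 J_log_derivative(1) in \<open>auto simp: contour_integral_unique\<close>)
  then have wn: "winding_number (J \<circ> ?\<gamma>) ?z = 1"
    by (subst winding_number_valid_path[OF val]) (use img in \<open>auto simp: comp\<close>)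
  have cauchy: "((\<lambda>\<zeta>. G \<zeta> / (\<zeta> - ?z)) has_contour_integral 2 * pi * \<i> * G ?z) (J \<circ> ?\<gamma>)"
    using Cauchy_integral_formula_convex_simple[OF convex_E G _ val img] u wn open_E
    by (simp add: interior_open pathfinish_compose pathstart_compose)
  have lhs: "contour_integral ?\<gamma> (\<lambda>w. ?J' w * (G (J w) / (J w - ?z))) = 2 * pi * \<i> * G ?z"
    using contour_integral_unique[OF cauchy] unfolding comp .
  have eq: "contour_integral ?\<gamma> (\<lambda>w. ?J' w * (G (J w) / (J w - ?z))) =
      contour_integral ?\<gamma> (\<lambda>w. G (J w) * ?k w)"
    using on_path u0 by (intro contour_integral_cong) (auto simp flip: J_log_derivative(1))
  have int: "(\<lambda>w. G (J w) * ?k w) contour_integrable_on ?\<gamma>"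
  proof (rule contour_integrable_continuous_circlepath)
    show "continuous_on (path_image ?\<gamma>) (\<lambda>w. G (J w) * ?k w)"
      using on_path by (intro continuous_intros continuous_on_circle[OF G r]) auto
  qed
  show ?thesis
    using has_contour_integral_integral[OF int] unfolding eq[symmetric] lhs .
qed

text \<open>The kernel expansion splits the Cauchy formula into a Chebyshev sum and a remainder. The
  remainder is bounded by the integral \<open>L\<close> of a majorant and not by a maximum of
  \<open>G\<close>, which may grow without bound as \<open>r\<close> tends to
  \<open>\<rho>\<close>.\<close>

lemma joukowski_polynomial_approximation:
  assumes G: "G holomorphic_on E" and r: "1 < r" "r < \<rho>"
    and bound: "\<And>t. t \<in> {0..1} \<Longrightarrow> t \<noteq> 1/2 \<Longrightarrow> cmod (G (J (circlepath 0 r t))) \<le> \<phi> t"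
    and int: "(\<phi> has_integral L) {0..1}"
    and v: "\<And>s. s \<in> {0<..<1} \<Longrightarrow> complex_of_real (v s) = G (of_real (1 + (h - 1) * s))"
  shows "\<exists>p. degree p \<le> n \<and> (\<forall>s\<in>{0<..<1}. \<bar>v s - poly p s\<bar> \<le> 2 * L / (r - 1) / r ^ n)"
proof -
  let ?\<gamma> = "circlepath 0 r"
  define a where "a k = contour_integral ?\<gamma> (\<lambda>w. G (J w) / w ^ Suc k) / (2 * pi * \<i>)" for k
  \<comment> \<open>The factors \<open>e k\<close> below and the values \<open>v s\<close> are real,
    so taking real parts of the coefficients preserves the identity. The factor 2 is that of
    \<open>2 * cos (real k * \<beta>)\<close> for \<open>k > 0\<close>.\<close>
  define p where "p = (\<Sum>k\<le>n. smult (if k = 0 then Re (a 0) else 2 * Re (a k)) (shifted_cheb k))"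
  have "degree p \<le> n"
    unfolding p_def
    by (intro degree_sum_le) (auto intro: order_trans[OF degree_smult_le] order_trans[OF degree_shifted_cheb])
  moreover have "\<bar>v s - poly p s\<bar> \<le> 2 * L / (r - 1) / r ^ n" if s: "s \<in> {0<..<1}" for s
  proof -
    \<comment> \<open>Chosen such that \<open>J (cis \<beta>)\<close> is the point of the segment
      with parameter \<open>s\<close>.\<close>
    define \<beta> where "\<beta> = arccos (1 - 2 * s)"
    have s_eq: "s = (1 - cos \<beta>) / 2" using s by (simp add: \<beta>_def cos_arccos_abs)
    define u where "u = cis \<beta>"
    have u: "cmod u = 1" by (simp add: u_def)
    then have u0: "u \<noteq> 0" by auto
    have Ju: "J u = of_real (1 + (h - 1) * s)" by (simp add: u_def J_unit_circle s_eq)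
    have "0 \<le> (1 - h) * (1 - s)" "0 \<le> (1 - h) * s" using s h by (auto intro!: mult_nonneg_nonneg)
    then have JuE: "J u \<in> E" unfolding Ju by (intro segment_in_E) (auto simp: algebra_simps)
    have vs: "G (J u) = v s" using v[OF s] Ju by simp
    have on_path: "w \<noteq> 0" "w \<noteq> u" "w \<noteq> inverse u" "cmod w = r" if "w \<in> path_image ?\<gamma>" for w
      using that r u by (auto simp: norm_inverse)
    note contGJ = continuous_on_circle[OF G r]
    define R where "R w = G (J w) *
      ((u ^ Suc n / (w - u) + inverse u ^ Suc n / (w - inverse u)) / w ^ Suc n)" for w
    have "R contour_integrable_on ?\<gamma>"
      unfolding R_def using on_path
      by (intro contour_integrable_continuous_circlepath continuous_intros contGJ) auto
    then obtain I where I: "(R has_contour_integral I) ?\<gamma>"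
      by (auto simp: contour_integrable_on_def)
    define e where "e k = (if k = 0 then 1 else u ^ k + inverse u ^ k)" for k :: nat
    have e: "e k = of_real (if k = 0 then 1 else 2 * cos (real k * \<beta>))" for k
      by (auto simp: e_def u_def cis_inverse Complex.DeMoivre complex_eq_iff)
    have coeffs: "((\<lambda>w. e k * (G (J w) / w ^ Suc k)) has_contour_integral e k * (2 * pi * \<i> * a k)) ?\<gamma>" for k
    proof -
      have "(\<lambda>w. G (J w) / w ^ Suc k) contour_integrable_on ?\<gamma>"
        using on_path by (intro contour_integrable_continuous_circlepath continuous_intros contGJ) auto
      then show ?thesis
        by (intro has_contour_integral_lmul) (simp add: a_def has_contour_integral_integral)
    qed
    have "((\<lambda>w. (\<Sum>k\<le>n. e k * (G (J w) / w ^ Suc k)) + R w) has_contour_integral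
        (\<Sum>k\<le>n. e k * (2 * pi * \<i> * a k)) + I) ?\<gamma>"
      by (intro has_contour_integral_add has_contour_integral_sum coeffs I) auto
    moreover have "(\<Sum>k\<le>n. e k * (G (J w) / w ^ Suc k)) + R w =
        G (J w) * (1 / (w - u) + 1 / (w - inverse u) - 1 / w)" if "w \<in> path_image ?\<gamma>" for w
      unfolding joukowski_kernel_expansion[OF on_path(1-3)[OF that] u0, of n]
      by (simp add: R_def e_def distrib_left sum_distrib_left mult_ac)
    ultimately have "((\<lambda>w. G (J w) * (1 / (w - u) + 1 / (w - inverse u) - 1 / w)) has_contour_integral
        (\<Sum>k\<le>n. e k * (2 * pi * \<i> * a k)) + I) ?\<gamma>"
      by (rule has_contour_integral_eq)
    then have "2 * pi * \<i> * v s = (\<Sum>k\<le>n. e k * (2 * pi * \<i> * a k)) + I"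
      using cauchy_formula_joukowski[OF G r u JuE] has_contour_integral_unique vs by fastforce
    also have "(\<Sum>k\<le>n. e k * (2 * pi * \<i> * a k)) = 2 * pi * \<i> * (\<Sum>k\<le>n. e k * a k)"
      by (simp add: sum_distrib_left mult_ac)
    finally have "v s - (\<Sum>k\<le>n. e k * a k) = I / (2 * pi * \<i>)"
      by (simp add: field_simps)
    moreover have "poly p s = Re (\<Sum>k\<le>n. e k * a k)"
      unfolding p_def poly_sum Re_sum e s_eq
      by (intro sum.cong) (auto simp: poly_shifted_cheb)
    ultimately have "v s - poly p s = Re (I / (2 * pi * \<i>))"
      by (metis Re_complex_of_real minus_complex.sel(1))
    also have "\<bar>\<dots>\<bar> \<le> cmod (I / (2 * pi * \<i>))" by (rule abs_Re_le_cmod)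
    also have "\<dots> = cmod I / (2 * pi)" by (simp add: norm_divide norm_mult)
    finally have main: "\<bar>v s - poly p s\<bar> \<le> cmod I / (2 * pi)" .
    have "((\<lambda>t. R (?\<gamma> t) * (2 * pi * \<i> * ?\<gamma> t)) has_integral I) {0..1}"
    proof (rule has_integral_eq[rotated, OF I[unfolded has_contour_integral_def]])
      fix t :: real assume "t \<in> {0..1}"
      then have "vector_derivative ?\<gamma> (at t within {0..1}) = 2 * pi * \<i> * ?\<gamma> t"
        by (subst vector_derivative_circlepath01) (auto simp: circlepath mult_ac)
      then show "R (?\<gamma> t) * vector_derivative ?\<gamma> (at t within {0..1}) = R (?\<gamma> t) * (2 * pi * \<i> * ?\<gamma> t)"
        by (rule arg_cong)
    qed
    \<comment> \<open>The bound by \<open>\<phi>\<close> is not assumed at \<open>t = 1/2\<close>;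
      resetting one value on both sides leaves the integrals unchanged.\<close>
    then have int_R: "((\<lambda>t. if t = 1/2 then 0 else R (?\<gamma> t) * (2 * pi * \<i> * ?\<gamma> t)) has_integral I) {0..1}"
      by (rule has_integral_spike_finite[of "{1/2}", rotated 2]) auto
    have int_\<phi>: "((\<lambda>t. 2 * pi * (2 / (r - 1) / r ^ n) * (if t = 1/2 then 0 else \<phi> t)) has_integral
        2 * pi * (2 / (r - 1) / r ^ n) * L) {0..1}"
      by (intro has_integral_mult_right has_integral_spike_finite[of "{1/2}", OF _ _ int]) auto
    have "cmod (if t = 1/2 then 0 else R (?\<gamma> t) * (2 * pi * \<i> * ?\<gamma> t)) \<le>
        2 * pi * (2 / (r - 1) / r ^ n) * (if t = 1/2 then 0 else \<phi> t)" if t: "t \<in> {0..1}" for t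
    proof (cases "t = 1/2")
      case False
      define w where "w = ?\<gamma> t"
      have wp: "w \<in> path_image ?\<gamma>" using t by (simp add: w_def path_image_def)
      note w = on_path[OF wp]
      have frac: "cmod (x ^ Suc n / (w - x)) \<le> 1 / (r - 1)" if "cmod x = 1" for x
      proof -
        have "r - 1 \<le> cmod (w - x)" using norm_triangle_ineq2[of w x] w that by simp
        then show ?thesis
          using r that by (simp add: norm_divide norm_mult norm_power frac_le)
      qed
      have "cmod (u ^ Suc n / (w - u) + inverse u ^ Suc n / (w - inverse u)) \<le> 1 / (r - 1) + 1 / (r - 1)"
        using u by (intro norm_triangle_mono frac) (auto simp: norm_inverse)
      then have k: "cmod (u ^ Suc n / (w - u) + inverse u ^ Suc n / (w - inverse u)) \<le> 2 / (r - 1)"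
        by simp
      \<comment> \<open>The derivative of the path has modulus \<open>2 * pi * r\<close>, which
        turns \<open>r ^ Suc n\<close> into \<open>r ^ n\<close>; the two kernels contribute
        \<open>1 / (r - 1)\<close> each.\<close>
      have "cmod (R w * (2 * pi * \<i> * w)) = cmod (G (J w)) *
          (cmod (u ^ Suc n / (w - u) + inverse u ^ Suc n / (w - inverse u)) / r ^ Suc n) * (2 * pi * r)"
        using w unfolding R_def norm_mult norm_divide norm_power by simp
      also have "\<dots> \<le> \<phi> t * (2 / (r - 1) / r ^ Suc n) * (2 * pi * r)"
        using bound[OF t False] r k unfolding w_def[symmetric]
        by (intro mult_right_mono mult_mono divide_right_mono)
           (auto intro: order_trans[OF norm_ge_zero])
      also have "\<dots> = 2 * pi * (2 / (r - 1) / r ^ n) * \<phi> t" using r by simp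
      finally show ?thesis using False by (simp add: w_def)
    qed simp
    from integral_norm_bound_integral[OF has_integral_integrable[OF int_R] has_integral_integrable[OF int_\<phi>] this]
    have "cmod I \<le> 2 * pi * (2 / (r - 1) / r ^ n) * L"
      unfolding integral_unique[OF int_R] integral_unique[OF int_\<phi>] .
    then have "cmod I / (2 * pi) \<le> 2 * L / (r - 1) / r ^ n"
      by (simp add: field_simps)
    with main show ?thesis by linarith
  qed
  ultimately show ?thesis by blast
qed

text \<open>For each \<open>n\<close> the radius is moved so close to \<open>\<rho>\<close> that
  \<open>\<rho> ^ n < 2 * r ^ n\<close>. Since \<open>C\<close> is uniform in \<open>r\<close> and
  \<open>r - 1 \<ge> r0 - 1\<close>, the constant does not deteriorate.\<close>

theorem geom_approx_of_holomorphic: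
  assumes G: "G holomorphic_on E" and r0: "1 < r0" "r0 < \<rho>"
    and bound: "\<And>r t. r0 \<le> r \<Longrightarrow> r < \<rho> \<Longrightarrow> t \<in> {0..1} \<Longrightarrow> t \<noteq> 1/2 \<Longrightarrow>
        cmod (G (J (circlepath 0 r t))) \<le> C / sqrt \<bar>t - 1/2\<bar>"
    and v: "\<And>s. s \<in> {0<..<1} \<Longrightarrow> complex_of_real (v s) = G (of_real (1 + (h - 1) * s))"
  shows "geom_approx \<rho> v"
proof -
  define L where "L = C * (2 * sqrt 2)"
  have int: "((\<lambda>t. C / sqrt \<bar>t - 1/2\<bar>) has_integral L) {0..1}"
    unfolding L_def using has_integral_mult_right[OF has_integral_inverse_sqrt_abs, of C] by simp
  have "0 \<le> C / sqrt \<bar>0 - 1/2\<bar>"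
    by (rule order_trans[OF norm_ge_zero bound[of r0 0]]) (use r0 in auto)
  then have "L \<ge> 0" by (simp add: L_def zero_le_divide_iff)
  have "\<exists>p. degree p \<le> n \<and> (\<forall>s\<in>{0<..<1}. \<bar>v s - poly p s\<bar> \<le> (4 * L / (r0 - 1)) / \<rho> ^ n)" for n
  proof -
    have "\<exists>r. r0 \<le> r \<and> r < \<rho> \<and> \<rho> ^ n < 2 * r ^ n"
    proof -
      have "((\<lambda>r. 2 * r ^ n) \<longlongrightarrow> 2 * \<rho> ^ n) (at_left \<rho>)"
        by (intro tendsto_intros)
      then have "eventually (\<lambda>r. \<rho> ^ n < 2 * r ^ n) (at_left \<rho>)"
        by (rule order_tendstoD) (use \<rho> in simp)
      moreover have "eventually (\<lambda>r. r \<in> {r0<..<\<rho>}) (at_left \<rho>)"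
        using r0 by (intro eventually_at_left_real)
      ultimately have "eventually (\<lambda>r. r0 \<le> r \<and> r < \<rho> \<and> \<rho> ^ n < 2 * r ^ n) (at_left \<rho>)"
        by eventually_elim auto
      then show ?thesis using eventually_happens'[of "at_left \<rho>"] by auto
    qed
    then obtain r where r: "r0 \<le> r" "r < \<rho>" "\<rho> ^ n < 2 * r ^ n" by blast
    then have r1: "1 < r" using r0 by linarith
    obtain p where p: "degree p \<le> n" "\<And>s. s \<in> {0<..<1} \<Longrightarrow> \<bar>v s - poly p s\<bar> \<le> 2 * L / (r - 1) / r ^ n"
      using joukowski_polynomial_approximation[OF G r1 r(2) bound[OF r(1,2)] int v] by blast
    have le: "2 * L / (r - 1) / r ^ n \<le> (4 * L / (r0 - 1)) / \<rho> ^ n"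
    proof -
      have "1 / r ^ n \<le> 2 / \<rho> ^ n" using r r1 \<rho> by (simp add: field_simps)
      moreover have "2 * L / (r - 1) \<le> 2 * L / (r0 - 1)"
        using r r0 \<open>L \<ge> 0\<close> by (intro divide_left_mono) auto
      ultimately have "2 * L / (r - 1) * (1 / r ^ n) \<le> 2 * L / (r0 - 1) * (2 / \<rho> ^ n)"
        using r1 r0 \<open>L \<ge> 0\<close> by (intro mult_mono) auto
      then show ?thesis by simp
    qed
    show ?thesis
      by (intro exI[of _ p] conjI ballI p(1) order_trans[OF p(2) le])
  qed
  then show ?thesis unfolding geom_approx_def by blast
qed

end

section \<open>Even and odd parts of the continued function\<close>

text \<open>\<open>G\<close> is \<open>K\<close> composed with \<open>Arccos\<close>, whose branch
  cuts are harmless thanks to \<open>inv\<close>. Away from the critical values 1 and -1,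
  \<open>cos\<close> has local holomorphic inverses; at these two values continuity makes the
  singularities removable.\<close>

lemma holomorphic_factor_through_cos:
  assumes E: "open E" and K: "K holomorphic_on {\<theta>. cos \<theta> \<in> E}"
    and inv: "\<And>\<theta> \<theta>'. cos \<theta> \<in> E \<Longrightarrow> cos \<theta> = cos \<theta>' \<Longrightarrow> K \<theta> = K \<theta>'"
  obtains G :: "complex \<Rightarrow> complex"
    where "G holomorphic_on E" "\<And>\<theta>. cos \<theta> \<in> E \<Longrightarrow> G (cos \<theta>) = K \<theta>"
proof -
  let ?D = "{\<theta>. cos \<theta> \<in> E}"
  define G where "G x = K (Arccos x)" for x
  have GK: "G (cos \<theta>) = K \<theta>" if "cos \<theta> \<in> E" for \<theta>
    unfolding G_def by (rule inv) (use that in auto)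
  have cos_hol: "cos holomorphic_on S" for S :: "complex set"
    by (intro holomorphic_intros)
  have D: "open ?D"
  proof -
    have "open (cos -` E)"
      by (rule open_vimage[OF E]) (intro continuous_intros)
    then show ?thesis by (simp add: vimage_def)
  qed
  have nonconst: "\<not> cos constant_on (UNIV :: complex set)"
  proof
    assume "cos constant_on (UNIV :: complex set)"
    then obtain y where "\<And>x :: complex. cos x = y" by (auto simp: constant_on_def)
    from this[of 0] this[of "complex_of_real pi"] show False
      by (auto simp: cos_of_real)
  qed
  have "continuous_on E G"
    unfolding continuous_on_open_invariant
  proof (intro allI impI)
    fix V :: "complex set" assume V: "open V"
    have "open (K -` V \<inter> ?D)"
      using holomorphic_on_imp_continuous_on[OF K] V D by (simp add: continuous_on_open_vimage)
    \<comment> \<open>A preimage under \<open>G\<close> is the \<open>cos\<close>-image of a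
      preimage under \<open>K\<close>, so the open mapping theorem gives continuity, also at the
      critical values.\<close>
    then have "open (cos ` (K -` V \<inter> ?D))"
      by (intro open_mapping_thm[of cos UNIV] cos_hol nonconst) auto
    moreover have "cos ` (K -` V \<inter> ?D) \<inter> E = G -` V \<inter> E"
    proof (intro equalityI subsetI)
      fix x assume "x \<in> G -` V \<inter> E"
      then show "x \<in> cos ` (K -` V \<inter> ?D) \<inter> E"
        by (auto intro!: image_eqI[of x cos "Arccos x"] simp: G_def)
    qed (auto simp: GK)
    ultimately show "\<exists>A. open A \<and> A \<inter> E = G -` V \<inter> E" by blast
  qed
  moreover have "G holomorphic_on E - {1, -1}"
  proof -
    have "G field_differentiable at x" if x: "x \<in> E - {1, -1}" for x
    proof -
      define \<theta> where "\<theta> = Arccos x"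
      have \<theta>: "\<theta> \<in> ?D" "cos \<theta> = x" using x by (auto simp: \<theta>_def)
      have "deriv cos \<theta> = - sin \<theta>"
        by (rule DERIV_imp_deriv) (auto intro!: derivative_eq_intros)
      moreover have "sin \<theta> \<noteq> 0"
        using x \<theta> sin_cos_squared_add[of \<theta>] by (auto simp: power2_eq_1_iff)
      ultimately obtain r where r: "r > 0" "ball \<theta> r \<subseteq> ?D" "open (cos ` ball \<theta> r)" "inj_on cos (ball \<theta> r)"
        using has_complex_derivative_locally_invertible[OF cos_hol \<theta>(1) D] by auto
      obtain g where g: "g holomorphic_on (cos ` ball \<theta> r)" "\<And>z. z \<in> ball \<theta> r \<Longrightarrow> g (cos z) = z"
        using holomorphic_has_inverse[OF cos_hol open_ball r(4)] by metis
      have "(K \<circ> g) holomorphic_on (cos ` ball \<theta> r)"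
        by (rule holomorphic_on_compose[OF g(1)], rule holomorphic_on_subset[OF K])
           (use g r in auto)
      moreover have "(K \<circ> g) y = G y" if "y \<in> cos ` ball \<theta> r" for y
        using that g r by (auto simp: GK)
      ultimately have "G holomorphic_on (cos ` ball \<theta> r)"
        by (rule holomorphic_transform)
      moreover have "x \<in> cos ` ball \<theta> r" using r(1) \<theta>(2) by force
      ultimately show ?thesis using r(3) holomorphic_on_imp_differentiable_at by blast
    qed
    then show ?thesis
      unfolding holomorphic_on_def by (blast intro: field_differentiable_at_within)
  qed
  ultimately have "G holomorphic_on E"
    using no_isolated_singularity[OF _ _ E, of G "{1, -1}"] by auto
  then show ?thesis using that GK by blast
qed

text \<open>A zero at \<open>a\<close> makes the singularity of the quotient removable. Allowing
  \<open>a\<close> outside \<open>E\<close> covers every position of the point -1 relative to the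
  ellipse.\<close>

lemma holomorphic_divide_linear:
  assumes E: "open E" and k: "k holomorphic_on E" and 0: "a \<in> E \<Longrightarrow> k a = 0"
  obtains g where "g holomorphic_on E" "\<And>z. z \<in> E \<Longrightarrow> k z = (z - a) * g z"
proof (cases "a \<in> E")
  case True
  define g where "g z = (if z = a then deriv k a else (k z - k a) / (z - a))" for z
  have "g holomorphic_on E"
    using pole_lemma[OF k, of a] True E by (simp add: interior_open g_def[abs_def])
  moreover have "k z = (z - a) * g z" for z
    using 0 True by (simp add: g_def)
  ultimately show ?thesis using that by blast
next
  case False
  have "(\<lambda>z. k z / (z - a)) holomorphic_on E"
    using False by (intro holomorphic_intros k) auto
  moreover have "k z = (z - a) * (k z / (z - a))" if "z \<in> E" for z
    using that False by auto
  ultimately show ?thesis using that by blast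
qed

text \<open>A weak Jordan inequality from \<open>sin y = 2 * sin (y / 2) * cos (y / 2)\<close>: use
  \<open>x * cos x \<le> sin x\<close> at \<open>x = y / 2\<close>, and that the square of
  \<open>cos (y / 2)\<close> is at least 1/2 here.\<close>

lemma half_le_sin:
  assumes "0 \<le> y" "y \<le> pi / 2"
  shows "y / 2 \<le> sin y"
proof -
  have "x * cos x \<le> sin x" if "0 \<le> x" "x \<le> pi / 4" for x :: real
  proof -
    have "sin 0 - 0 * cos 0 \<le> sin x - x * cos x"
    proof (rule DERIV_nonneg_imp_nondecreasing[of 0 x "\<lambda>x. sin x - x * cos x"])
      fix z assume z: "0 \<le> z" "z \<le> x"
      have "((\<lambda>x. sin x - x * cos x) has_real_derivative z * sin z) (at z)"
        by (auto intro!: derivative_eq_intros)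
      moreover have "0 \<le> z * sin z"
        using z that by (intro mult_nonneg_nonneg sin_ge_zero) auto
      ultimately show "\<exists>y. ((\<lambda>x. sin x - x * cos x) has_real_derivative y) (at z) \<and> 0 \<le> y" by blast
    qed (use that in auto)
    then show ?thesis by simp
  qed
  from this[of "y / 2"] have le: "y / 2 * cos (y / 2) \<le> sin (y / 2)" using assms by simp
  have c: "0 \<le> cos (y / 2)" using assms by (intro cos_ge_zero) auto
  have "0 \<le> cos y" using assms by (intro cos_ge_zero) auto
  then have "1 / 2 \<le> cos (y / 2) * cos (y / 2)"
    using cos_double_cos[of "y / 2"] by (simp add: power2_eq_square)
  then have "y * (1 / 2) \<le> y * (cos (y / 2) * cos (y / 2))"
    using assms by (intro mult_left_mono)
  also have "\<dots> = 2 * (y / 2 * cos (y / 2)) * cos (y / 2)" by simp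
  also have "\<dots> \<le> 2 * sin (y / 2) * cos (y / 2)"
    using le c by (intro mult_right_mono) auto
  also have "\<dots> = sin y" using sin_double[of "y / 2"] by simp
  finally show ?thesis by simp
qed

section \<open>Growth on the images of the circles\<close>

context arc_ellipse
begin

text \<open>The midpoint of 1 and \<open>\<rho>\<close>. It keeps the circles away from the unit
  circle, whose image is the segment between the foci.\<close>

definition r0 :: real where "r0 = (1 + \<rho>) / 2"

lemma r0: "1 < r0" "r0 < \<rho>"
  using \<rho> by (auto simp: r0_def)

text \<open>The value \<open>t = 1/2\<close> belongs to \<open>w = - r\<close>, the leftmost point
  of the ellipse and the only place where the curve can meet -1. \<open>C\<close> is uniform up to
  the excluded radius \<open>\<rho>\<close>.\<close>

definition circle_bounded :: "(complex \<Rightarrow> complex) \<Rightarrow> bool" where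
  "circle_bounded G \<longleftrightarrow> (\<exists>C. \<forall>r t. r0 \<le> r \<longrightarrow> r < \<rho> \<longrightarrow> t \<in> {0..1} \<longrightarrow> t \<noteq> 1/2 \<longrightarrow>
     cmod (G (J (circlepath 0 r t))) \<le> C / sqrt \<bar>t - 1/2\<bar>)"

lemma geom_approx_of_circle_bounded:
  assumes "G holomorphic_on E" "circle_bounded G"
    and "\<And>s. s \<in> {0<..<1} \<Longrightarrow> complex_of_real (v s) = G (of_real (1 + (h - 1) * s))"
  shows "geom_approx \<rho> v"
proof -
  obtain C where "\<And>r t. r0 \<le> r \<Longrightarrow> r < \<rho> \<Longrightarrow> t \<in> {0..1} \<Longrightarrow> t \<noteq> 1/2 \<Longrightarrow>
     cmod (G (J (circlepath 0 r t))) \<le> C / sqrt \<bar>t - 1/2\<bar>"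
    using assms(2) unfolding circle_bounded_def by blast
  from geom_approx_of_holomorphic[OF assms(1) r0 this assms(3)] show ?thesis by blast
qed

lemma J_circle_in_E:
  assumes "r0 \<le> r" "r < \<rho>"
  shows "J (circlepath 0 r t) \<in> E"
  using assms r0 by (intro J_in_E) (auto simp: circlepath norm_mult)

text \<open>In \<open>J_minus_foci\<close> the squared factors have modulus at least
  \<open>r0 - 1\<close> before squaring, and the denominator has modulus below
  \<open>\<rho>\<close>.\<close>

lemma J_circle_foci_bound:
  obtains \<delta> where "\<delta> > 0"
    "\<And>r t. r0 \<le> r \<Longrightarrow> r < \<rho> \<Longrightarrow> \<delta> \<le> cmod (J (circlepath 0 r t) - 1)"
    "\<And>r t. r0 \<le> r \<Longrightarrow> r < \<rho> \<Longrightarrow> \<delta> \<le> cmod (J (circlepath 0 r t) - of_real h)"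
proof
  define \<delta> where "\<delta> = (1 - h) / 4 * (r0 - 1)\<^sup>2 / \<rho>"
  show "\<delta> > 0" using h r0 \<rho> by (simp add: \<delta>_def)
  fix r t assume r: "r0 \<le> r" "r < \<rho>"
  define w where "w = circlepath 0 r t"
  have w: "cmod w = r" using r r0 by (simp add: w_def circlepath norm_mult)
  then have w0: "w \<noteq> 0" using r r0 by auto
  have *: "\<delta> \<le> (1 - h) / 4 * x\<^sup>2 / r" if "r - 1 \<le> x" for x
    unfolding \<delta>_def using h r r0 that by (intro frac_le mult_left_mono power_mono) auto
  have "r - 1 \<le> cmod (w - 1)" "r - 1 \<le> cmod (w + 1)"
    using norm_triangle_ineq2[of w 1] norm_triangle_ineq2[of w "-1"] w by auto
  note * = this[THEN *]
  have "\<bar>1 - h\<bar> = 1 - h" using h by auto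
  then show "\<delta> \<le> cmod (J (circlepath 0 r t) - 1)"
    "\<delta> \<le> cmod (J (circlepath 0 r t) - of_real h)"
    using * unfolding w_def[symmetric] J_minus_foci[OF w0] norm_mult norm_divide norm_power norm_of_real w
    by simp_all
qed

text \<open>Near \<open>t = 1/2\<close> the imaginary part alone grows linearly in
  \<open>\<bar>t - 1/2\<bar>\<close>; farther away the real part of \<open>J w + 1\<close> is at
  least 1. The argument does not depend on where -1 lies.\<close>

lemma J_circle_minus_one_bound:
  obtains \<delta> where "\<delta> > 0"
    "\<And>r t. r0 \<le> r \<Longrightarrow> r < \<rho> \<Longrightarrow> t \<in> {0..1} \<Longrightarrow> \<delta> * \<bar>t - 1/2\<bar> \<le> cmod (J (circlepath 0 r t) + 1)"
proof
  \<comment> \<open>The semiminor axis of the image of the circle of radius \<open>r0\<close>, the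
    smallest one that occurs.\<close>
  define \<kappa> where "\<kappa> = (1 - h) / 4 * (r0 - 1 / r0)"
  have "1 / r0 < r0" using r0 less_1_mult[of r0 r0] by (simp add: field_simps)
  then have \<kappa>: "\<kappa> > 0" using h by (simp add: \<kappa>_def)
  show "min 1 \<kappa> > 0" using \<kappa> by simp
  fix r t :: real assume r: "r0 \<le> r" "r < \<rho>" and t: "t \<in> {0..1}"
  define w where "w = circlepath 0 r t"
  have r1: "r > 1" using r r0 by linarith
  have w: "w = of_real r * cis (2 * pi * t)"
    by (simp add: w_def circlepath cis_conv_exp mult_ac)
  then have inv: "1 / w = of_real (1 / r) * cis (- (2 * pi * t))"
    by (simp add: divide_inverse cis_inverse)
  have Re: "Re (J w + 1) = (3 + h) / 2 + (1 - h) / 4 * (r + 1 / r) * cos (2 * pi * t)"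
    and Im: "Im (J w + 1) = (1 - h) / 4 * (r - 1 / r) * sin (2 * pi * t)"
  proof -
    define d where "d = (1 - h) / 4"
    have J: "J w + 1 = of_real ((1 + h) / 2 + 1) + of_real d * (w + of_real (1 / r) * cis (- (2 * pi * t)))"
      unfolding J_def inv d_def by simp
    have "(1 + h) / 2 + 1 = (3 + h) / 2" by simp
    note J = J[unfolded this]
    show "Re (J w + 1) = (3 + h) / 2 + (1 - h) / 4 * (r + 1 / r) * cos (2 * pi * t)"
      "Im (J w + 1) = (1 - h) / 4 * (r - 1 / r) * sin (2 * pi * t)"
      unfolding d_def[symmetric] J unfolding w by (simp_all add: algebra_simps)
  qed
  show "min 1 \<kappa> * \<bar>t - 1/2\<bar> \<le> cmod (J (circlepath 0 r t) + 1)"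
    unfolding w_def[symmetric]
  proof (cases "\<bar>t - 1/2\<bar> \<le> 1/4")
    case True
    define y where "y = 2 * pi * \<bar>t - 1/2\<bar>"
    have y: "0 \<le> y" "y \<le> pi / 2" using True by (auto simp: y_def field_simps)
    have "\<bar>sin (2 * pi * t)\<bar> = \<bar>sin (2 * pi * (t - 1/2))\<bar>"
      by (simp add: right_diff_distrib sin_diff)
    also have "\<dots> = \<bar>sin y\<bar>" by (auto simp: y_def abs_if simp flip: sin_minus) (simp_all add: algebra_simps)
    finally have "y / 2 \<le> \<bar>sin (2 * pi * t)\<bar>"
      using half_le_sin[OF y] by linarith
    moreover have "\<bar>t - 1/2\<bar> \<le> y / 2"
    proof -
      have "1 * \<bar>t - 1/2\<bar> \<le> pi * \<bar>t - 1/2\<bar>" by (intro mult_right_mono) (use pi_gt3 in auto)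
      then show ?thesis by (simp add: y_def)
    qed
    ultimately have s: "\<bar>t - 1/2\<bar> \<le> \<bar>sin (2 * pi * t)\<bar>" by (rule order_trans[rotated])
    have "1 / r \<le> 1 / r0" using r r0 by (intro divide_left_mono) auto
    then have "r0 - 1 / r0 \<le> r - 1 / r" using r by linarith
    then have "\<kappa> \<le> (1 - h) / 4 * (r - 1 / r)" unfolding \<kappa>_def using h by (intro mult_left_mono) auto
    then have "\<kappa> * \<bar>t - 1/2\<bar> \<le> \<bar>(1 - h) / 4 * (r - 1 / r)\<bar> * \<bar>sin (2 * pi * t)\<bar>"
      using s \<kappa> by (intro mult_mono) auto
    then have "\<kappa> * \<bar>t - 1/2\<bar> \<le> \<bar>Im (J w + 1)\<bar>" unfolding Im abs_mult by simp
    moreover have "min 1 \<kappa> * \<bar>t - 1/2\<bar> \<le> \<kappa> * \<bar>t - 1/2\<bar>" by (intro mult_right_mono) auto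
    ultimately show "min 1 \<kappa> * \<bar>t - 1/2\<bar> \<le> cmod (J w + 1)"
      using abs_Im_le_cmod[of "J w + 1"] by linarith
  next
    case False
    \<comment> \<open>On the right half of the circle the cosine is nonnegative, so the real part of
      \<open>J w + 1\<close> is at least \<open>(3 + h) / 2\<close>, which exceeds 1.\<close>
    have cos_nonneg: "0 \<le> cos (2 * pi * x)" if "0 \<le> x" "x \<le> 1/4" for x
    proof -
      have "0 \<le> 2 * pi * x" "2 * pi * x \<le> 2 * pi * (1/4)"
        using that by (auto intro!: mult_left_mono)
      then show ?thesis using pi_gt_zero by (intro cos_ge_zero) linarith+
    qed
    have "0 \<le> cos (2 * pi * t)"
    proof (cases "t < 1/2")
      case True
      then show ?thesis using False t by (intro cos_nonneg) auto
    next
      case ge: False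
      have "0 \<le> cos (2 * pi * (1 - t))"
        using False ge t by (intro cos_nonneg) auto
      then show ?thesis by (simp add: right_diff_distrib cos_diff)
    qed
    then have "0 \<le> (1 - h) / 4 * (r + 1 / r) * cos (2 * pi * t)"
      using h r1 by (intro mult_nonneg_nonneg) auto
    then have "1 \<le> Re (J w + 1)"
      unfolding Re using h by (intro add_increasing2) auto
    moreover have "min 1 \<kappa> * \<bar>t - 1/2\<bar> \<le> 1 * 1"
      using t \<kappa> by (intro mult_mono) (auto simp: abs_if)
    ultimately show "min 1 \<kappa> * \<bar>t - 1/2\<bar> \<le> cmod (J w + 1)"
      using complex_Re_le_cmod[of "J w + 1"] by linarith
  qed
qed

lemma circle_bounded_if_bounded:
  assumes "\<And>z. z \<in> E \<Longrightarrow> cmod (G z) \<le> M"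
  shows "circle_bounded G"
  unfolding circle_bounded_def
proof (intro exI allI impI)
  fix r t :: real assume r: "r0 \<le> r" "r < \<rho>" and t: "t \<in> {0..1}" "t \<noteq> 1/2"
  have le: "cmod (G (J (circlepath 0 r t))) \<le> M"
    by (intro assms J_circle_in_E r)
  then have "0 \<le> M" by (rule order_trans[OF norm_ge_zero])
  have "sqrt \<bar>t - 1/2\<bar> \<le> 1" "sqrt \<bar>t - 1/2\<bar> > 0"
    using t by (auto simp: abs_if)
  then have "M / 1 \<le> M / sqrt \<bar>t - 1/2\<bar>"
    using \<open>0 \<le> M\<close> by (intro divide_left_mono) auto
  with le show "cmod (G (J (circlepath 0 r t))) \<le> M / sqrt \<bar>t - 1/2\<bar>" by simp
qed

text \<open>If \<open>-1\<close> lies on the boundary of the ellipse, the function \<open>G\<close> need not be bounded, but its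
  square root singularity at \<open>-1\<close> is still integrable.\<close>

lemma circle_bounded_if_sqrt_singularity:
  assumes M: "\<And>z. z \<in> E \<Longrightarrow> cmod (G z) * sqrt (cmod (1 - z\<^sup>2)) \<le> M"
  shows "circle_bounded G"
proof -
  obtain \<delta>1 where \<delta>1: "\<delta>1 > 0" "\<And>r t. r0 \<le> r \<Longrightarrow> r < \<rho> \<Longrightarrow> \<delta>1 \<le> cmod (J (circlepath 0 r t) - 1)"
    using J_circle_foci_bound by metis
  obtain \<delta>2 where \<delta>2: "\<delta>2 > 0"
    "\<And>r t. r0 \<le> r \<Longrightarrow> r < \<rho> \<Longrightarrow> t \<in> {0..1} \<Longrightarrow> \<delta>2 * \<bar>t - 1/2\<bar> \<le> cmod (J (circlepath 0 r t) + 1)"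
    using J_circle_minus_one_bound by metis
  show ?thesis
    unfolding circle_bounded_def
  proof (intro exI allI impI)
    fix r t :: real assume r: "r0 \<le> r" "r < \<rho>" and t: "t \<in> {0..1}" "t \<noteq> 1/2"
    define z where "z = J (circlepath 0 r t)"
    have "z \<in> E" unfolding z_def by (intro J_circle_in_E r)
    have "1 - z\<^sup>2 = - ((z - 1) * (z + 1))" by (simp add: power2_eq_square algebra_simps)
    then have "cmod (1 - z\<^sup>2) = cmod (z - 1) * cmod (z + 1)" by (simp add: norm_mult)
    moreover have "\<delta>1 * (\<delta>2 * \<bar>t - 1/2\<bar>) \<le> cmod (z - 1) * cmod (z + 1)"
      unfolding z_def using \<delta>1 \<delta>2 r t by (intro mult_mono) auto
    ultimately have "sqrt (\<delta>1 * \<delta>2) * sqrt \<bar>t - 1/2\<bar> \<le> sqrt (cmod (1 - z\<^sup>2))"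
      by (simp add: mult.assoc flip: real_sqrt_mult)
    then have "cmod (G z) * (sqrt (\<delta>1 * \<delta>2) * sqrt \<bar>t - 1/2\<bar>) \<le> M"
      using M[OF \<open>z \<in> E\<close>] mult_left_mono[OF _ norm_ge_zero[of "G z"]] by fastforce
    moreover have "sqrt (\<delta>1 * \<delta>2) > 0" "sqrt \<bar>t - 1/2\<bar> > 0" using \<delta>1(1) \<delta>2(1) t by auto
    ultimately show "cmod (G (J (circlepath 0 r t))) \<le> (M / sqrt (\<delta>1 * \<delta>2)) / sqrt \<bar>t - 1/2\<bar>"
      unfolding z_def[symmetric] by (simp add: pos_le_divide_eq mult_ac)
  qed
qed

text \<open>The curves keep a fixed distance from the focus \<open>h\<close>, so division by
  \<open>z - h\<close> only changes the constant; the constant \<open>k\<close> is absorbed because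
  the majorant's denominator is at most 1.\<close>

lemma circle_bounded_quotient:
  assumes "circle_bounded G" and Q: "\<And>z. z \<in> E \<Longrightarrow> G z - k = (z - of_real h) * Q z"
  shows "circle_bounded (\<lambda>z. l * Q z)"
proof -
  obtain C where C: "\<And>r t. r0 \<le> r \<Longrightarrow> r < \<rho> \<Longrightarrow> t \<in> {0..1} \<Longrightarrow> t \<noteq> 1/2 \<Longrightarrow>
     cmod (G (J (circlepath 0 r t))) \<le> C / sqrt \<bar>t - 1/2\<bar>"
    using assms(1) unfolding circle_bounded_def by blast
  obtain \<delta> where \<delta>: "\<delta> > 0" "\<And>r t. r0 \<le> r \<Longrightarrow> r < \<rho> \<Longrightarrow> \<delta> \<le> cmod (J (circlepath 0 r t) - of_real h)"
    using J_circle_foci_bound by metis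
  show ?thesis
    unfolding circle_bounded_def
  proof (intro exI allI impI)
    fix r t :: real assume r: "r0 \<le> r" "r < \<rho>" and t: "t \<in> {0..1}" "t \<noteq> 1/2"
    define z where "z = J (circlepath 0 r t)"
    have "z \<in> E" unfolding z_def by (intro J_circle_in_E r)
    let ?q = "sqrt \<bar>t - 1/2\<bar>"
    have q: "?q > 0" "?q \<le> 1" using t by (auto simp: abs_if)
    have "cmod k / 1 \<le> cmod k / ?q" using q by (intro divide_left_mono) auto
    have "\<delta> * cmod (Q z) \<le> cmod (z - of_real h) * cmod (Q z)"
      unfolding z_def using \<delta> r by (intro mult_right_mono) auto
    also have "\<dots> = cmod (G z - k)" using Q[OF \<open>z \<in> E\<close>] by (simp add: norm_mult)
    also have "\<dots> \<le> cmod (G z) + cmod k" by (rule norm_triangle_ineq4)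
    also have "\<dots> \<le> C / ?q + cmod k / ?q"
      using C[OF r t] \<open>cmod k / 1 \<le> cmod k / ?q\<close> by (simp add: z_def)
    finally have "\<delta> * cmod (Q z) \<le> (C + cmod k) / ?q" by (simp add: add_divide_distrib)
    then have "cmod (Q z) \<le> (C + cmod k) / ?q / \<delta>" using \<delta>(1)
      by (subst pos_le_divide_eq) (simp_all add: mult.commute)
    then have "cmod l * cmod (Q z) \<le> cmod l * ((C + cmod k) / ?q / \<delta>)" by (intro mult_left_mono) auto
    then show "cmod (l * Q (J (circlepath 0 r t))) \<le> (cmod l * (C + cmod k) / \<delta>) / ?q"
      unfolding z_def[symmetric] by (simp add: norm_mult mult_ac)
  qed
qed

text \<open>With \<open>x = 1 + (h - 1) * s\<close> one has
  \<open>x - h = (1 - h) * (1 - s)\<close>, so \<open>arc_quotient\<close> is \<open>1 - h\<close>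
  times the holomorphic difference quotient at \<open>h\<close>.\<close>

lemma geom_approx_quotient:
  assumes G: "G holomorphic_on E" "circle_bounded G"
    and u: "\<And>x. h \<le> x \<Longrightarrow> x < 1 \<Longrightarrow> complex_of_real (u x) = G (of_real x)"
  shows "geom_approx \<rho> (arc_quotient h u)"
proof -
  have "(\<lambda>z. G z - G (of_real h)) holomorphic_on E"
    by (intro holomorphic_intros G)
  then obtain Q where Q: "Q holomorphic_on E"
      "\<And>z. z \<in> E \<Longrightarrow> G z - G (of_real h) = (z - of_real h) * Q z"
    using holomorphic_divide_linear[OF open_E, of "\<lambda>z. G z - G (of_real h)" "of_real h"] by auto
  show ?thesis
  proof (rule geom_approx_of_circle_bounded)
    show "(\<lambda>z. of_real (1 - h) * Q z) holomorphic_on E" by (intro holomorphic_intros Q)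
    show "circle_bounded (\<lambda>z. of_real (1 - h) * Q z)"
      by (rule circle_bounded_quotient[OF G(2) Q(2)])
    fix s :: real assume s: "s \<in> {0<..<1}"
    define x where "x = 1 + (h - 1) * s"
    have "0 < (1 - h) * s" "0 < (1 - h) * (1 - s)" using s h by auto
    then have x: "h < x" "x < 1" by (auto simp: x_def algebra_simps)
    have "complex_of_real (u x) - u h = (x - of_real h) * Q x"
      using Q(2)[OF segment_in_E[of x]] x h u by simp
    moreover have "complex_of_real x - of_real h = of_real (1 - h) * of_real (1 - s)"
      by (simp add: x_def algebra_simps)
    ultimately have "complex_of_real (u x) - u h = of_real (1 - s) * (of_real (1 - h) * Q x)"
      by (simp add: mult_ac)
    then show "complex_of_real (arc_quotient h u s) = of_real (1 - h) * Q (of_real (1 + (h - 1) * s))"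
      using s unfolding arc_quotient_def x_def[symmetric] by (simp add: nonzero_divide_eq_eq mult_ac)
  qed
qed

end

section \<open>The parts of \<open>F\<close> as functions of the cosine\<close>

locale arc_continuation = arc_ellipse +
  fixes f :: "real \<Rightarrow> real \<Rightarrow> real" and F :: "complex \<Rightarrow> complex"
  assumes continuation: "\<And>\<theta>. \<theta> \<in> {- arccos h..arccos h} \<Longrightarrow>
          F (complex_of_real \<theta>) = complex_of_real (f (cos \<theta>) (sin \<theta>))"
    and holomorphic: "F holomorphic_on {\<theta>. cos \<theta> \<in> E}"
    and periodic: "\<And>\<theta>. cos \<theta> \<in> E \<Longrightarrow> F (\<theta> + 2 * complex_of_real pi) = F \<theta>"
    and bounded: "bounded (F ` {\<theta>. cos \<theta> \<in> E})"
begin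

lemma cos_shift: "n \<in> \<int> \<Longrightarrow> cos (\<theta> + complex_of_real (2 * n * pi)) = cos \<theta>"
  by (subst complex_cos_eq) auto

lemma sin_shift: "n \<in> \<int> \<Longrightarrow> sin (\<theta> + complex_of_real (2 * n * pi)) = sin \<theta>"
  by (subst complex_sin_eq) auto

lemma periodic_nat: "cos \<theta> \<in> E \<Longrightarrow> F (\<theta> + complex_of_real (2 * real n * pi)) = F \<theta>"
proof (induction n)
  case (Suc n)
  have "F (\<theta> + complex_of_real (2 * real n * pi) + 2 * complex_of_real pi) =
      F (\<theta> + complex_of_real (2 * real n * pi))"
    using Suc.prems by (intro periodic) (simp only: cos_shift Ints_of_nat)
  then show ?case using Suc by (simp add: algebra_simps)
qed simp

lemma periodic_int:
  assumes "cos \<theta> \<in> E" "n \<in> \<int>"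
  shows "F (\<theta> + complex_of_real (2 * n * pi)) = F \<theta>"
proof -
  obtain m where n: "n = of_int m" using assms(2) by (auto elim: Ints_cases)
  show ?thesis
  proof (cases "m \<ge> 0")
    case True
    then have "n = real (nat m)" by (simp add: n)
    then show ?thesis using periodic_nat[OF assms(1)] by simp
  next
    case False
    \<comment> \<open>For a negative multiple the natural-number case is applied at the shifted
      point, leading back to \<open>\<theta>\<close>.\<close>
    define \<theta>' where "\<theta>' = \<theta> + complex_of_real (2 * n * pi)"
    have "cos \<theta>' \<in> E" using assms by (simp only: \<theta>'_def cos_shift)
    from periodic_nat[OF this, of "nat (- m)"] have "F (\<theta>' + complex_of_real (2 * (- n) * pi)) = F \<theta>'"
      using False by (simp add: n)
    then show ?thesis by (simp add: \<theta>'_def)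
  qed
qed

text \<open>Angles with equal cosine agree up to sign and a multiple of the period. Hence
  \<open>F \<theta> + F (- \<theta>)\<close> and
  \<open>sin \<theta> * (F \<theta> - F (- \<theta>))\<close> depend on \<open>cos \<theta>\<close>
  only.\<close>

lemma cos_eq_cases:
  assumes "cos \<theta> \<in> E" "cos \<theta> = cos \<theta>'"
  obtains "sin \<theta>' = sin \<theta>" "F \<theta>' = F \<theta>" "F (- \<theta>') = F (- \<theta>)"
    | "sin \<theta>' = - sin \<theta>" "F \<theta>' = F (- \<theta>)" "F (- \<theta>') = F \<theta>"
proof -
  obtain n where n: "n \<in> \<int>"
    and "\<theta>' = \<theta> + of_real (2 * n * pi) \<or> \<theta>' = - \<theta> + of_real (2 * n * pi)"
    using assms(2)[symmetric] unfolding complex_cos_eq by blast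
  then consider "\<theta>' = \<theta> + of_real (2 * n * pi)" | "\<theta>' = - \<theta> + of_real (2 * n * pi)" by blast
  then show thesis
  proof cases
    case 1
    then have "- \<theta>' = - \<theta> + of_real (2 * (- n) * pi)" by simp
    with 1 show ?thesis
      using that(1) n assms(1) sin_shift[OF n] periodic_int[OF _ n] periodic_int[of "- \<theta>" "- n"]
      by (metis Ints_minus cos_minus)
  next
    case 2
    then have "- \<theta>' = \<theta> + of_real (2 * (- n) * pi)" by simp
    with 2 show ?thesis
      using that(2) n assms(1) sin_shift[OF n] periodic_int[of "- \<theta>" n] periodic_int[of "\<theta>" "- n"]
      by (metis Ints_minus cos_minus sin_minus)
  qed
qed

lemma holomorphic_neg: "(\<lambda>\<theta>. F (- \<theta>)) holomorphic_on {\<theta>. cos \<theta> \<in> E}"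
proof -
  have "(F \<circ> uminus) holomorphic_on {\<theta>. cos \<theta> \<in> E}"
    by (rule holomorphic_on_compose_gen[OF _ holomorphic]) (auto intro!: holomorphic_intros)
  then show ?thesis by (simp add: o_def)
qed

lemma bound_on_region:
  obtains M where "\<And>\<theta>. cos \<theta> \<in> E \<Longrightarrow> cmod ((F \<theta> + F (- \<theta>)) / 2) \<le> M"
    "\<And>\<theta>. cos \<theta> \<in> E \<Longrightarrow> cmod ((F \<theta> - F (- \<theta>)) / 2) \<le> M"
proof -
  obtain M where M: "\<And>\<theta>. cos \<theta> \<in> E \<Longrightarrow> cmod (F \<theta>) \<le> M"
    using bounded by (auto simp: bounded_iff)
  show ?thesis
  proof (rule that[of M])
    fix \<theta> :: complex assume "cos \<theta> \<in> E"
    then have "cmod (F \<theta>) \<le> M" "cmod (F (- \<theta>)) \<le> M"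
      using M[of \<theta>] M[of "- \<theta>"] by auto
    then show "cmod ((F \<theta> + F (- \<theta>)) / 2) \<le> M" "cmod ((F \<theta> - F (- \<theta>)) / 2) \<le> M"
      using norm_triangle_ineq[of "F \<theta>" "F (- \<theta>)"] norm_triangle_ineq4[of "F \<theta>" "F (- \<theta>)"]
      by (simp_all add: norm_divide)
  qed
qed

lemma even_part:
  obtains G where "G holomorphic_on E" "circle_bounded G"
    "\<And>\<theta>. cos \<theta> \<in> E \<Longrightarrow> G (cos \<theta>) = (F \<theta> + F (- \<theta>)) / 2"
proof -
  define K where "K \<theta> = (F \<theta> + F (- \<theta>)) / 2" for \<theta>
  have "K holomorphic_on {\<theta>. cos \<theta> \<in> E}"
    unfolding K_def by (intro holomorphic_intros holomorphic holomorphic_neg) auto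
  moreover have "K \<theta> = K \<theta>'" if "cos \<theta> \<in> E" "cos \<theta> = cos \<theta>'" for \<theta> \<theta>'
    using that by (rule cos_eq_cases) (simp_all add: K_def)
  ultimately obtain G where G: "G holomorphic_on E" "\<And>\<theta>. cos \<theta> \<in> E \<Longrightarrow> G (cos \<theta>) = K \<theta>"
    using holomorphic_factor_through_cos[OF open_E, of K] by blast
  obtain M where M: "\<And>\<theta>. cos \<theta> \<in> E \<Longrightarrow> cmod (K \<theta>) \<le> M"
    using bound_on_region unfolding K_def by metis
  have "cmod (G z) \<le> M" if "z \<in> E" for z
    using M[of "Arccos z"] G(2)[of "Arccos z"] that by simp
  then have "circle_bounded G" by (rule circle_bounded_if_bounded)
  then show ?thesis using that G by (simp add: K_def)
qed

text \<open>Multiplying by \<open>sin \<theta>\<close> instead of dividing avoids poles and still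
  gives a function \<open>k\<close> of \<open>cos \<theta>\<close>. It should be
  \<open>(1 - z\<^sup>2) * G z\<close>, and its zeros at 1 and -1, where these lie in
  \<open>E\<close>, allow the two linear factors to be divided out.\<close>

lemma odd_part:
  obtains G where "G holomorphic_on E" "circle_bounded G"
    "\<And>\<theta>. cos \<theta> \<in> E \<Longrightarrow> sin \<theta> \<noteq> 0 \<Longrightarrow> G (cos \<theta>) = (F \<theta> - F (- \<theta>)) / 2 / sin \<theta>"
proof -
  define K where "K \<theta> = sin \<theta> * ((F \<theta> - F (- \<theta>)) / 2)" for \<theta>
  have "K holomorphic_on {\<theta>. cos \<theta> \<in> E}"
    unfolding K_def by (intro holomorphic_intros holomorphic holomorphic_neg) auto
  moreover have "K \<theta> = K \<theta>'" if "cos \<theta> \<in> E" "cos \<theta> = cos \<theta>'" for \<theta> \<theta>'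
    using that by (rule cos_eq_cases) (simp_all add: K_def field_simps)
  ultimately obtain k where k: "k holomorphic_on E" "\<And>\<theta>. cos \<theta> \<in> E \<Longrightarrow> k (cos \<theta>) = K \<theta>"
    using holomorphic_factor_through_cos[OF open_E, of K] by blast
  have "k 1 = 0" if "1 \<in> E"
    using k(2)[of 0] that by (simp add: K_def)
  then obtain k1 where k1: "k1 holomorphic_on E" "\<And>z. z \<in> E \<Longrightarrow> k z = (z - 1) * k1 z"
    using holomorphic_divide_linear[OF open_E k(1)] by blast
  have "k1 (-1) = 0" if "-1 \<in> E"
  proof -
    have "cos (complex_of_real pi) = -1" "sin (complex_of_real pi) = 0"
      by (simp_all add: cos_of_real sin_of_real)
    then have "k (-1) = 0" using k(2)[of "of_real pi"] that by (simp add: K_def)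
    then show ?thesis using k1(2)[OF that] by simp
  qed
  then obtain k2 where k2: "k2 holomorphic_on E" "\<And>z. z \<in> E \<Longrightarrow> k1 z = (z - (-1)) * k2 z"
    using holomorphic_divide_linear[OF open_E k1(1)] by blast
  define G where "G z = - k2 z" for z
  have G: "G holomorphic_on E" unfolding G_def by (intro holomorphic_intros k2)
  have kG: "k z = (1 - z\<^sup>2) * G z" if "z \<in> E" for z
    using k1(2)[OF that] k2(2)[OF that] by (simp add: G_def power2_eq_square algebra_simps)
  have Gcos: "G (cos \<theta>) = (F \<theta> - F (- \<theta>)) / 2 / sin \<theta>" if "cos \<theta> \<in> E" "sin \<theta> \<noteq> 0" for \<theta>
  proof -
    have "sin \<theta> * (sin \<theta> * G (cos \<theta>)) = sin \<theta> * ((F \<theta> - F (- \<theta>)) / 2)"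
      using kG[OF that(1)] k(2)[OF that(1)] sin_squared_eq[of \<theta>]
      by (simp add: K_def power2_eq_square mult.assoc)
    then have *: "sin \<theta> * G (cos \<theta>) = (F \<theta> - F (- \<theta>)) / 2"
      by (simp only: mult_left_cancel[OF that(2)])
    have "G (cos \<theta>) = sin \<theta> * G (cos \<theta>) / sin \<theta>" using that(2) by simp
    then show ?thesis unfolding * .
  qed
  obtain M where M: "\<And>\<theta>. cos \<theta> \<in> E \<Longrightarrow> cmod ((F \<theta> - F (- \<theta>)) / 2) \<le> M"
    using bound_on_region by metis
  \<comment> \<open>The square root is \<open>cmod (sin \<theta>)\<close>, so the product is the
    modulus of the odd part of \<open>F\<close>, bounded even where \<open>G\<close> is not.\<close>
  have "cmod (G z) * sqrt (cmod (1 - z\<^sup>2)) \<le> M" if "z \<in> E" for z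
  proof -
    define \<theta> where "\<theta> = Arccos z"
    have z: "cos \<theta> = z" by (simp add: \<theta>_def)
    have "1 - z\<^sup>2 = (sin \<theta>)\<^sup>2" using sin_squared_eq[of \<theta>] z by simp
    then have s: "sqrt (cmod (1 - z\<^sup>2)) = cmod (sin \<theta>)" by (simp add: norm_power)
    show ?thesis
    proof (cases "sin \<theta> = 0")
      case True
      then show ?thesis unfolding s using order_trans[OF norm_ge_zero M[of \<theta>]] that z by simp
    next
      case False
      then have "cmod (G z) * cmod (sin \<theta>) = cmod ((F \<theta> - F (- \<theta>)) / 2)"
        using Gcos[of \<theta>] that z by (simp add: norm_divide)
      then show ?thesis unfolding s using M[of \<theta>] that z by simp
    qed
  qed
  then have "circle_bounded G" by (rule circle_bounded_if_sqrt_singularity)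
  then show ?thesis using that G Gcos by blast
qed

lemma real_parameter:
  assumes "h \<le> x" "x \<le> 1"
  obtains \<theta> where "0 \<le> \<theta>" "\<theta> \<in> {- arccos h..arccos h}" "- \<theta> \<in> {- arccos h..arccos h}"
    "cos \<theta> = x" "sin \<theta> = sqrt (1 - x\<^sup>2)"
    "F (of_real \<theta>) = f x (sqrt (1 - x\<^sup>2))" "F (- of_real \<theta>) = f x (- sqrt (1 - x\<^sup>2))"
proof -
  define \<theta> where "\<theta> = arccos x"
  have x: "-1 \<le> x" "x \<le> 1" using assms h by auto
  have 1: "0 \<le> \<theta>" "\<theta> \<le> arccos h"
    unfolding \<theta>_def using assms h x by (auto intro!: arccos_lbound arccos_le_arccos)
  then have 2: "\<theta> \<in> {- arccos h..arccos h}" "- \<theta> \<in> {- arccos h..arccos h}" by auto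
  have 3: "cos \<theta> = x" "sin \<theta> = sqrt (1 - x\<^sup>2)" using x by (simp_all add: \<theta>_def cos_arccos sin_arccos)
  have 4: "F (of_real \<theta>) = f x (sqrt (1 - x\<^sup>2))" "F (- of_real \<theta>) = f x (- sqrt (1 - x\<^sup>2))"
    using continuation[OF 2(1)] continuation[OF 2(2)] 3 by simp_all
  show ?thesis by (rule that[OF 1(1) 2 3 4])
qed

lemma geom_approx_even:
  "geom_approx \<rho> (\<lambda>s. arc_even f (1 + (h - 1) * s))" "geom_approx \<rho> (arc_quotient h (arc_even f))"
  and geom_approx_odd:
  "geom_approx \<rho> (\<lambda>s. arc_odd f (1 + (h - 1) * s))" "geom_approx \<rho> (arc_quotient h (arc_odd f))"
proof -
  have seg: "h \<le> 1 + (h - 1) * s \<and> 1 + (h - 1) * s < 1" if "s \<in> {0<..<1}" for s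
  proof -
    have "0 < (1 - h) * s" "0 < (1 - h) * (1 - s)" using that h by auto
    then show ?thesis by (auto simp: algebra_simps)
  qed
  obtain G1 where G1: "G1 holomorphic_on E" "circle_bounded G1"
    "\<And>\<theta>. cos \<theta> \<in> E \<Longrightarrow> G1 (cos \<theta>) = (F \<theta> + F (- \<theta>)) / 2"
    using even_part by blast
  have e: "complex_of_real (arc_even f x) = G1 (of_real x)" if "h \<le> x" "x < 1" for x
  proof -
    have x: "h \<le> x" "x \<le> 1" using that by auto
    show ?thesis
      using real_parameter[OF x]
    proof cases
      case (1 \<theta>)
      have "cos (complex_of_real \<theta>) = of_real x" using 1(4) by (simp add: cos_of_real)
      then show ?thesis
        using G1(3)[of "of_real \<theta>"] segment_in_E[OF x] 1 by (simp add: arc_even_def)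
    qed
  qed
  show "geom_approx \<rho> (\<lambda>s. arc_even f (1 + (h - 1) * s))"
    using seg by (intro geom_approx_of_circle_bounded[OF G1(1,2)] e) auto
  show "geom_approx \<rho> (arc_quotient h (arc_even f))"
    by (rule geom_approx_quotient[OF G1(1,2) e])
  obtain G2 where G2: "G2 holomorphic_on E" "circle_bounded G2"
    "\<And>\<theta>. cos \<theta> \<in> E \<Longrightarrow> sin \<theta> \<noteq> 0 \<Longrightarrow> G2 (cos \<theta>) = (F \<theta> - F (- \<theta>)) / 2 / sin \<theta>"
    using odd_part by blast
  \<comment> \<open>\<open>x = h\<close> is included because \<open>arc_quotient\<close> subtracts
    the value there; \<open>x = 1\<close> is not, since \<open>arc_odd\<close> is then a division by
    zero.\<close>
  have o: "complex_of_real (arc_odd f x) = G2 (of_real x)" if "h \<le> x" "x < 1" for x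
  proof -
    have x: "h \<le> x" "x \<le> 1" using that by auto
    have "x\<^sup>2 < 1" using that h by (simp add: abs_square_less_1)
    then have s: "sqrt (1 - x\<^sup>2) \<noteq> 0" by simp
    show ?thesis
      using real_parameter[OF x]
    proof cases
      case (1 \<theta>)
      have c: "cos (complex_of_real \<theta>) = of_real x" using 1(4) by (simp add: cos_of_real)
      have s': "sin (complex_of_real \<theta>) = of_real (sqrt (1 - x\<^sup>2))" using 1(5) by (simp add: sin_of_real)
      then have "sin (complex_of_real \<theta>) \<noteq> 0" using s by simp
      then show ?thesis
        using G2(3)[of "of_real \<theta>"] segment_in_E[OF x] 1 c s' by (simp add: arc_odd_def)
    qed
  qed
  show "geom_approx \<rho> (\<lambda>s. arc_odd f (1 + (h - 1) * s))"
    using seg by (intro geom_approx_of_circle_bounded[OF G2(1,2)] o) auto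
  show "geom_approx \<rho> (arc_quotient h (arc_odd f))"
    by (rule geom_approx_quotient[OF G2(1,2) o])
qed

end

section \<open>The arc inner product in the variable \<open>\<sigma>\<close>\<close>

locale arc_parameter =
  fixes h :: real
  assumes abs_h: "\<bar>h\<bar> < 1"
begin

abbreviation "x_of s \<equiv> 1 + (h - 1) * s"
abbreviation "\<tau> \<equiv> arc_tau h"

definition upper :: "(real \<Rightarrow> real \<Rightarrow> real) \<Rightarrow> real \<Rightarrow> real" where
  "upper f s = f (x_of s) (sqrt (1 - (x_of s)\<^sup>2))"

definition lower :: "(real \<Rightarrow> real \<Rightarrow> real) \<Rightarrow> real \<Rightarrow> real" where
  "lower f s = f (x_of s) (- sqrt (1 - (x_of s)\<^sup>2))"

lemma tau_gt_1: "\<tau> > 1"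
  using abs_h by (simp add: arc_tau_def)

lemma arccos_h: "0 < arccos h" "arccos h < pi" "cos (arccos h) = h"
  using arccos_lt_bounded[of h] abs_h by auto

text \<open>The origin of \<open>\<tau>\<close>: in the variable \<open>s\<close> the factors of
  \<open>1 - x\<^sup>2\<close> are multiples of \<open>s\<close> and
  \<open>\<tau> - s\<close>.\<close>

lemma one_minus_square: "1 - (x_of s)\<^sup>2 = (1 - h)\<^sup>2 * (s * (\<tau> - s))"
proof -
  have "1 - h \<noteq> 0" using abs_h by auto
  then have "(1 - h) * \<tau> = 2" by (simp add: arc_tau_def del: left_diff_distrib_numeral)
  moreover have "(1 - h)\<^sup>2 * (s * (\<tau> - s)) = (1 - h) * s * ((1 - h) * \<tau> - (1 - h) * s)"
    by (simp add: power2_eq_square algebra_simps)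
  ultimately have "(1 - h)\<^sup>2 * (s * (\<tau> - s)) = (1 - h) * s * (2 - (1 - h) * s)"
    by (simp only:)
  also have "\<dots> = 1 - (x_of s)\<^sup>2" by (simp add: power2_eq_square algebra_simps)
  finally show ?thesis by simp
qed

lemma one_minus_square_pos: "s \<in> {0<..<1} \<Longrightarrow> 1 - (x_of s)\<^sup>2 > 0"
  unfolding one_minus_square using abs_h tau_gt_1 by auto

text \<open>For \<open>s = (1 - cos \<theta>) / (1 - h)\<close>, \<open>d\<theta>\<close> becomes
  \<open>ds\<close> divided by the square root of \<open>s * (\<tau> - s)\<close>, and
  \<open>(cos \<theta> - h) powr b\<close> becomes \<open>(1 - h) powr b * (1 - s) powr b\<close>.
  This produces the exponents \<open>-1/2\<close>.\<close>

lemma half_substitution: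
  assumes int: "set_integrable lborel {0..1} (\<lambda>s. g s * sj_weight \<tau> (-1/2) b (-1/2) s)"
  shows "set_integrable lborel {0<..<arccos h} (\<lambda>\<theta>. g ((1 - cos \<theta>) / (1 - h)) * (cos \<theta> - h) powr b)"
    and "(LINT \<theta>:{0<..<arccos h}|lborel. g ((1 - cos \<theta>) / (1 - h)) * (cos \<theta> - h) powr b) =
       (1 - h) powr b * (LINT s:{0..1}|lborel. g s * sj_weight \<tau> (-1/2) b (-1/2) s)"
proof -
  let ?S = "{0<..<arccos h}" and ?w = "sj_weight \<tau> (-1/2) b (-1/2)"
  define \<sigma> where "\<sigma> \<theta> = (1 - cos \<theta>) / (1 - h)" for \<theta>
  define k where "k s = (1 - h) powr b * (g s * ?w s)" for s
  define K where "K \<theta> = g (\<sigma> \<theta>) * (cos \<theta> - h) powr b" for \<theta>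
  have h1: "1 - h > 0" using abs_h by auto
  have cos_S: "h < cos \<theta>" "cos \<theta> < 1" "sin \<theta> > 0" if "\<theta> \<in> ?S" for \<theta>
  proof -
    show "h < cos \<theta>" using that arccos_h cos_monotone_0_pi[of \<theta> "arccos h"] by auto
    show "cos \<theta> < 1" using that arccos_h cos_monotone_0_pi[of 0 \<theta>] by auto
    show "sin \<theta> > 0" using that arccos_h by (intro sin_gt_zero) auto
  qed
  have deriv: "(\<sigma> has_field_derivative sin \<theta> / (1 - h)) (at \<theta> within ?S)" for \<theta>
    unfolding \<sigma>_def by (rule DERIV_cdivide) (auto intro!: derivative_eq_intros)
  have inj: "inj_on \<sigma> ?S"
  proof (rule inj_onI)
    fix x y assume xy: "x \<in> ?S" "y \<in> ?S" "\<sigma> x = \<sigma> y"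
    then have c: "cos x = cos y" using h1 by (simp add: \<sigma>_def)
    have "0 \<le> x" "x \<le> pi" "0 \<le> y" "y \<le> pi" using xy(1,2) arccos_h(2) by simp_all
    from cos_inj_pi[OF this c] show "x = y" .
  qed
  have img: "\<sigma> ` ?S = {0<..<1}"
  proof (intro equalityI subsetI)
    fix s assume s: "s \<in> {0<..<1::real}"
    have "0 < (1 - h) * s" "0 < (1 - h) * (1 - s)" using s h1 by auto
    then have x: "h < x_of s" "x_of s < 1" by (auto simp: algebra_simps)
    have x1: "-1 < x_of s" "x_of s \<le> 1" "-1 \<le> x_of s" using x abs_h by linarith+
    have "0 < arccos (x_of s)" using arccos_lt_bounded[OF x1(1) x(2)] by blast
    moreover have "arccos (x_of s) < arccos h"
      by (rule arccos_less_arccos[OF _ x(1) x1(2)]) (use abs_h in linarith)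
    moreover have "\<sigma> (arccos (x_of s)) = s"
      unfolding \<sigma>_def cos_arccos[OF x1(3,2)] using h1 by (simp add: field_simps)
    ultimately show "s \<in> \<sigma> ` ?S" by (intro image_eqI[of s \<sigma> "arccos (x_of s)"]) auto
  next
    fix s assume "s \<in> \<sigma> ` ?S"
    then obtain \<theta> where "\<theta> \<in> ?S" "s = \<sigma> \<theta>" by blast
    then show "s \<in> {0<..<1}" using cos_S(1,2)[of \<theta>] h1 by (simp add: \<sigma>_def)
  qed
  have Kk: "\<bar>sin \<theta> / (1 - h)\<bar> * k (\<sigma> \<theta>) = K \<theta>" if \<theta>: "\<theta> \<in> ?S" for \<theta>
  proof -
    note c = cos_S[OF \<theta>]
    have \<sigma>: "0 < \<sigma> \<theta>" "\<sigma> \<theta> < 1" using img \<theta> by auto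
    have "x_of (\<sigma> \<theta>) = cos \<theta>" using h1 by (simp add: \<sigma>_def field_simps)
    then have "(1 - h)\<^sup>2 * (\<sigma> \<theta> * (\<tau> - \<sigma> \<theta>)) = (sin \<theta>)\<^sup>2"
      using one_minus_square[of "\<sigma> \<theta>"] sin_squared_eq[of \<theta>] by simp
    then have "\<sigma> \<theta> * (\<tau> - \<sigma> \<theta>) = (sin \<theta> / (1 - h))\<^sup>2"
      using h1 by (simp add: power_divide field_simps)
    moreover have "(q\<^sup>2) powr (-1/2) = 1 / q" if "q > 0" for q :: real
    proof -
      have "(q\<^sup>2) powr (-1/2) = (q powr 2) powr (-1/2)" using that by (simp add: powr_numeral)
      also have "\<dots> = q powr (-1)" by (simp add: powr_powr)
      also have "\<dots> = 1 / q" using that powr_minus_divide[of q 1] by simp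
      finally show ?thesis .
    qed
    ultimately have "(\<sigma> \<theta> * (\<tau> - \<sigma> \<theta>)) powr (-1/2) = 1 / (sin \<theta> / (1 - h))"
      using c h1 by simp
    then have w1: "\<sigma> \<theta> powr (-1/2) * (\<tau> - \<sigma> \<theta>) powr (-1/2) = (1 - h) / sin \<theta>"
      using \<sigma> tau_gt_1 by (simp add: powr_mult)
    have w2: "(1 - \<sigma> \<theta>) powr b = (cos \<theta> - h) powr b / (1 - h) powr b"
    proof -
      have "1 - \<sigma> \<theta> = (cos \<theta> - h) / (1 - h)" using h1 by (simp add: \<sigma>_def field_simps)
      then show ?thesis using c h1 by (simp add: powr_divide)
    qed
    have k: "k (\<sigma> \<theta>) = (1 - h) powr b * (g (\<sigma> \<theta>) *
        (\<sigma> \<theta> powr (-1/2) * (\<tau> - \<sigma> \<theta>) powr (-1/2) * (1 - \<sigma> \<theta>) powr b))"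
      by (simp add: k_def sj_weight_def mult_ac)
    have abs: "\<bar>sin \<theta> / (1 - h)\<bar> = sin \<theta> / (1 - h)" using c h1 by simp
    have cancel: "S / H * (A * (B * (H / S * (X / A)))) = B * X" if "S > 0" "H > 0" "A > 0" for S H A B X :: real
      using that by simp
    show ?thesis
      unfolding abs k w1 w2 K_def by (rule cancel) (use c h1 in auto)
  qed
  have k_int: "set_integrable lborel {0..1} k"
    using int unfolding k_def by simp
  then have k_int': "set_integrable lborel {0<..<1} k"
    by (rule set_integrable_subset) auto
  \<comment> \<open>The change of variables is stated for absolute integrability over the completed
    measure. To return to \<open>lborel\<close>, Borel measurability of \<open>K\<close> is
    recovered by composing the Borel function \<open>kk\<close> with
    \<open>\<sigma>\<close>.\<close>
  define kk where "kk s = indicator {0<..<1} s *\<^sub>R k s" for s :: real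
  have kk: "kk \<in> borel_measurable borel"
    using borel_measurable_integrable[OF k_int'[unfolded set_integrable_def]] by (simp add: kk_def[abs_def])
  have k_abs: "k absolutely_integrable_on {0<..<1}"
    using k_int' kk unfolding set_integrable_def kk_def[abs_def]
    by (subst integrable_completion) auto
  have sub: "(\<lambda>\<theta>. \<bar>sin \<theta> / (1 - h)\<bar> * k (\<sigma> \<theta>)) absolutely_integrable_on ?S \<and>
      integral ?S (\<lambda>\<theta>. \<bar>sin \<theta> / (1 - h)\<bar> * k (\<sigma> \<theta>)) = integral {0<..<1} k"
    using has_absolute_integral_change_of_variables_1'[OF _ deriv inj, of k "integral {0<..<1} k"] k_abs
    unfolding img by auto
  have K_abs: "K absolutely_integrable_on ?S"
  proof -
    have "(\<lambda>\<theta>. \<bar>sin \<theta> / (1 - h)\<bar> * k (\<sigma> \<theta>)) absolutely_integrable_on ?S \<longleftrightarrow> K absolutely_integrable_on ?S"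
      by (intro set_integrable_cong refl Kk)
    then show ?thesis using conjunct1[OF sub] by (rule iffD1)
  qed
  have K_val: "integral ?S K = integral {0<..<1} k"
  proof -
    have "integral ?S (\<lambda>\<theta>. \<bar>sin \<theta> / (1 - h)\<bar> * k (\<sigma> \<theta>)) = integral ?S K"
      by (intro Henstock_Kurzweil_Integration.integral_cong Kk)
    then show ?thesis using conjunct2[OF sub] by (rule trans[OF sym])
  qed
  have K_borel: "(\<lambda>\<theta>. indicator ?S \<theta> *\<^sub>R K \<theta>) \<in> borel_measurable borel"
  proof -
    have "(\<lambda>\<theta>. indicator ?S \<theta> * (sin \<theta> / (1 - h) * kk (\<sigma> \<theta>))) \<in> borel_measurable borel"
      unfolding \<sigma>_def by (intro borel_measurable_times measurable_compose[OF _ kk]) measurable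
    moreover have "indicator ?S \<theta> * (sin \<theta> / (1 - h) * kk (\<sigma> \<theta>)) = indicator ?S \<theta> *\<^sub>R K \<theta>" for \<theta>
    proof (cases "\<theta> \<in> ?S")
      case True
      then have "\<sigma> \<theta> \<in> {0<..<1}" using img by blast
      then show ?thesis using Kk[OF True] cos_S[OF True] True h1 by (simp add: kk_def)
    qed simp
    ultimately show ?thesis by simp
  qed
  have K_int: "set_integrable lborel ?S K"
    using K_abs K_borel unfolding set_integrable_def by (subst (asm) integrable_completion) auto
  then show "set_integrable lborel ?S (\<lambda>\<theta>. g ((1 - cos \<theta>) / (1 - h)) * (cos \<theta> - h) powr b)"
    by (simp add: K_def[abs_def] \<sigma>_def)
  have "(LINT \<theta>:?S|lborel. K \<theta>) = integral {0<..<1} k"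
    using set_borel_integral_eq_integral(2)[OF K_int] K_val by simp
  also have "\<dots> = integral {0..1} k"
    by (simp add: integral_open_interval_real)
  also have "\<dots> = (LINT s:{0..1}|lborel. k s)"
    using set_borel_integral_eq_integral(2)[OF k_int] by simp
  also have "\<dots> = (1 - h) powr b * (LINT s:{0..1}|lborel. g s * ?w s)"
    by (simp add: k_def)
  finally show "(LINT \<theta>:?S|lborel. g ((1 - cos \<theta>) / (1 - h)) * (cos \<theta> - h) powr b) =
       (1 - h) powr b * (LINT s:{0..1}|lborel. g s * ?w s)"
    by (simp add: K_def \<sigma>_def)
qed

lemma upper_lower_cos:
  assumes "\<theta> \<in> {0<..<arccos h}"
  shows "upper f ((1 - cos \<theta>) / (1 - h)) = f (cos \<theta>) (sin \<theta>)"
    and "lower f ((1 - cos \<theta>) / (1 - h)) = f (cos (- \<theta>)) (sin (- \<theta>))"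
proof -
  have "1 - h > 0" using abs_h by auto
  then have x: "x_of ((1 - cos \<theta>) / (1 - h)) = cos \<theta>" by (simp add: field_simps)
  have "sin \<theta> \<ge> 0" using assms arccos_h by (intro sin_ge_zero) auto
  then have "sqrt (1 - (cos \<theta>)\<^sup>2) = sin \<theta>" by (simp flip: sin_squared_eq)
  then show "upper f ((1 - cos \<theta>) / (1 - h)) = f (cos \<theta>) (sin \<theta>)"
    "lower f ((1 - cos \<theta>) / (1 - h)) = f (cos (- \<theta>)) (sin (- \<theta>))"
    unfolding upper_def lower_def x by simp_all
qed

text \<open>The arc is cut at \<open>\<theta> = 0\<close>; the lower half is reflected, and both
  halves are then substituted. The endpoints and the cut form a null set.\<close>

lemma arc_inner_eq_sj_inner:
  assumes int: "set_integrable lborel {0..1} (\<lambda>s. upper f s * upper g s * sj_weight \<tau> (-1/2) b (-1/2) s)"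
      "set_integrable lborel {0..1} (\<lambda>s. lower f s * lower g s * sj_weight \<tau> (-1/2) b (-1/2) s)"
  shows "arc_inner b h f g = (1 - h) powr b *
     (sj_inner \<tau> (-1/2) b (-1/2) (upper f) (upper g) + sj_inner \<tau> (-1/2) b (-1/2) (lower f) (lower g))"
proof -
  define \<phi> where "\<phi> = arccos h"
  define K where "K \<theta> = f (cos \<theta>) (sin \<theta>) * g (cos \<theta>) (sin \<theta>) * (cos \<theta> - h) powr b" for \<theta>
  let ?\<sigma> = "\<lambda>\<theta>. (1 - cos \<theta>) / (1 - h)"
  have \<phi>: "0 < \<phi>" using arccos_h by (simp add: \<phi>_def)
  have up: "K \<theta> = upper f (?\<sigma> \<theta>) * upper g (?\<sigma> \<theta>) * (cos \<theta> - h) powr b"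
    and lo: "K (- \<theta>) = lower f (?\<sigma> \<theta>) * lower g (?\<sigma> \<theta>) * (cos \<theta> - h) powr b"
    if "\<theta> \<in> {0<..<\<phi>}" for \<theta>
    using that upper_lower_cos[of \<theta>] by (simp_all add: K_def \<phi>_def)
  have up_int: "set_integrable lborel {0<..<\<phi>} K"
  proof -
    have "set_integrable lborel {0<..<\<phi>} K \<longleftrightarrow> set_integrable lborel {0<..<\<phi>}
        (\<lambda>\<theta>. upper f (?\<sigma> \<theta>) * upper g (?\<sigma> \<theta>) * (cos \<theta> - h) powr b)"
      by (intro set_integrable_cong refl up)
    then show ?thesis using half_substitution(1)[OF int(1)] unfolding \<phi>_def by (rule iffD2)
  qed
  have "(LINT \<theta>:{0<..<\<phi>}|lborel. K \<theta>) = (LINT \<theta>:{0<..<\<phi>}|lborel.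
      upper f (?\<sigma> \<theta>) * upper g (?\<sigma> \<theta>) * (cos \<theta> - h) powr b)"
    by (rule set_lebesgue_integral_cong) (simp_all add: up)
  then have up_val: "(LINT \<theta>:{0<..<\<phi>}|lborel. K \<theta>) =
      (1 - h) powr b * sj_inner \<tau> (-1/2) b (-1/2) (upper f) (upper g)"
    unfolding \<phi>_def half_substitution(2)[OF int(1)] sj_inner_def .
  have lo_int: "set_integrable lborel {0<..<\<phi>} (\<lambda>\<theta>. K (- \<theta>))"
  proof -
    have "set_integrable lborel {0<..<\<phi>} (\<lambda>\<theta>. K (- \<theta>)) \<longleftrightarrow> set_integrable lborel {0<..<\<phi>}
        (\<lambda>\<theta>. lower f (?\<sigma> \<theta>) * lower g (?\<sigma> \<theta>) * (cos \<theta> - h) powr b)"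
      by (intro set_integrable_cong refl lo)
    then show ?thesis using half_substitution(1)[OF int(2)] unfolding \<phi>_def by (rule iffD2)
  qed
  have "(LINT \<theta>:{0<..<\<phi>}|lborel. K (- \<theta>)) = (LINT \<theta>:{0<..<\<phi>}|lborel.
      lower f (?\<sigma> \<theta>) * lower g (?\<sigma> \<theta>) * (cos \<theta> - h) powr b)"
    by (rule set_lebesgue_integral_cong) (simp_all add: lo)
  then have lo_val: "(LINT \<theta>:{0<..<\<phi>}|lborel. K (- \<theta>)) =
      (1 - h) powr b * sj_inner \<tau> (-1/2) b (-1/2) (lower f) (lower g)"
    unfolding \<phi>_def half_substitution(2)[OF int(2)] sj_inner_def .
  have neg_set: "{\<theta>. - \<theta> \<in> {-\<phi><..<0}} = {0<..<\<phi>}" by auto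
  have lo_val': "(LINT \<theta>:{-\<phi><..<0}|lborel. K \<theta>) = (LINT \<theta>:{0<..<\<phi>}|lborel. K (- \<theta>))"
    by (subst set_integral_reflect) (simp only: neg_set)
  have lo_int': "set_integrable lborel {-\<phi><..<0} K"
  proof -
    have "integrable lborel (\<lambda>\<theta>. indicator {0<..<\<phi>} (0 + -1 * \<theta>) *\<^sub>R K (- (0 + -1 * \<theta>)))"
      by (rule lborel_integrable_real_affine) (use lo_int in \<open>auto simp: set_integrable_def\<close>)
    moreover have "indicator {0<..<\<phi>} (0 + -1 * \<theta>) = (indicator {-\<phi><..<0} \<theta> :: real)" for \<theta>
      by (auto simp: indicator_def)
    ultimately show ?thesis by (simp add: set_integrable_def)
  qed
  have "arc_inner b h f g = (LINT \<theta>:{-\<phi>..\<phi>}|lborel. K \<theta>)"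
    by (simp add: arc_inner_def K_def \<phi>_def)
  also have "\<dots> = (LINT \<theta>:{-\<phi><..<0} \<union> {0<..<\<phi>}|lborel. K \<theta>)"
    by (rule set_integral_discrete_difference[of "{-\<phi>, 0, \<phi>}"]) (use \<phi> in auto)
  also have "\<dots> = (LINT \<theta>:{-\<phi><..<0}|lborel. K \<theta>) + (LINT \<theta>:{0<..<\<phi>}|lborel. K \<theta>)"
    by (intro set_integral_Un lo_int' up_int) auto
  finally show ?thesis
    by (simp add: lo_val' lo_val up_val distrib_left)
qed

text \<open>The factor \<open>m\<close> covers \<open>b = -1\<close>: there all functions involved are divisible by \<open>1 - s\<close>, and
  \<open>(1 - s)\<^sup>2\<close> turns the non-integrable weight into the one with \<open>b = 1\<close>.\<close>

lemma arc_inner_parity: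
  assumes \<beta>: "\<beta> > -1"
    and weight: "\<And>a c s. s \<in> {0<..<1} \<Longrightarrow> (m s)\<^sup>2 * sj_weight \<tau> a b c s = sj_weight \<tau> a \<beta> c s"
    and bb: "bounded_borel01 e" "bounded_borel01 e'" "bounded_borel01 d" "bounded_borel01 d'"
    and f: "\<And>s. s \<in> {0<..<1} \<Longrightarrow> arc_even f (x_of s) = m s * e s"
           "\<And>s. s \<in> {0<..<1} \<Longrightarrow> arc_odd f (x_of s) = m s * d s"
    and g: "\<And>s. s \<in> {0<..<1} \<Longrightarrow> arc_even g (x_of s) = m s * e' s"
           "\<And>s. s \<in> {0<..<1} \<Longrightarrow> arc_odd g (x_of s) = m s * d' s"
  shows "arc_inner b h f g = 2 * (1 - h) powr b *
     (sj_inner \<tau> (-1/2) \<beta> (-1/2) e e' + (1 - h)\<^sup>2 * sj_inner \<tau> (1/2) \<beta> (1/2) d d')"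
proof -
  interpret sj: sj_parameters \<tau> "-1/2" \<beta> "-1/2"
    by unfold_locales (use tau_gt_1 \<beta> in auto)
  define y where "y s = sqrt (1 - (x_of s)\<^sup>2)" for s
  have y: "bounded_borel01 y"
    unfolding y_def by (intro bounded_borel01_continuous continuous_intros)
  have y0: "y s > 0" if "s \<in> {0<..<1}" for s
    using one_minus_square_pos[OF that] by (simp add: y_def)
  \<comment> \<open>Here \<open>y * y\<close> is \<open>(1 - h)\<^sup>2 * s * (\<tau> - s)\<close>,
    which raises the exponents \<open>-1/2\<close> of the weight to \<open>1/2\<close>: hence the
    second family, for the odd parts.\<close>
  have y2: "(y s)\<^sup>2 * sj_weight \<tau> (-1/2) \<beta> (-1/2) s = (1 - h)\<^sup>2 * sj_weight \<tau> (1/2) \<beta> (1/2) s"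
    if s: "s \<in> {0<..<1}" for s
  proof -
    have *: "z * z powr (-1/2) = z powr (1/2)" if "z > 0" for z :: real
      using that powr_add[of z 1 "-1/2"] by simp
    have s': "s > 0" "\<tau> - s > 0" using s tau_gt_1 by auto
    have "(y s)\<^sup>2 = (1 - h)\<^sup>2 * (s * (\<tau> - s))"
      using one_minus_square_pos[OF s] one_minus_square[of s] by (simp add: y_def)
    then have "(y s)\<^sup>2 * sj_weight \<tau> (-1/2) \<beta> (-1/2) s =
       (1 - h)\<^sup>2 * ((s * s powr (-1/2)) * (1 - s) powr \<beta> * ((\<tau> - s) * (\<tau> - s) powr (-1/2)))"
      unfolding sj_weight_def by (simp only: mult_ac)
    then show ?thesis unfolding *[OF s'(1)] *[OF s'(2)] by (simp only: sj_weight_def)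
  qed
  have split: "upper k s = arc_even k (x_of s) + y s * arc_odd k (x_of s)"
    "lower k s = arc_even k (x_of s) - y s * arc_odd k (x_of s)" if "s \<in> {0<..<1}" for k s
    using y0[OF that] by (simp_all add: upper_def lower_def arc_even_def arc_odd_def y_def field_simps)
  define p where "p s = e s + y s * d s" for s
  define p' where "p' s = e' s + y s * d' s" for s
  define q where "q s = e s - y s * d s" for s
  define q' where "q' s = e' s - y s * d' s" for s
  have pq: "bounded_borel01 p" "bounded_borel01 p'" "bounded_borel01 q" "bounded_borel01 q'"
    unfolding p_def p'_def q_def q'_def by (intro bounded_borel01_intros bb y)+
  have up: "upper f s * upper g s * sj_weight \<tau> (-1/2) b (-1/2) s = p s * p' s * sj.w s"
    and lo: "lower f s * lower g s * sj_weight \<tau> (-1/2) b (-1/2) s = q s * q' s * sj.w s"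
    if s: "s \<in> {0<..<1}" for s
  proof -
    have "upper f s = m s * p s" "upper g s = m s * p' s" "lower f s = m s * q s" "lower g s = m s * q' s"
      unfolding split[OF s] f[OF s] g[OF s] p_def p'_def q_def q'_def by (simp_all add: algebra_simps)
    then have "upper f s * upper g s * sj_weight \<tau> (-1/2) b (-1/2) s =
        p s * p' s * ((m s)\<^sup>2 * sj_weight \<tau> (-1/2) b (-1/2) s)"
      "lower f s * lower g s * sj_weight \<tau> (-1/2) b (-1/2) s =
        q s * q' s * ((m s)\<^sup>2 * sj_weight \<tau> (-1/2) b (-1/2) s)"
      by (simp_all add: power2_eq_square mult_ac)
    then show "upper f s * upper g s * sj_weight \<tau> (-1/2) b (-1/2) s = p s * p' s * sj.w s"
      "lower f s * lower g s * sj_weight \<tau> (-1/2) b (-1/2) s = q s * q' s * sj.w s"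
      by (simp_all only: weight[OF s])
  qed
  have int_cong: "set_integrable lborel {0..1} (\<lambda>s. u s * sj_weight \<tau> (-1/2) b (-1/2) s)"
    if int: "set_integrable lborel {0..1} (\<lambda>s. v s * sj.w s)"
      and eq: "\<And>s. s \<in> {0<..<1} \<Longrightarrow> u s * sj_weight \<tau> (-1/2) b (-1/2) s = v s * sj.w s" for u v
  proof -
    have "u s * sj_weight \<tau> (-1/2) b (-1/2) s = v s * sj.w s" if "s \<in> {0..1}" for s
    proof -
      from that consider "s = 0" | "s = 1" | "s \<in> {0<..<1}" by fastforce
      then show ?thesis by cases (use eq in simp_all)
    qed
    then have "set_integrable lborel {0..1} (\<lambda>s. u s * sj_weight \<tau> (-1/2) b (-1/2) s) \<longleftrightarrow>
        set_integrable lborel {0..1} (\<lambda>s. v s * sj.w s)"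
      by (intro set_integrable_cong refl)
    then show ?thesis using int by (rule iffD2)
  qed
  have "set_integrable lborel {0..1} (\<lambda>s. upper f s * upper g s * sj_weight \<tau> (-1/2) b (-1/2) s)"
    by (rule int_cong[OF sj.weighted_integrable up]) (intro bounded_borel01_mult pq)
  moreover have "set_integrable lborel {0..1} (\<lambda>s. lower f s * lower g s * sj_weight \<tau> (-1/2) b (-1/2) s)"
    by (rule int_cong[OF sj.weighted_integrable lo]) (intro bounded_borel01_mult pq)
  ultimately have "arc_inner b h f g = (1 - h) powr b *
     (sj_inner \<tau> (-1/2) b (-1/2) (upper f) (upper g) + sj_inner \<tau> (-1/2) b (-1/2) (lower f) (lower g))"
    by (rule arc_inner_eq_sj_inner)
  also have "sj_inner \<tau> (-1/2) b (-1/2) (upper f) (upper g) = sj.ip p p'"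
    by (rule sj_inner_cong[OF up])
  also have "sj_inner \<tau> (-1/2) b (-1/2) (lower f) (lower g) = sj.ip q q'"
    by (rule sj_inner_cong[OF lo])
  also have "sj.ip p p' = sj.ip (\<lambda>s. p s * p' s) (\<lambda>s. 1)"
    by (rule sj_inner_cong) simp
  also have "sj.ip q q' = sj.ip (\<lambda>s. q s * q' s) (\<lambda>s. 1)"
    by (rule sj_inner_cong) simp
  also have "sj.ip (\<lambda>s. p s * p' s) (\<lambda>s. 1) + sj.ip (\<lambda>s. q s * q' s) (\<lambda>s. 1) =
      sj.ip (\<lambda>s. p s * p' s + q s * q' s) (\<lambda>s. 1)"
    by (subst sj.ip_add_left) (auto intro!: bounded_borel01_mult pq)
  \<comment> \<open>The mixed terms of the upper and lower arcs have opposite signs and cancel, so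
    even and odd parts are orthogonal.\<close>
  also have "(\<lambda>s. p s * p' s + q s * q' s) = (\<lambda>s. 2 * (e s * e' s + (y s * y s) * (d s * d' s)))"
    by (auto simp: p_def p'_def q_def q'_def algebra_simps)
  also have "sj.ip \<dots> (\<lambda>s. 1) =
      2 * (sj.ip (\<lambda>s. e s * e' s) (\<lambda>s. 1) + sj.ip (\<lambda>s. (y s * y s) * (d s * d' s)) (\<lambda>s. 1))"
    by (subst sj_inner_scale_left, subst sj.ip_add_left) (auto intro!: bounded_borel01_mult bb y)
  also have "sj.ip (\<lambda>s. e s * e' s) (\<lambda>s. 1) = sj.ip e e'"
    by (rule sj_inner_cong) simp
  also have "sj.ip (\<lambda>s. (y s * y s) * (d s * d' s)) (\<lambda>s. 1) =
      sj_inner \<tau> (1/2) \<beta> (1/2) (\<lambda>s. (1 - h)\<^sup>2 * d s) d'"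
  proof (rule sj_inner_cong)
    fix s :: real assume s: "s \<in> {0<..<1}"
    have "y s * y s * (d s * d' s) * 1 * sj.w s = d s * d' s * ((y s)\<^sup>2 * sj.w s)"
      by (simp add: power2_eq_square mult_ac)
    also have "\<dots> = (1 - h)\<^sup>2 * d s * d' s * sj_weight \<tau> (1/2) \<beta> (1/2) s"
      unfolding y2[OF s] by (simp add: mult_ac)
    finally show "y s * y s * (d s * d' s) * 1 * sj.w s =
        (1 - h)\<^sup>2 * d s * d' s * sj_weight \<tau> (1/2) \<beta> (1/2) s" .
  qed
  finally show ?thesis by (simp add: sj_inner_scale_left)
qed

section \<open>Parity of the basis functions and partial sums\<close>

lemma arc_even_diff: "arc_even (\<lambda>x y. f x y - g x y) x = arc_even f x - arc_even g x"
  and arc_odd_diff: "arc_odd (\<lambda>x y. f x y - g x y) x = arc_odd f x - arc_odd g x"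
  by (simp_all add: arc_even_def arc_odd_def add_divide_distrib diff_divide_distrib)

lemma arc_even_odd_of_parity:
  assumes "s \<in> {0<..<1}"
  shows "arc_even (\<lambda>x y. u x + y * v x) (x_of s) = u (x_of s)"
    "arc_odd (\<lambda>x y. u x + y * v x) (x_of s) = v (x_of s)"
  using one_minus_square_pos[OF assms] by (simp_all add: arc_even_def arc_odd_def field_simps)

lemma \<sigma>_x_of: "(x_of s - 1) / (h - 1) = s"
  using abs_h by auto

lemma arc_p_parity:
  assumes "s \<in> {0<..<1}"
  shows "arc_even (arc_p b h n) (x_of s) = poly (semiclassical_jacobi \<tau> (-1/2) b (-1/2) n) s"
    "arc_odd (arc_p b h n) (x_of s) = 0"
  using abs_h by (simp_all add: arc_p_def arc_even_def arc_odd_def)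

lemma arc_q_parity:
  assumes "s \<in> {0<..<1}"
  shows "arc_even (arc_q b h n) (x_of s) = 0"
    "arc_odd (arc_q b h n) (x_of s) = poly (semiclassical_jacobi \<tau> (1/2) b (1/2) (n - 1)) s"
  using abs_h one_minus_square_pos[OF assms] by (simp_all add: arc_q_def arc_even_def arc_odd_def)

lemma arc_partial_sum_parity:
  assumes s: "s \<in> {0<..<1}"
  shows "arc_even (arc_partial_sum b h n f) (x_of s) = arc_coeff_0 b h f * poly (semiclassical_jacobi \<tau> (-1/2) b (-1/2) 0) s +
      (\<Sum>j=1..n. arc_coeff_2 b h f j * poly (semiclassical_jacobi \<tau> (-1/2) b (-1/2) j) s)"
    and "arc_odd (arc_partial_sum b h n f) (x_of s) =
      (\<Sum>j=1..n. arc_coeff_1 b h f j * poly (semiclassical_jacobi \<tau> (1/2) b (1/2) (j - 1)) s)"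
proof -
  let ?P = "\<lambda>j x. poly (semiclassical_jacobi \<tau> (-1/2) b (-1/2) j) ((x - 1) / (h - 1))"
  let ?Q = "\<lambda>j x. poly (semiclassical_jacobi \<tau> (1/2) b (1/2) (j - 1)) ((x - 1) / (h - 1))"
  have eq: "arc_partial_sum b h n f = (\<lambda>x y.
      (arc_coeff_0 b h f * ?P 0 x + (\<Sum>j=1..n. arc_coeff_2 b h f j * ?P j x)) +
      y * (\<Sum>j=1..n. arc_coeff_1 b h f j * ?Q j x))"
    by (intro ext) (simp add: arc_partial_sum_def arc_p_def arc_q_def sum.distrib sum_distrib_left mult_ac)
  show "arc_even (arc_partial_sum b h n f) (x_of s) = arc_coeff_0 b h f * poly (semiclassical_jacobi \<tau> (-1/2) b (-1/2) 0) s +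
      (\<Sum>j=1..n. arc_coeff_2 b h f j * poly (semiclassical_jacobi \<tau> (-1/2) b (-1/2) j) s)"
    "arc_odd (arc_partial_sum b h n f) (x_of s) =
      (\<Sum>j=1..n. arc_coeff_1 b h f j * poly (semiclassical_jacobi \<tau> (1/2) b (1/2) (j - 1)) s)"
    unfolding eq arc_even_odd_of_parity[OF s] \<sigma>_x_of by simp_all
qed

end

section \<open>Convergence\<close>

lemma bigo_geom:
  fixes \<rho> :: real
  assumes "\<rho> > 1" "\<And>n. k \<le> n \<Longrightarrow> \<bar>X n\<bar> \<le> C / \<rho> ^ n"
  shows "X \<in> O(\<lambda>n. 1 / \<rho> ^ n)"
proof (rule bigoI)
  show "\<forall>\<^sub>F n in sequentially. norm (X n) \<le> C * norm (1 / \<rho> ^ n)"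
    using eventually_ge_at_top[of k]
  proof eventually_elim
    case (elim n)
    then show ?case using assms(2)[of n] assms(1) by simp
  qed
qed

lemma bigo_geom_shift:
  fixes \<rho> :: real
  assumes \<rho>: "\<rho> > 1" and "\<exists>C. \<forall>n. \<bar>X n\<bar> \<le> C / \<rho> ^ n" and Y: "\<And>n. k \<le> n \<Longrightarrow> Y n = X (n - k)"
  shows "Y \<in> O(\<lambda>n. 1 / \<rho> ^ n)"
proof -
  obtain C where C: "\<And>n. \<bar>X n\<bar> \<le> C / \<rho> ^ n" using assms(2) by blast
  show ?thesis
  proof (rule bigo_geom[OF \<rho>])
    fix n assume "k \<le> n"
    then show "\<bar>Y n\<bar> \<le> C * \<rho> ^ k / \<rho> ^ n"
      using C[of "n - k"] \<rho> by (simp add: Y power_diff)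
  qed
qed

lemma arc_inner_self_nonneg: "arc_inner b h u u \<ge> 0"
  unfolding arc_inner_def set_lebesgue_integral_def
  by (rule integral_nonneg_AE) simp

lemma arc_norm_square: "(arc_norm b h u)\<^sup>2 = arc_inner b h u u"
  by (simp add: arc_norm_def arc_inner_self_nonneg)

text \<open>\<open>X\<close> and \<open>Y\<close> are the squared errors of the even and odd parts,
  whose expansions stop at different degrees. Index shifts by \<open>i\<close> and \<open>k\<close>
  only enlarge the constants.\<close>

lemma arc_norm_bigo:
  assumes \<rho>: "\<rho> > 1" and c: "c \<ge> 0" "l \<ge> 0" and ik: "i \<le> k"
    and R: "\<And>n. k \<le> n \<Longrightarrow> arc_inner b h (R n) (R n) = c * (X (n - i) + l * Y (n - k))"
    and X: "\<exists>C. \<forall>n. X n \<le> C / (\<rho> ^ n)\<^sup>2" and Y: "\<exists>C. \<forall>n. Y n \<le> C / (\<rho> ^ n)\<^sup>2"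
  shows "(\<lambda>n. arc_norm b h (R n)) \<in> O(\<lambda>n. 1 / \<rho> ^ n)"
proof -
  obtain C1 C2 where C: "\<And>n. X n \<le> C1 / (\<rho> ^ n)\<^sup>2" "\<And>n. Y n \<le> C2 / (\<rho> ^ n)\<^sup>2"
    using X Y by blast
  define D where "D = c * (C1 * (\<rho> ^ i)\<^sup>2 + l * (C2 * (\<rho> ^ k)\<^sup>2))"
  have shift: "C / (\<rho> ^ (n - j))\<^sup>2 = C * (\<rho> ^ j)\<^sup>2 / (\<rho> ^ n)\<^sup>2" if "j \<le> n" for C j n
    using that \<rho> by (simp add: power_diff power_divide)
  show ?thesis
  proof (rule bigo_geom[OF \<rho>])
    fix n assume n: "k \<le> n"
    have "X (n - i) \<le> C1 * (\<rho> ^ i)\<^sup>2 / (\<rho> ^ n)\<^sup>2" "Y (n - k) \<le> C2 * (\<rho> ^ k)\<^sup>2 / (\<rho> ^ n)\<^sup>2"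
      using C(1)[of "n - i"] C(2)[of "n - k"] shift n ik by simp_all
    then have "arc_inner b h (R n) (R n) \<le>
        c * (C1 * (\<rho> ^ i)\<^sup>2 / (\<rho> ^ n)\<^sup>2 + l * (C2 * (\<rho> ^ k)\<^sup>2 / (\<rho> ^ n)\<^sup>2))"
      unfolding R[OF n] using c by (intro mult_left_mono add_mono)
    also have "\<dots> = D / (\<rho> ^ n)\<^sup>2"
      by (simp add: D_def add_divide_distrib distrib_left)
    finally have "arc_norm b h (R n) \<le> sqrt (D / (\<rho> ^ n)\<^sup>2)"
      by (simp add: arc_norm_def)
    also have "\<dots> = sqrt D / \<rho> ^ n"
      using \<rho> by (simp add: real_sqrt_divide)
    finally show "\<bar>arc_norm b h (R n)\<bar> \<le> sqrt D / \<rho> ^ n"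
      by (simp add: arc_norm_def arc_inner_self_nonneg)
  qed
qed

sublocale arc_continuation \<subseteq> arc_parameter h
  by unfold_locales (rule h)

context arc_continuation
begin

text \<open>In each arc coefficient the factors \<open>c\<close> and \<open>(1 - h)\<^sup>2\<close>
  cancel between numerator and denominator, leaving the Jacobi coefficients of \<open>e\<close> and
  \<open>d\<close>. The partial sum thus splits into two truncated Jacobi expansions.\<close>

lemma convergence_orthogonal_case:
  assumes b: "b > -1"
  shows "(\<lambda>n. arc_norm b h (\<lambda>x y. f x y - arc_partial_sum b h n f x y)) \<in> O(\<lambda>n. 1 / \<rho> ^ n)"
    and "(\<lambda>n. arc_coeff_1 b h f n) \<in> O(\<lambda>n. 1 / \<rho> ^ n)"
    and "(\<lambda>n. arc_coeff_2 b h f n) \<in> O(\<lambda>n. 1 / \<rho> ^ n)"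
proof -
  interpret P: sj_parameters \<tau> "-1/2" b "-1/2"
    by unfold_locales (use tau_gt_1 b in auto)
  interpret Q: sj_parameters \<tau> "1/2" b "1/2"
    by unfold_locales (use tau_gt_1 b in auto)
  let ?P = "\<lambda>n. poly (semiclassical_jacobi \<tau> (-1/2) b (-1/2) n)"
  let ?Q = "\<lambda>n. poly (semiclassical_jacobi \<tau> (1/2) b (1/2) n)"
  define e where "e s = arc_even f (x_of s)" for s
  define d where "d s = arc_odd f (x_of s)" for s
  have ge: "geom_approx \<rho> e" and gd: "geom_approx \<rho> d"
    using geom_approx_even(1) geom_approx_odd(1) by (simp_all add: e_def[abs_def] d_def[abs_def])
  note be = geom_approx_bounded_borel01[OF ge \<rho>] and bd = geom_approx_bounded_borel01[OF gd \<rho>]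
  define c where "c = 2 * (1 - h) powr b"
  have c: "c > 0" using h by (auto simp: c_def)
  have par: "arc_inner b h u v = c * (P.ip e1 e2 + (1 - h)\<^sup>2 * Q.ip d1 d2)"
    if "bounded_borel01 e1" "bounded_borel01 e2" "bounded_borel01 d1" "bounded_borel01 d2"
      "\<And>s. s \<in> {0<..<1} \<Longrightarrow> arc_even u (x_of s) = e1 s" "\<And>s. s \<in> {0<..<1} \<Longrightarrow> arc_odd u (x_of s) = d1 s"
      "\<And>s. s \<in> {0<..<1} \<Longrightarrow> arc_even v (x_of s) = e2 s" "\<And>s. s \<in> {0<..<1} \<Longrightarrow> arc_odd v (x_of s) = d2 s"
    for u v e1 e2 d1 d2
    unfolding c_def
    by (rule arc_inner_parity[OF b, where m = "\<lambda>_. 1"]) (simp_all add: that)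
  have zero: "sj_inner t a b c (\<lambda>_. 0) v = 0" "sj_inner t a b c v (\<lambda>_. 0) = 0" for t a b c v
    by (simp_all add: sj_inner_def)
  have fp: "arc_inner b h f (arc_p b h j) = c * P.ip e (?P j)" for j
    by (subst par[of e "?P j" d "\<lambda>_. 0"]) (simp_all add: be bd e_def d_def arc_p_parity zero)
  have pp: "arc_inner b h (arc_p b h j) (arc_p b h j) = c * P.ip (?P j) (?P j)" for j
    by (subst par[of "?P j" "?P j" "\<lambda>_. 0" "\<lambda>_. 0"]) (simp_all add: arc_p_parity zero)
  have fq: "arc_inner b h f (arc_q b h j) = c * ((1 - h)\<^sup>2 * Q.ip d (?Q (j - 1)))" for j
    by (subst par[of e "\<lambda>_. 0" d "?Q (j - 1)"]) (simp_all add: be bd e_def d_def arc_q_parity zero)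
  have qq: "arc_inner b h (arc_q b h j) (arc_q b h j) = c * ((1 - h)\<^sup>2 * Q.ip (?Q (j - 1)) (?Q (j - 1)))" for j
    by (subst par[of "\<lambda>_. 0" "\<lambda>_. 0" "?Q (j - 1)" "?Q (j - 1)"]) (simp_all add: arc_q_parity zero)
  have h1: "1 - h \<noteq> 0" using h by auto
  have c2: "arc_coeff_2 b h f j = sj_coeff \<tau> (-1/2) b (-1/2) e j"
    and c0: "arc_coeff_0 b h f = sj_coeff \<tau> (-1/2) b (-1/2) e 0" for j
    using b c unfolding arc_coeff_2_def arc_coeff_0_def arc_norm_square fp pp sj_coeff_def Let_def by simp_all
  have c1: "arc_coeff_1 b h f j = sj_coeff \<tau> (1/2) b (1/2) d (j - 1)" for j
    using b c h1 unfolding arc_coeff_1_def arc_norm_square fq qq sj_coeff_def Let_def by simp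
  show "(\<lambda>n. arc_coeff_1 b h f n) \<in> O(\<lambda>n. 1 / \<rho> ^ n)"
    by (rule bigo_geom_shift[OF \<rho> Q.sj_coeff_geom_decay[OF gd \<rho>], of 1]) (rule c1)
  show "(\<lambda>n. arc_coeff_2 b h f n) \<in> O(\<lambda>n. 1 / \<rho> ^ n)"
    by (rule bigo_geom_shift[OF \<rho> P.sj_coeff_geom_decay[OF ge \<rho>], of 0]) (simp add: c2)
  define rP where "rP n s = e s - poly (P.expansion e n) s" for n s
  define rQ where "rQ n s = d s - poly (Q.expansion d n) s" for n s
  show "(\<lambda>n. arc_norm b h (\<lambda>x y. f x y - arc_partial_sum b h n f x y)) \<in> O(\<lambda>n. 1 / \<rho> ^ n)"
  \<comment> \<open>The shifts are 0 and 1: \<open>arc_p\<close> of index \<open>n\<close> has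
    degree \<open>n\<close> in \<open>s\<close>, while the polynomial factor of \<open>arc_q\<close>
    has degree \<open>n - 1\<close>.\<close>
  proof (rule arc_norm_bigo[OF \<rho>, of c "(1 - h)\<^sup>2" 0 1])
    fix n :: nat assume n: "1 \<le> n"
    then obtain m where m: "n = Suc m" by (cases n) auto
    have even: "arc_even (\<lambda>x y. f x y - arc_partial_sum b h n f x y) (x_of s) = rP (n - 0) s"
      and odd: "arc_odd (\<lambda>x y. f x y - arc_partial_sum b h n f x y) (x_of s) = rQ (n - 1) s"
      if s: "s \<in> {0<..<1}" for s
    proof -
      show "arc_even (\<lambda>x y. f x y - arc_partial_sum b h n f x y) (x_of s) = rP (n - 0) s"
        unfolding arc_even_diff arc_partial_sum_parity[OF s] rP_def P.expansion_def poly_sum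
        by (simp add: c0 c2 e_def sum.atMost_shift sum.atLeast1_atMost_eq)
      show "arc_odd (\<lambda>x y. f x y - arc_partial_sum b h n f x y) (x_of s) = rQ (n - 1) s"
        unfolding arc_odd_diff arc_partial_sum_parity[OF s] rQ_def Q.expansion_def poly_sum
        by (simp add: c1 d_def sum.atLeast1_atMost_eq m lessThan_Suc_atMost
          del: sum.cl_ivl_Suc sum.lessThan_Suc sum.atMost_Suc)
    qed
    show "arc_inner b h (\<lambda>x y. f x y - arc_partial_sum b h n f x y) (\<lambda>x y. f x y - arc_partial_sum b h n f x y) =
        c * (P.ip (rP (n - 0)) (rP (n - 0)) + (1 - h)\<^sup>2 * Q.ip (rQ (n - 1)) (rQ (n - 1)))"
      by (rule par[OF _ _ _ _ even odd even odd])
         (auto intro!: bounded_borel01_diff be bd simp: rP_def[abs_def] rQ_def[abs_def])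
  next
    show "\<exists>C. \<forall>n. P.ip (rP n) (rP n) \<le> C / (\<rho> ^ n)\<^sup>2"
      using P.expansion_geom_convergence[OF ge \<rho>] by (simp add: rP_def[abs_def])
    show "\<exists>C. \<forall>n. Q.ip (rQ n) (rQ n) \<le> C / (\<rho> ^ n)\<^sup>2"
      using Q.expansion_geom_convergence[OF gd \<rho>] by (simp add: rQ_def[abs_def])
  qed (use c in auto)
qed

text \<open>The constant terms interpolate the even and odd parts at \<open>h\<close>, that is at
  \<open>s = 1\<close>, and all other basis polynomials contain the factor \<open>1 - s\<close>. The
  residual therefore does too, and its square turns the exponent -1 of \<open>1 - s\<close> into 1,
  where the orthogonal theory applies to \<open>e\<close> and \<open>d\<close>.\<close>

lemma convergence_minus_one:
  shows "(\<lambda>n. arc_norm (-1) h (\<lambda>x y. f x y - arc_partial_sum (-1) h n f x y)) \<in> O(\<lambda>n. 1 / \<rho> ^ n)"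
    and "(\<lambda>n. arc_coeff_1 (-1) h f n) \<in> O(\<lambda>n. 1 / \<rho> ^ n)"
    and "(\<lambda>n. arc_coeff_2 (-1) h f n) \<in> O(\<lambda>n. 1 / \<rho> ^ n)"
proof -
  interpret P: sj_parameters \<tau> "-1/2" 1 "-1/2"
    by unfold_locales (use tau_gt_1 in auto)
  interpret Q: sj_parameters \<tau> "1/2" 1 "1/2"
    by unfold_locales (use tau_gt_1 in auto)
  define e where "e = arc_quotient h (arc_even f)"
  define d where "d = arc_quotient h (arc_odd f)"
  have ge: "geom_approx \<rho> e" and gd: "geom_approx \<rho> d"
    using geom_approx_even(2) geom_approx_odd(2) by (simp_all add: e_def d_def)
  note be = geom_approx_bounded_borel01[OF ge \<rho>] and bd = geom_approx_bounded_borel01[OF gd \<rho>]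
  have e: "arc_even f (x_of s) = arc_even f h + (1 - s) * e s"
    and d: "arc_odd f (x_of s) = arc_odd f h + (1 - s) * d s" if "s \<in> {0<..<1}" for s
    using that by (simp_all add: e_def d_def arc_quotient_def)
  have J0: "semiclassical_jacobi t a (-1) c 0 = 1"
    and JSuc: "semiclassical_jacobi t a (-1) c (Suc n) = [:1, -1:] * semiclassical_jacobi t a 1 c n" for t a c n
    by (simp_all add: semiclassical_jacobi_def)
  have linear: "poly ([:1, -1:] * p) s = (1 - s) * poly p s" for p and s :: real
    by (simp add: algebra_simps)
  have c2: "arc_coeff_2 (-1) h f j = sj_coeff \<tau> (-1/2) 1 (-1/2) e (j - 1)" for j
    by (simp add: arc_coeff_2_def e_def)
  have c1: "arc_coeff_1 (-1) h f j = sj_coeff \<tau> (1/2) 1 (1/2) d (j - 2)" if "2 \<le> j" for j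
    using that by (simp add: arc_coeff_1_def d_def)
  show "(\<lambda>n. arc_coeff_1 (-1) h f n) \<in> O(\<lambda>n. 1 / \<rho> ^ n)"
    by (rule bigo_geom_shift[OF \<rho> Q.sj_coeff_geom_decay[OF gd \<rho>], of 2]) (rule c1)
  show "(\<lambda>n. arc_coeff_2 (-1) h f n) \<in> O(\<lambda>n. 1 / \<rho> ^ n)"
    by (rule bigo_geom_shift[OF \<rho> P.sj_coeff_geom_decay[OF ge \<rho>], of 1]) (rule c2)
  define rP where "rP n s = e s - poly (P.expansion e n) s" for n s
  define rQ where "rQ n s = d s - poly (Q.expansion d n) s" for n s
  let ?c = "2 * (1 - h) powr (-1)"
  show "(\<lambda>n. arc_norm (-1) h (\<lambda>x y. f x y - arc_partial_sum (-1) h n f x y)) \<in> O(\<lambda>n. 1 / \<rho> ^ n)"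
  \<comment> \<open>One more degree than in the orthogonal case is spent on the factor
    \<open>1 - s\<close>, so the shifts are 1 and 2.\<close>
  proof (rule arc_norm_bigo[OF \<rho>, of ?c "(1 - h)\<^sup>2" 1 2])
    fix n :: nat assume n: "2 \<le> n"
    define m where "m = n - 2"
    have m: "n = Suc (Suc m)" using n by (simp add: m_def)
    have even: "arc_even (\<lambda>x y. f x y - arc_partial_sum (-1) h n f x y) (x_of s) = (1 - s) * rP (n - 1) s"
      and odd: "arc_odd (\<lambda>x y. f x y - arc_partial_sum (-1) h n f x y) (x_of s) = (1 - s) * rQ (n - 2) s"
      if s: "s \<in> {0<..<1}" for s
    proof -
      have "arc_even (arc_partial_sum (-1) h n f) (x_of s) = arc_even f h +
          (\<Sum>i<n. arc_coeff_2 (-1) h f (Suc i) * poly (semiclassical_jacobi \<tau> (-1/2) (-1) (-1/2) (Suc i)) s)"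
        unfolding arc_partial_sum_parity(1)[OF s] J0 by (simp add: arc_coeff_0_def sum.atLeast1_atMost_eq)
      also have "\<dots> = arc_even f h + (1 - s) * poly (P.expansion e (n - 1)) s"
        unfolding JSuc linear c2 P.expansion_def poly_sum poly_smult sum_distrib_left m
        by (simp add: lessThan_Suc_atMost mult.left_commute del: sum.cl_ivl_Suc sum.lessThan_Suc sum.atMost_Suc)
      finally show "arc_even (\<lambda>x y. f x y - arc_partial_sum (-1) h n f x y) (x_of s) = (1 - s) * rP (n - 1) s"
        unfolding arc_even_diff e[OF s] by (simp add: rP_def right_diff_distrib)
      \<comment> \<open>The summand \<open>j = 1\<close> is the interpolating constant
        \<open>arc_odd f h\<close>; it is split off, so only \<open>Suc m = n - 1\<close> terms
        remain.\<close>
      have "arc_odd (arc_partial_sum (-1) h n f) (x_of s) = arc_odd f h +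
          (\<Sum>i<Suc m. arc_coeff_1 (-1) h f (Suc (Suc i)) * poly (semiclassical_jacobi \<tau> (1/2) (-1) (1/2) (Suc i)) s)"
        unfolding arc_partial_sum_parity(2)[OF s] m
        by (simp add: sum.atLeast1_atMost_eq J0 arc_coeff_1_def del: sum.cl_ivl_Suc sum.lessThan_Suc)
           (simp add: sum.lessThan_Suc_shift J0 arc_coeff_1_def del: sum.cl_ivl_Suc sum.lessThan_Suc)
      also have "\<dots> = arc_odd f h + (1 - s) * poly (Q.expansion d (n - 2)) s"
        unfolding JSuc linear Q.expansion_def poly_sum poly_smult sum_distrib_left m
        by (simp add: c1 lessThan_Suc_atMost mult.left_commute del: sum.cl_ivl_Suc sum.lessThan_Suc sum.atMost_Suc)
      finally show "arc_odd (\<lambda>x y. f x y - arc_partial_sum (-1) h n f x y) (x_of s) = (1 - s) * rQ (n - 2) s"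
        unfolding arc_odd_diff d[OF s] by (simp add: rQ_def right_diff_distrib)
    qed
    show "arc_inner (-1) h (\<lambda>x y. f x y - arc_partial_sum (-1) h n f x y) (\<lambda>x y. f x y - arc_partial_sum (-1) h n f x y) =
        ?c * (P.ip (rP (n - 1)) (rP (n - 1)) + (1 - h)\<^sup>2 * Q.ip (rQ (n - 2)) (rQ (n - 2)))"
    proof (rule arc_inner_parity[where m = "\<lambda>s. 1 - s" and \<beta> = 1, OF _ _ _ _ _ _ even odd even odd])
      fix a c s :: real assume s: "s \<in> {0<..<1}"
      have "(1 - s)\<^sup>2 * (1 - s) powr (-1) = (1 - s) powr 1"
        using s by (simp add: powr_minus power2_eq_square)
      then show "(1 - s)\<^sup>2 * sj_weight \<tau> a (-1) c s = sj_weight \<tau> a 1 c s"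
        unfolding sj_weight_def by (metis (no_types, opaque_lifting) mult.assoc mult.left_commute)
    qed (auto intro!: bounded_borel01_diff be bd simp: rP_def[abs_def] rQ_def[abs_def])
  next
    show "\<exists>C. \<forall>n. P.ip (rP n) (rP n) \<le> C / (\<rho> ^ n)\<^sup>2"
      using P.expansion_geom_convergence[OF ge \<rho>] by (simp add: rP_def[abs_def])
    show "\<exists>C. \<forall>n. Q.ip (rQ n) (rQ n) \<le> C / (\<rho> ^ n)\<^sup>2"
      using Q.expansion_geom_convergence[OF gd \<rho>] by (simp add: rQ_def[abs_def])
  qed auto
qed

end

theorem theorem5:
  fixes h \<phi> \<rho> :: real
    and f :: "real \<Rightarrow> real \<Rightarrow> real"
    and F :: "complex \<Rightarrow> complex"
  assumes h: "\<bar>h\<bar> < 1"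
    and \<phi>: "cos \<phi> = h" "0 < \<phi>" "\<phi> < pi"
    and \<rho>: "\<rho> > 1"
    and continuation: "\<And>\<theta>. \<theta> \<in> {-\<phi>..\<phi>} \<Longrightarrow>
          F (complex_of_real \<theta>) = complex_of_real (f (cos \<theta>) (sin \<theta>))"
    and analytic: "F analytic_on arc_region h \<rho>"
    and periodic: "\<And>\<theta>. \<theta> \<in> arc_region h \<rho> \<Longrightarrow> F (\<theta> + 2 * complex_of_real pi) = F \<theta>"
    and bounded: "bounded (F ` arc_region h \<rho>)"
  shows "\<forall>b\<ge>-1.
      (\<lambda>n. arc_norm b h (\<lambda>x y. f x y - arc_partial_sum b h n f x y)) \<in> O(\<lambda>n. 1 / \<rho> ^ n) \<and>
      (\<lambda>n. arc_coeff_1 b h f n) \<in> O(\<lambda>n. 1 / \<rho> ^ n) \<and>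
      (\<lambda>n. arc_coeff_2 b h f n) \<in> O(\<lambda>n. 1 / \<rho> ^ n)"
proof -
  interpret ellipse: arc_ellipse h \<rho>
    by unfold_locales (fact h, fact \<rho>)
  have arccos: "arccos h = \<phi>"
    using \<phi> by (auto intro: arccos_cos)
  have region: "arc_region h \<rho> = {\<theta>. cos \<theta> \<in> ellipse.E}"
    unfolding arc_region_def ellipse.open_ellipse_E ..
  interpret arc_continuation h \<rho> f F
  proof unfold_locales
    show "F (complex_of_real \<theta>) = complex_of_real (f (cos \<theta>) (sin \<theta>))"
      if "\<theta> \<in> {- arccos h..arccos h}" for \<theta>
      using continuation that unfolding arccos .
    show "F holomorphic_on {\<theta>. cos \<theta> \<in> ellipse.E}"
      using analytic_imp_holomorphic[OF analytic] unfolding region .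
    show "F (\<theta> + 2 * complex_of_real pi) = F \<theta>" if "cos \<theta> \<in> ellipse.E" for \<theta>
      using periodic[of \<theta>] that unfolding region by simp
    show "bounded (F ` {\<theta>. cos \<theta> \<in> ellipse.E})"
      using bounded unfolding region .
  qed
  show ?thesis
  proof (intro allI impI)
    fix b :: real assume "b \<ge> -1"
    then consider "b > -1" | "b = -1" by linarith
    then show "(\<lambda>n. arc_norm b h (\<lambda>x y. f x y - arc_partial_sum b h n f x y)) \<in> O(\<lambda>n. 1 / \<rho> ^ n) \<and>
      (\<lambda>n. arc_coeff_1 b h f n) \<in> O(\<lambda>n. 1 / \<rho> ^ n) \<and>
      (\<lambda>n. arc_coeff_2 b h f n) \<in> O(\<lambda>n. 1 / \<rho> ^ n)"
    proof cases
      case 1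
      then show ?thesis by (intro conjI convergence_orthogonal_case)
    next
      case 2
      show ?thesis unfolding 2 by (intro conjI convergence_minus_one)
    qed
  qed
qed

end
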